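(* Let $\mathcal E^n$ be the Gaussian statistical experiment described in the context, with parameter $(\vartheta,\sigma,\overline\sigma)\in(0,\infty)\times\Sigma(c,\tilde c)$. Let $\widehat\vartheta_n$ be an estimator of $\vartheta$ in the experiment $\mathcal E^n$ such that $\Delta_n^{-1/2}(\widehat\vartheta_n-\vartheta)$ converges to $\mathcal N\big(0,V_\vartheta(\sigma,\overline\sigma)\big)$ in distribution as $n\to\infty$ (under the law with parameter $(\vartheta,\sigma,\overline\sigma)$). Then $$V_\vartheta(\sigma,\overline\sigma)\ \ge\ V^{\mathrm{opt}}_\vartheta(\sigma,\overline\sigma)=\frac{1}{(T_2-T_1)^2}\,(e^{\vartheta T_2}-e^{\vartheta T_1})^2\Big(\int_0^T\frac{e^{2\vartheta t}\sigma_t^2}{\overline\sigma_t^2}\,dt\Big)^{-1}.$$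
   Context: Let $0<T\le T_1<T_2$ be known, $T$ fixed, and $\Delta_n=T/n$. The experiment $\mathcal E^n$ is generated by the data $(\Delta_i^nX^1,\Delta_i^nX^2)$, $i=1,\dots,n$, where $\Delta_i^nX^j=X^j_{i\Delta_n}-X^j_{(i-1)\Delta_n}$ and $$X^j_t=X^j_0+\int_0^te^{-\vartheta(T_j-s)}\sigma_s\,dB_s+\int_0^t\overline\sigma_s\,d\overline B_s,\qquad j=1,2,$$ with $X_0^j\in\mathbb R$, $B,\overline B$ independent Brownian motions, and unknown parameter $(\vartheta,\sigma,\overline\sigma)\in(0,\infty)\times\Sigma(c,\tilde c)$. Here, for fixed $\alpha\ge1/2$ and constants $c,\tilde c>0$, $\Sigma(c,\tilde c)$ is the space of pairs $(\sigma,\overline\sigma)$ of positive deterministic functions on $[0,T]$ such that $$(\sigma_t^2-\sigma_s^2)^2+(\overline\sigma_t^2-\overline\sigma_s^2)^2\le c\,|t-s|^{2\alpha}\quad\text{for all }s,t\in[0,T],$$ and $\tilde c\le\inf_t\sigma_t\le\sup_t\sigma_t\le c$, $\tilde c\le\inf_t\overline\sigma_t\le\sup_t\overline\sigma_t\le c$.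
   Formalization: The formal version assumes asymptotic normality along √Δₙ-local parameter sequences at every parameter (Hájek regularity; otherwise Hodges' estimator refutes the claim), α ≤ 1 (for α > 1 the volatilities are constant and the MLE beats the bound), and c̃ < c (for c̃ = c they are known). *)

theory Defs
  imports "HOL-Probability.Probability"
begin

section \<open>Brownian motion and the integral of a deterministic integrand\<close>

definition brownian_motion :: "'w measure \<Rightarrow> (real \<Rightarrow> 'w \<Rightarrow> real) \<Rightarrow> bool" where
  "brownian_motion M B \<longleftrightarrow>
     prob_space M
   \<and> (\<forall>t\<ge>0. B t \<in> borel_measurable M)
   \<and> (AE \<omega> in M. B 0 \<omega> = 0)
   \<and> (\<forall>s t. 0 \<le> s \<and> s < t \<longrightarrow>
        distributed M lborel (\<lambda>\<omega>. B t \<omega> - B s \<omega>) (\<lambda>x. ennreal (normal_density 0 (sqrt (t - s)) x)))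
   \<and> (\<forall>(s :: nat \<Rightarrow> real) m. mono s \<and> 0 \<le> s 0 \<longrightarrow>
        prob_space.indep_vars M (\<lambda>_. borel) (\<lambda>k \<omega>. B (s (Suc k)) \<omega> - B (s k) \<omega>) {..<m})
   \<and> (AE \<omega> in M. continuous_on {0..} (\<lambda>t. B t \<omega>))"

definition independent_processes ::
  "'w measure \<Rightarrow> (real \<Rightarrow> 'w \<Rightarrow> real) \<Rightarrow> (real \<Rightarrow> 'w \<Rightarrow> real) \<Rightarrow> bool" where
  "independent_processes M B B' \<longleftrightarrow>
     prob_space.indep_var M
       (Pi\<^sub>M {0..} (\<lambda>_. borel)) (\<lambda>\<omega>. \<lambda>t\<in>{0..}. B t \<omega>)
       (Pi\<^sub>M {0..} (\<lambda>_. borel)) (\<lambda>\<omega>. \<lambda>t\<in>{0..}. B' t \<omega>)"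

text \<open>The step function with value \<open>a k\<close> on \<open>(s k, s (k + 1)]\<close> for \<open>k < m\<close>, and its integral
  against \<open>B\<close>.\<close>

definition step_fun :: "nat \<Rightarrow> (nat \<Rightarrow> real) \<Rightarrow> (nat \<Rightarrow> real) \<Rightarrow> real \<Rightarrow> real" where
  "step_fun m s a u = (\<Sum>k<m. a k * indicator {s k<..s (Suc k)} u)"

definition step_integral ::
  "(real \<Rightarrow> 'w \<Rightarrow> real) \<Rightarrow> nat \<Rightarrow> (nat \<Rightarrow> real) \<Rightarrow> (nat \<Rightarrow> real) \<Rightarrow> 'w \<Rightarrow> real" where
  "step_integral B m s a \<omega> = (\<Sum>k<m. a k * (B (s (Suc k)) \<omega> - B (s k) \<omega>))"

text \<open>\<open>I\<close> is (a version of) the stochastic integral of the deterministic function \<open>f\<close> against \<open>B\<close>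
  over \<open>[0, t]\<close>: the mean-square limit of the integrals of step functions converging to \<open>f\<close> in
  \<open>L\<^sup>2[0, t]\<close>. Nonnegative integrals are used because they are not silently zero for
  non-integrable integrands.\<close>

definition has_stochastic_integral ::
  "'w measure \<Rightarrow> (real \<Rightarrow> 'w \<Rightarrow> real) \<Rightarrow> real \<Rightarrow> (real \<Rightarrow> real) \<Rightarrow> ('w \<Rightarrow> real) \<Rightarrow> bool" where
  "has_stochastic_integral M B t f I \<longleftrightarrow>
     set_borel_measurable lborel {0..t} f \<and> I \<in> borel_measurable M
   \<and> (\<exists>(m :: nat \<Rightarrow> nat) (s :: nat \<Rightarrow> nat \<Rightarrow> real) (a :: nat \<Rightarrow> nat \<Rightarrow> real).
        (\<forall>k. mono (s k) \<and> s k 0 = 0 \<and> s k (m k) = t)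
      \<and> (\<lambda>k. \<integral>\<^sup>+u\<in>{0..t}. ennreal ((step_fun (m k) (s k) (a k) u - f u)\<^sup>2) \<partial>lborel) \<longlonglongrightarrow> 0
      \<and> (\<lambda>k. \<integral>\<^sup>+\<omega>. ennreal ((step_integral B (m k) (s k) (a k) \<omega> - I \<omega>)\<^sup>2) \<partial>M) \<longlonglongrightarrow> 0)"

section \<open>The parameter set\<close>

text \<open>Functions on \<open>[0, T]\<close> are represented by total functions of which only the values on
  \<open>[0, T]\<close> are used. A parameter is a triple \<open>(\<theta>, \<sigma>, \<sigma>')\<close>, where \<open>\<sigma>'\<close> is the second volatility;
  the class \<open>\<Sigma>(c, c')\<close> has upper bound \<open>c\<close> (also the Hoelder constant) and lower bound \<open>c'\<close>.\<close>

type_synonym param = "real \<times> (real \<Rightarrow> real) \<times> (real \<Rightarrow> real)"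

definition volatility_class ::
  "real \<Rightarrow> real \<Rightarrow> real \<Rightarrow> real \<Rightarrow> ((real \<Rightarrow> real) \<times> (real \<Rightarrow> real)) set" where
  "volatility_class T \<alpha> c c' = {(\<sigma>, \<sigma>').
     (\<forall>t\<in>{0..T}. 0 < \<sigma> t \<and> 0 < \<sigma>' t)
   \<and> (\<forall>s\<in>{0..T}. \<forall>t\<in>{0..T}.
        ((\<sigma> t)\<^sup>2 - (\<sigma> s)\<^sup>2)\<^sup>2 + ((\<sigma>' t)\<^sup>2 - (\<sigma>' s)\<^sup>2)\<^sup>2 \<le> c * \<bar>t - s\<bar> powr (2 * \<alpha>))
   \<and> (\<forall>t\<in>{0..T}. c' \<le> \<sigma> t \<and> \<sigma> t \<le> c \<and> c' \<le> \<sigma>' t \<and> \<sigma>' t \<le> c)}"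

definition param_space :: "real \<Rightarrow> real \<Rightarrow> real \<Rightarrow> real \<Rightarrow> param set" where
  "param_space T \<alpha> c c' = {0<..} \<times> volatility_class T \<alpha> c c'"

section \<open>The model and the experiment\<close>

definition forward_price ::
  "'w measure \<Rightarrow> real \<Rightarrow> real \<Rightarrow> param \<Rightarrow> (real \<Rightarrow> 'w \<Rightarrow> real) \<Rightarrow> (real \<Rightarrow> 'w \<Rightarrow> real)
    \<Rightarrow> real \<Rightarrow> (real \<Rightarrow> 'w \<Rightarrow> real) \<Rightarrow> bool" where
  "forward_price M T x0 p B B' Tj X \<longleftrightarrow> (case p of (\<theta>, \<sigma>, \<sigma>') \<Rightarrow>
     \<forall>t\<in>{0..T}. X t \<in> borel_measurable M \<and>
       (\<exists>I J. has_stochastic_integral M B t (\<lambda>s. exp (- \<theta> * (Tj - s)) * \<sigma> s) I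
            \<and> has_stochastic_integral M B' t \<sigma>' J
            \<and> (AE \<omega> in M. X t \<omega> = x0 + I \<omega> + J \<omega>)))"

definition two_factor_model ::
  "'w measure \<Rightarrow> real \<Rightarrow> real \<Rightarrow> real \<Rightarrow> real \<Rightarrow> real \<Rightarrow> param
    \<Rightarrow> (real \<Rightarrow> 'w \<Rightarrow> real) \<Rightarrow> (real \<Rightarrow> 'w \<Rightarrow> real)
    \<Rightarrow> (real \<Rightarrow> 'w \<Rightarrow> real) \<Rightarrow> (real \<Rightarrow> 'w \<Rightarrow> real) \<Rightarrow> bool" where
  "two_factor_model M T T1 T2 x1 x2 p B B' X1 X2 \<longleftrightarrow>
     brownian_motion M B \<and> brownian_motion M B' \<and> independent_processes M B B'
   \<and> forward_price M T x1 p B B' T1 X1 \<and> forward_price M T x2 p B B' T2 X2"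

definition increment :: "real \<Rightarrow> nat \<Rightarrow> (real \<Rightarrow> 'w \<Rightarrow> real) \<Rightarrow> nat \<Rightarrow> 'w \<Rightarrow> real" where
  "increment T n X i \<omega> = X (real i * (T / real n)) \<omega> - X ((real i - 1) * (T / real n)) \<omega>"

abbreviation data_space :: "nat \<Rightarrow> (nat \<Rightarrow> real \<times> real) measure" where
  "data_space n \<equiv> Pi\<^sub>M {1..n} (\<lambda>_. borel)"

text \<open>The law of the observed increments; the experiment is the family of these laws when the
  parameter varies.\<close>

definition data_law ::
  "'w measure \<Rightarrow> real \<Rightarrow> nat \<Rightarrow> (real \<Rightarrow> 'w \<Rightarrow> real) \<Rightarrow> (real \<Rightarrow> 'w \<Rightarrow> real)
    \<Rightarrow> (nat \<Rightarrow> real \<times> real) measure" where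
  "data_law M T n X1 X2 =
     distr M (data_space n) (\<lambda>\<omega>. \<lambda>i\<in>{1..n}. (increment T n X1 i \<omega>, increment T n X2 i \<omega>))"

section \<open>Asymptotic normality and the efficiency bound\<close>

definition centered_normal :: "real \<Rightarrow> real measure" where
  "centered_normal v =
     (if v = 0 then return borel 0
      else density lborel (\<lambda>x. ennreal (normal_density 0 (sqrt v) x)))"

text \<open>Local sequences of parameters around \<open>p\<close> at the rate of estimation, along a fixed direction
  \<open>(h, f, g)\<close> in the coordinates \<open>(\<theta>, \<sigma>\<^sup>2, \<sigma>'\<^sup>2)\<close>. Direction zero gives the constant sequence \<open>p\<close>,
  so asymptotic normality along all local sequences (regularity in the sense of Hajek) includes
  asymptotic normality under the fixed parameter \<open>p\<close>.\<close>

definition local_sequence ::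
  "real \<Rightarrow> real \<Rightarrow> real \<Rightarrow> real \<Rightarrow> param \<Rightarrow> (nat \<Rightarrow> param) \<Rightarrow> bool" where
  "local_sequence T \<alpha> c c' p q \<longleftrightarrow>
     (\<forall>n. q n \<in> param_space T \<alpha> c c')
   \<and> (\<exists>h f g. \<forall>\<^sub>F n in sequentially.
        fst (q n) = fst p + sqrt (T / real n) * h
      \<and> (\<forall>t\<in>{0..T}. (fst (snd (q n)) t)\<^sup>2 = (fst (snd p) t)\<^sup>2 + sqrt (T / real n) * f t)
      \<and> (\<forall>t\<in>{0..T}. (snd (snd (q n)) t)\<^sup>2 = (snd (snd p) t)\<^sup>2 + sqrt (T / real n) * g t))"

definition V_opt :: "real \<Rightarrow> real \<Rightarrow> real \<Rightarrow> param \<Rightarrow> real" where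
  "V_opt T T1 T2 p = (case p of (\<theta>, \<sigma>, \<sigma>') \<Rightarrow>
     1 / (T2 - T1)\<^sup>2 * (exp (\<theta> * T2) - exp (\<theta> * T1))\<^sup>2
       * inverse (integral {0..T} (\<lambda>t. exp (2 * \<theta> * t) * (\<sigma> t)\<^sup>2 / (\<sigma>' t)\<^sup>2)))"

end

(*
  Put D = Delta X^1 - Delta X^2.  The second factor cancels in D, so D ~ N(0, A) with
  A = k(theta)^2 * integral of exp(2 theta s) sigma(s)^2 over the cell, where
  k(theta) = exp(-theta T1) - exp(-theta T2), and Delta X^2 = rho(theta) D + (noise independent of D)
  with rho = exp(-theta T2) / k.  The data are therefore independent Gaussian regressions.
  A perturbation of theta at the rate sqrt(T/n) is visible through A and through rho, but sigma^2 can be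
  perturbed at the same rate so that A does not change to first order; then only the regression slope
  carries information, and the chi-square divergence between the two experiments tends to
  exp(h^2 / V_opt) - 1.  By the Cauchy-Schwarz inequality (as in the Hammersley-Chapman-Robbins bound),
  applied to the bounded function sin(u Z) of the rescaled estimation error Z, whose limit laws along both
  sequences are known, one gets h^2 <= V (exp(h^2 / V_opt) - 1) after u -> 0, and the claim after h -> 0.
*)

theory Submission
  imports Defs
begin

section \<open>Wiener integrals of step functions\<close>

text \<open>Two obstacles shape the proof. First, the parameter may lie on the boundary of the
  volatility class, where the least favourable direction can leave the class. Both sequences are
  therefore also pulled, by the same rule, towards a constant \<open>m\<close> halfway between the
  squared bounds; convexity in the squared volatilities keeps them admissible, and the pull changes
  signal-to-noise ratios only by a factor 1 + O(sqrt (T / n)). The conditions \<open>c' < c\<close>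
  and \<alpha> \<le> 1 give the tilt room in the class. Second, an estimator need not have moments,
  so only the characteristic functions of its limit laws are available; sin (u Z) is bounded, odd
  and close to u Z for small u. The chi-square divergence suits independent cells because 1 +
  chi-square is multiplicative: a cell contributes 1 / sqrt (1 - x) with x of order 1/n, and the x
  add up to an integral of the signal-to-noise ratio. Normality and independence of the increments
  are derived through characteristic functions, since the stochastic integrals are given only as
  mean-square limits.\<close>

lemma char_normal:
  assumes "0 < \<sigma>"
  shows "char (density lborel (normal_density 0 \<sigma>)) u = of_real (exp (- (u * \<sigma>)\<^sup>2 / 2))"
proof -
  interpret S: real_distribution std_normal_distribution
    by (rule real_dist_normal_dist)
  have "distributed std_normal_distribution lborel (\<lambda>x. x) (normal_density 0 1)"
    by (auto simp: distributed_def distr_id2 cong: distr_cong)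
  from S.normal_density_affine[OF this, of \<sigma> 0] assms
  have "distributed std_normal_distribution lborel (\<lambda>x. \<sigma> * x) (normal_density 0 \<sigma>)"
    by simp
  then have eq: "density lborel (normal_density 0 \<sigma>) = distr std_normal_distribution lborel (\<lambda>x. \<sigma> * x)"
    by (simp add: distributed_def)
  have "char (density lborel (normal_density 0 \<sigma>)) u = char std_normal_distribution (u * \<sigma>)"
    unfolding eq char_def by (subst integral_distr) (auto simp: mult_ac)
  then show ?thesis
    by (simp add: char_std_normal_distribution)
qed

section \<open>Combinations of process values and the step functions they integrate\<close>

text \<open>One list codes both a step function and its integral: for a path starting at 0,
  \<open>lincomb\<close> is the integral of \<open>step_of\<close>. Concatenation adds both at once,
  so two step functions never need a common partition.\<close>

definition lincomb :: "(real \<times> real) list \<Rightarrow> (real \<Rightarrow> real) \<Rightarrow> real" where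
  "lincomb L b = (\<Sum>(c, t)\<leftarrow>L. c * b t)"

definition step_of :: "(real \<times> real) list \<Rightarrow> real \<Rightarrow> real" where
  "step_of L u = (\<Sum>(c, t)\<leftarrow>L. c * indicator {0<..t} u)"

lemma lincomb_append: "lincomb (L @ L') b = lincomb L b + lincomb L' b"
  by (simp add: lincomb_def)

lemma step_of_append: "step_of (L @ L') u = step_of L u + step_of L' u"
  by (simp add: step_of_def)

lemma lincomb_scale: "lincomb (map (\<lambda>(c, t). (r * c, t)) L) b = r * lincomb L b"
  by (induction L) (auto simp: lincomb_def algebra_simps)

lemma step_of_scale: "step_of (map (\<lambda>(c, t). (r * c, t)) L) u = r * step_of L u"
  by (induction L) (auto simp: step_of_def algebra_simps)

lemma measurable_step_of [measurable]: "step_of L \<in> borel_measurable borel"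
proof (induction L)
  case (Cons x L)
  have "step_of (x # L) = (\<lambda>u. fst x * indicator {0<..snd x} u + step_of L u)"
    by (auto simp: step_of_def split_beta)
  with Cons show ?case by simp
qed (simp add: step_of_def)

lemma measurable_lincomb:
  assumes "\<And>c t. (c, t) \<in> set L \<Longrightarrow> X t \<in> borel_measurable M"
  shows "(\<lambda>\<omega>. lincomb L (\<lambda>t. X t \<omega>)) \<in> borel_measurable M"
  using assms
proof (induction L)
  case (Cons x L)
  have [measurable]: "X (snd x) \<in> borel_measurable M" "(\<lambda>\<omega>. lincomb L (\<lambda>t. X t \<omega>)) \<in> borel_measurable M"
    using Cons.prems[of "fst x" "snd x"] Cons.IH Cons.prems by auto
  have "(\<lambda>\<omega>. lincomb (x # L) (\<lambda>t. X t \<omega>)) = (\<lambda>\<omega>. fst x * X (snd x) \<omega> + lincomb L (\<lambda>t. X t \<omega>))"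
    by (auto simp: lincomb_def split_beta)
  then show ?case by simp
qed (simp add: lincomb_def)

text \<open>The cells before index j are selected by the value test \<open>s k < s j\<close> instead
  of k < j, so that the selection depends on the time alone. The cells on which the two tests differ
  have length zero and a zero increment.\<close>

lemma sum_telescope_partition:
  fixes s :: "nat \<Rightarrow> real" and g :: "real \<Rightarrow> 'b::real_vector"
  assumes "mono s" "j \<le> m"
  shows "(\<Sum>k<m. of_bool (s k < s j) *\<^sub>R (g (s (Suc k)) - g (s k))) = g (s j) - g (s 0)"
proof -
  have "(\<Sum>k<m. of_bool (s k < s j) *\<^sub>R (g (s (Suc k)) - g (s k))) = (\<Sum>k<j. g (s (Suc k)) - g (s k))"
  proof (rule sum.mono_neutral_cong_right)
    show "\<forall>k\<in>{..<m} - {..<j}. of_bool (s k < s j) *\<^sub>R (g (s (Suc k)) - g (s k)) = 0"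
      using monoD[OF assms(1)] by (auto simp: not_less)
    show "of_bool (s k < s j) *\<^sub>R (g (s (Suc k)) - g (s k)) = g (s (Suc k)) - g (s k)"
      if "k \<in> {..<j}" for k
    proof (cases "s k < s j")
      case False
      with that have "s (Suc k) = s k"
        using monoD[OF assms(1), of k "Suc k"] monoD[OF assms(1), of "Suc k" j] by auto
      then show ?thesis by simp
    qed simp
  qed (use assms in auto)
  also have "\<dots> = g (s j) - g (s 0)"
    by (rule sum_lessThan_telescope)
  finally show ?thesis .
qed

text \<open>The value on a cell is the total coefficient of the times to the right of its left end.
  The function g is arbitrary because the identity serves twice: for a Brownian path and for the map
  from t to \<open>indicator {0<..t} u\<close>.\<close>

lemma lincomb_partition:
  fixes g :: "real \<Rightarrow> real"
  assumes "mono s" and "\<And>c t. (c, t) \<in> set L \<Longrightarrow> \<exists>j\<le>m. t = s j"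
  defines "a \<equiv> \<lambda>k. \<Sum>(c, t)\<leftarrow>L. c * of_bool (s k < t)"
  shows "(\<Sum>(c, t)\<leftarrow>L. c * (g t - g (s 0))) = (\<Sum>k<m. a k * (g (s (Suc k)) - g (s k)))"
  using assms(2) unfolding a_def
proof (induction L)
  case (Cons x L)
  obtain c t where x: "x = (c, t)" by fastforce
  with Cons.prems obtain j where j: "j \<le> m" "t = s j" by auto
  have "c * (g t - g (s 0)) = c * (\<Sum>k<m. of_bool (s k < s j) *\<^sub>R (g (s (Suc k)) - g (s k)))"
    using sum_telescope_partition[OF assms(1) j(1), of g] j by simp
  moreover have "(\<Sum>(c, t)\<leftarrow>L. c * (g t - g (s 0)))
      = (\<Sum>k<m. (\<Sum>(c, t)\<leftarrow>L. c * of_bool (s k < t)) * (g (s (Suc k)) - g (s k)))"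
    by (rule Cons.IH) (use Cons.prems in auto)
  ultimately show ?case
    by (simp add: x j(2)[symmetric] sum_distrib_left distrib_right sum.distrib mult.assoc
        del: sum_mult_of_bool_eq sum_of_bool_mult_eq)
qed simp

lemma exists_partition:
  fixes A :: "real set"
  assumes "finite A" "\<And>t. t \<in> A \<Longrightarrow> 0 \<le> t"
  shows "\<exists>s m. mono s \<and> s 0 = 0 \<and> (\<forall>t\<in>A. \<exists>j\<le>m. t = s (j::nat))"
proof -
  define xs where "xs = sorted_list_of_set (insert 0 A)"
  define m where "m = length xs - 1"
  \<comment> \<open>Staying at the last point keeps \<open>s\<close> monotone on all indices, as the
    independence clause of \<open>brownian_motion\<close> demands.\<close>
  define s where "s k = xs ! min k m" for k
  have fin: "finite (insert 0 A)" using assms by simp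
  have xs: "set xs = insert 0 A" "sorted xs"
    using fin unfolding xs_def by (auto simp del: sorted_list_of_set_insert_remove)
  then have ne: "xs \<noteq> []" by auto
  have "mono s"
    unfolding s_def m_def using ne xs(2)
    by (intro monoI sorted_nth_mono) (auto simp: min_def Suc_diff_le simp flip: length_greater_0_conv)
  moreover have ex: "\<exists>j\<le>m. t = s j" if t: "t \<in> insert 0 A" for t
  proof -
    from t xs obtain j where "j < length xs" "xs ! j = t" by (metis in_set_conv_nth)
    then show ?thesis by (intro exI[of _ j]) (auto simp: s_def m_def)
  qed
  moreover have "s 0 = 0"
  proof -
    obtain j where "0 = s j" using ex[of 0] by auto
    then have "s 0 \<le> 0" using monoD[OF \<open>mono s\<close>, of 0 j] by simp
    moreover have "s 0 \<in> insert 0 A"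
      using ne xs(1) unfolding s_def by (metis min_0L nth_mem length_greater_0_conv)
    ultimately show ?thesis using assms(2) by force
  qed
  ultimately show ?thesis by blast
qed

text \<open>Distinct cells of a monotone partition are disjoint, so the mixed products
  vanish.\<close>

lemma step_fun_square:
  assumes "mono s"
  shows "(step_fun m s a u)\<^sup>2 = step_fun m s (\<lambda>k. (a k)\<^sup>2) u"
proof -
  have disj: "indicator {s k<..s (Suc k)} u * indicator {s l<..s (Suc l)} u = (0::real)" if "k \<noteq> l" for k l
  proof -
    have "s (Suc k) \<le> s l \<or> s (Suc l) \<le> s k"
      using that monoD[OF assms, of "Suc k" l] monoD[OF assms, of "Suc l" k] by (cases "k < l") auto
    then show ?thesis by (auto simp: indicator_def)
  qed
  have "(step_fun m s a u)\<^sup>2 = (\<Sum>k<m. \<Sum>l<m. a k * indicator {s k<..s (Suc k)} u * (a l * indicator {s l<..s (Suc l)} u))"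
    unfolding step_fun_def power2_eq_square sum_product ..
  also have "\<dots> = (\<Sum>k<m. \<Sum>l<m. if l = k then (a k)\<^sup>2 * indicator {s k<..s (Suc k)} u else 0)"
    using disj by (intro sum.cong refl) (auto simp: power2_eq_square indicator_def)
  also have "\<dots> = step_fun m s (\<lambda>k. (a k)\<^sup>2) u"
    by (simp add: step_fun_def)
  finally show ?thesis .
qed

lemma integral_step_fun:
  assumes "mono s"
  shows "integrable lborel (step_fun m s a)" "(\<integral>u. step_fun m s a u \<partial>lborel) = (\<Sum>k<m. a k * (s (Suc k) - s k))"
proof -
  have mono: "s k \<le> s (Suc k)" for k
    using monoD[OF assms, of k "Suc k"] by simp
  have int: "integrable lborel (\<lambda>u. a k * indicator {s k<..s (Suc k)} u)" for k
    using mono[of k] by (intro integrable_mult_right integrable_real_indicator) auto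
  then show "integrable lborel (step_fun m s a)"
    unfolding step_fun_def by (rule Bochner_Integration.integrable_sum)
  show "(\<integral>u. step_fun m s a u \<partial>lborel) = (\<Sum>k<m. a k * (s (Suc k) - s k))"
    unfolding step_fun_def using mono
    by (subst Bochner_Integration.integral_sum[OF int]) (intro sum.cong refl, simp)
qed

lemma step_of_eq_step_fun:
  assumes "mono s" "s 0 = 0" and "\<And>c t. (c, t) \<in> set L \<Longrightarrow> \<exists>j\<le>m. t = s j"
  shows "step_of L u = step_fun m s (\<lambda>k. \<Sum>(c, t)\<leftarrow>L. c * of_bool (s k < t)) u"
proof -
  have mono: "s k \<le> s (Suc k)" "0 \<le> s k" for k
    using monoD[OF assms(1), of k "Suc k"] monoD[OF assms(1), of 0 k] assms(2) by auto
  have "step_of L u = (\<Sum>(c, t)\<leftarrow>L. c * (indicator {0<..t} u - indicator {0<..s 0} u))"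
    by (simp add: step_of_def assms(2))
  also have "\<dots> = (\<Sum>k<m. (\<Sum>(c, t)\<leftarrow>L. c * of_bool (s k < t)) * (indicator {0<..s (Suc k)} u - indicator {0<..s k} u))"
    by (rule lincomb_partition[OF assms(1)]) (use assms in auto)
  also have "\<dots> = step_fun m s (\<lambda>k. \<Sum>(c, t)\<leftarrow>L. c * of_bool (s k < t)) u"
    unfolding step_fun_def by (intro sum.cong refl arg_cong2[where f="(*)"])
      (use mono in \<open>auto simp: indicator_def dest: less_le_trans le_less_trans order_trans\<close>, smt (verit, best) mono)
  finally show ?thesis .
qed

section \<open>Characteristic functions of Brownian step integrals\<close>

lemma brownian_increment_char:
  assumes bm: "brownian_motion M B" and st: "0 \<le> s" "s \<le> t"
  shows "(\<integral>\<omega>. iexp (a * (B t \<omega> - B s \<omega>)) \<partial>M) = of_real (exp (- (a\<^sup>2 * (t - s)) / 2))"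
proof (cases "s = t")
  case True
  interpret prob_space M using bm by (simp add: brownian_motion_def)
  from True show ?thesis by (simp add: prob_space)
next
  case False
  with st have "s < t" by simp
  interpret prob_space M using bm by (simp add: brownian_motion_def)
  have [measurable]: "B t \<in> borel_measurable M" "B s \<in> borel_measurable M"
    using bm st by (auto simp: brownian_motion_def)
  have "distributed M lborel (\<lambda>\<omega>. B t \<omega> - B s \<omega>) (\<lambda>x. ennreal (normal_density 0 (sqrt (t - s)) x))"
    using bm st \<open>s < t\<close> by (simp add: brownian_motion_def)
  then have "distr M lborel (\<lambda>\<omega>. B t \<omega> - B s \<omega>) = density lborel (normal_density 0 (sqrt (t - s)))"
    by (simp add: distributed_def)
  moreover have "(\<integral>\<omega>. iexp (a * (B t \<omega> - B s \<omega>)) \<partial>M) = char (distr M lborel (\<lambda>\<omega>. B t \<omega> - B s \<omega>)) a"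
    unfolding char_def by (subst integral_distr) auto
  ultimately show ?thesis
    using \<open>s < t\<close> by (simp add: char_normal power_mult_distrib)
qed

text \<open>On a partition through all times of \<open>L\<close> the combination becomes a sum of
  independent centred increments. Their variances add up to the integral of the squared step
  function, which is the Ito isometry for step functions.\<close>

lemma brownian_lincomb_char:
  assumes bm: "brownian_motion M B" and L: "\<And>c t. (c, t) \<in> set L \<Longrightarrow> 0 \<le> t"
  shows "(\<integral>\<omega>. iexp (lincomb L (\<lambda>t. B t \<omega>)) \<partial>M) = of_real (exp (- (\<integral>u. (step_of L u)\<^sup>2 \<partial>lborel) / 2))"
    and "integrable lborel (\<lambda>u. (step_of L u)\<^sup>2)"
proof -
  interpret prob_space M using bm by (simp add: brownian_motion_def)
  have B [measurable]: "B t \<in> borel_measurable M" if "0 \<le> t" for t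
    using bm that by (auto simp: brownian_motion_def)
  obtain s m where s: "mono s" "s 0 = 0" "\<And>c t. (c, t) \<in> set L \<Longrightarrow> \<exists>j\<le>m. t = s (j::nat)"
    using exists_partition[of "snd ` set L"] L by fastforce
  have s0: "0 \<le> s k" for k using monoD[OF s(1), of 0 k] s(2) by simp
  define a where "a k = (\<Sum>(c, t)\<leftarrow>L. c * of_bool (s k < t))" for k
  have step: "step_of L u = step_fun m s a u" for u
    unfolding a_def by (rule step_of_eq_step_fun[OF s])
  show "integrable lborel (\<lambda>u. (step_of L u)\<^sup>2)"
    by (simp add: step step_fun_square[OF s(1)] integral_step_fun[OF s(1)])
  \<comment> \<open>The partition identity concerns B t - B 0, and B 0 = 0 holds only almost
    surely.\<close>
  have AE: "AE \<omega> in M. lincomb L (\<lambda>t. B t \<omega>) = (\<Sum>k<m. a k * (B (s (Suc k)) \<omega> - B (s k) \<omega>))"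
  proof -
    have "AE \<omega> in M. B 0 \<omega> = 0" using bm by (simp add: brownian_motion_def)
    then show ?thesis
    proof eventually_elim
      case (elim \<omega>)
      have "lincomb L (\<lambda>t. B t \<omega>) = (\<Sum>(c, t)\<leftarrow>L. c * (B t \<omega> - B (s 0) \<omega>))"
        by (simp add: lincomb_def s(2) elim)
      also have "\<dots> = (\<Sum>k<m. a k * (B (s (Suc k)) \<omega> - B (s k) \<omega>))"
        unfolding a_def by (rule lincomb_partition[OF s(1)]) (use s(3) in auto)
      finally show ?case .
    qed
  qed
  have "(\<integral>\<omega>. iexp (lincomb L (\<lambda>t. B t \<omega>)) \<partial>M) = (\<integral>\<omega>. iexp (\<Sum>k<m. a k * (B (s (Suc k)) \<omega> - B (s k) \<omega>)) \<partial>M)"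
  proof (rule integral_cong_AE)
    have "(\<lambda>\<omega>. lincomb L (\<lambda>t. B t \<omega>)) \<in> borel_measurable M"
      by (intro measurable_lincomb B L)
    then show "(\<lambda>\<omega>. iexp (lincomb L (\<lambda>t. B t \<omega>))) \<in> borel_measurable M"
      by measurable
    have [measurable]: "B (s k) \<in> borel_measurable M" for k
      by (intro B s0)
    show "(\<lambda>\<omega>. iexp (\<Sum>k<m. a k * (B (s (Suc k)) \<omega> - B (s k) \<omega>))) \<in> borel_measurable M"
      by measurable
  qed (use AE in auto)
  also have "\<dots> = (\<integral>\<omega>. (\<Prod>k<m. iexp (a k * (B (s (Suc k)) \<omega> - B (s k) \<omega>))) \<partial>M)"
    by (simp only: of_real_sum sum_distrib_left exp_sum finite_lessThan)
  also have "\<dots> = (\<Prod>k<m. \<integral>\<omega>. iexp (a k * (B (s (Suc k)) \<omega> - B (s k) \<omega>)) \<partial>M)"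
  proof (rule indep_vars_lebesgue_integral)
    have "indep_vars (\<lambda>_. borel) (\<lambda>k \<omega>. B (s (Suc k)) \<omega> - B (s k) \<omega>) {..<m}"
      using bm s(1) s0 by (simp add: brownian_motion_def)
    then show "indep_vars (\<lambda>_. borel) (\<lambda>k \<omega>. iexp (a k * (B (s (Suc k)) \<omega> - B (s k) \<omega>))) {..<m}"
      by (rule indep_vars_compose2[where Y="\<lambda>k x. iexp (a k * x)"]) auto
    show "integrable M (\<lambda>\<omega>. iexp (a k * (B (s (Suc k)) \<omega> - B (s k) \<omega>)))" for k
      using s0 by (intro integrable_iexp) (auto intro!: borel_measurable_times borel_measurable_diff B)
  qed simp
  also have "\<dots> = (\<Prod>k<m. of_real (exp (- ((a k)\<^sup>2 * (s (Suc k) - s k)) / 2)))"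
    using s0 monoD[OF s(1)] by (intro prod.cong refl brownian_increment_char[OF bm]) auto
  also have "\<dots> = of_real (exp (- (\<Sum>k<m. (a k)\<^sup>2 * (s (Suc k) - s k)) / 2))"
    by (simp add: sum_divide_distrib sum_negf[symmetric] exp_sum del: of_real_exp sum_negf flip: of_real_prod)
  also have "(\<Sum>k<m. (a k)\<^sup>2 * (s (Suc k) - s k)) = (\<integral>u. (step_of L u)\<^sup>2 \<partial>lborel)"
    by (simp add: step step_fun_square[OF s(1)] integral_step_fun[OF s(1)])
  finally show "(\<integral>\<omega>. iexp (lincomb L (\<lambda>t. B t \<omega>)) \<partial>M) = of_real (exp (- (\<integral>u. (step_of L u)\<^sup>2 \<partial>lborel) / 2))" .
qed

lemma independent_lincomb_char:
  assumes bm: "brownian_motion M B" "brownian_motion M B'" and ind: "independent_processes M B B'"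
    and L: "\<And>c t. (c, t) \<in> set L \<Longrightarrow> 0 \<le> t" and L': "\<And>c t. (c, t) \<in> set L' \<Longrightarrow> 0 \<le> t"
  shows "(\<integral>\<omega>. iexp (lincomb L (\<lambda>t. B t \<omega>) + lincomb L' (\<lambda>t. B' t \<omega>)) \<partial>M)
    = of_real (exp (- ((\<integral>u. (step_of L u)\<^sup>2 \<partial>lborel) + (\<integral>u. (step_of L' u)\<^sup>2 \<partial>lborel)) / 2))"
proof -
  interpret prob_space M using bm by (simp add: brownian_motion_def)
  have B: "B t \<in> borel_measurable M" "B' t \<in> borel_measurable M" if "0 \<le> t" for t
    using bm that by (auto simp: brownian_motion_def)
  have meas: "(\<lambda>b. iexp (lincomb K b)) \<in> borel_measurable (Pi\<^sub>M {0..} (\<lambda>_. borel))"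
    if "\<And>c t. (c, t) \<in> set K \<Longrightarrow> 0 \<le> t" for K
    by (rule measurable_compose[OF measurable_lincomb[where X="\<lambda>t b. b t"]])
      (use that in \<open>auto intro!: measurable_component_singleton\<close>)
  \<comment> \<open>Independence is given for the paths restricted to nonnegative times; the
    combinations read only such times and thus factor through the restriction.\<close>
  have eq: "lincomb K (restrict b {0..}) = lincomb K b" if "\<And>c t. (c, t) \<in> set K \<Longrightarrow> 0 \<le> t" for K b
    unfolding lincomb_def by (intro arg_cong[where f=sum_list] map_cong) (use that in auto)
  have "indep_var borel ((\<lambda>b. iexp (lincomb L b)) \<circ> (\<lambda>\<omega>. \<lambda>t\<in>{0..}. B t \<omega>))
      borel ((\<lambda>b. iexp (lincomb L' b)) \<circ> (\<lambda>\<omega>. \<lambda>t\<in>{0..}. B' t \<omega>))"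
    by (rule indep_var_compose[OF ind[unfolded independent_processes_def]]) (use L L' in \<open>blast intro: meas\<close>)+
  then have *: "indep_var borel (\<lambda>\<omega>. iexp (lincomb L (\<lambda>t. B t \<omega>))) borel (\<lambda>\<omega>. iexp (lincomb L' (\<lambda>t. B' t \<omega>)))"
    by (simp add: comp_def eq[OF L] eq[OF L'])
  have int: "integrable M (\<lambda>\<omega>. iexp (lincomb L (\<lambda>t. B t \<omega>)))" "integrable M (\<lambda>\<omega>. iexp (lincomb L' (\<lambda>t. B' t \<omega>)))"
    using measurable_lincomb[of L B M] measurable_lincomb[of L' B' M] B L L' by (auto intro!: integrable_iexp)
  have "(\<integral>\<omega>. iexp (lincomb L (\<lambda>t. B t \<omega>) + lincomb L' (\<lambda>t. B' t \<omega>)) \<partial>M)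
    = (\<integral>\<omega>. iexp (lincomb L (\<lambda>t. B t \<omega>)) * iexp (lincomb L' (\<lambda>t. B' t \<omega>)) \<partial>M)"
    by (simp add: distrib_left exp_add)
  also have "\<dots> = (\<integral>\<omega>. iexp (lincomb L (\<lambda>t. B t \<omega>)) \<partial>M) * (\<integral>\<omega>. iexp (lincomb L' (\<lambda>t. B' t \<omega>)) \<partial>M)"
    by (rule indep_var_lebesgue_integral[OF * int])
  also have "\<dots> = of_real (exp (- ((\<integral>u. (step_of L u)\<^sup>2 \<partial>lborel) + (\<integral>u. (step_of L' u)\<^sup>2 \<partial>lborel)) / 2))"
    by (simp only: brownian_lincomb_char(1)[OF bm(1) L] brownian_lincomb_char(1)[OF bm(2) L'] of_real_mult[symmetric]
        exp_add[symmetric] add_divide_distrib minus_add_distrib)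
  finally show ?thesis .
qed

section \<open>Wiener integrals as mean-square limits\<close>

abbreviation L2_converges :: "'a measure \<Rightarrow> (nat \<Rightarrow> 'a \<Rightarrow> real) \<Rightarrow> ('a \<Rightarrow> real) \<Rightarrow> bool" where
  "L2_converges M f z \<equiv> (\<lambda>k. \<integral>\<^sup>+x. ennreal ((f k x - z x)\<^sup>2) \<partial>M) \<longlonglongrightarrow> 0"

text \<open>Unlike \<open>has_stochastic_integral\<close> this has no end point: integrands live on
  the whole line, so integrals over different cells can be added.\<close>

definition wiener_integral :: "'w measure \<Rightarrow> (real \<Rightarrow> 'w \<Rightarrow> real) \<Rightarrow> (real \<Rightarrow> real) \<Rightarrow> ('w \<Rightarrow> real) \<Rightarrow> bool" where
  "wiener_integral M B z Z \<longleftrightarrow> z \<in> borel_measurable borel \<and> Z \<in> borel_measurable M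
    \<and> (\<exists>L. (\<forall>k. \<forall>(c, t)\<in>set (L k). 0 \<le> t)
      \<and> L2_converges lborel (\<lambda>k. step_of (L k)) z
      \<and> L2_converges M (\<lambda>k \<omega>. lincomb (L k) (\<lambda>t. B t \<omega>)) Z)"

lemma has_stochastic_integral_imp_wiener:
  assumes "has_stochastic_integral M B t f I" "0 \<le> t"
  shows "wiener_integral M B (\<lambda>u. indicator {0..t} u * f u) I"
proof -
  obtain m :: "nat \<Rightarrow> nat" and s a where
    s': "\<forall>k. mono (s k) \<and> s k 0 = 0 \<and> s k (m k) = t" and
    lim1: "(\<lambda>k. \<integral>\<^sup>+u\<in>{0..t}. ennreal ((step_fun (m k) (s k) (a k) u - f u)\<^sup>2) \<partial>lborel) \<longlonglongrightarrow> 0" and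
    lim2: "(\<lambda>k. \<integral>\<^sup>+\<omega>. ennreal ((step_integral B (m k) (s k) (a k) \<omega> - I \<omega>)\<^sup>2) \<partial>M) \<longlonglongrightarrow> 0"
    using assms(1) unfolding has_stochastic_integral_def by (elim conjE exE) (rule that)
  have s: "mono (s k)" "s k 0 = 0" "s k (m k) = t" for k
    using s' by auto
  \<comment> \<open>A cell is the difference of two intervals starting at 0, hence two list entries
    with opposite coefficients.\<close>
  define L where "L k = concat (map (\<lambda>j. [(a k j, s k (Suc j)), (- a k j, s k j)]) [0..<m k])" for k
  have s0: "0 \<le> s k j" "s k j \<le> s k (Suc j)" for k j
    using monoD[OF s(1), of 0 j k] monoD[OF s(1), of j "Suc j" k] s(2)[of k] by auto
  have st: "s k (Suc j) \<le> t" if "j < m k" for k j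
    using monoD[OF s(1), of "Suc j" "m k" k] that s(3)[of k] by auto
  have lin: "lincomb (L k) b = (\<Sum>j<m k. a k j * (b (s k (Suc j)) - b (s k j)))" for k b
  proof -
    have "lincomb (concat (map (\<lambda>j. [(a k j, s k (Suc j)), (- a k j, s k j)]) [0..<n])) b
        = (\<Sum>j<n. a k j * (b (s k (Suc j)) - b (s k j)))" for n
      by (induction n) (simp_all add: lincomb_append, simp_all add: lincomb_def right_diff_distrib)
    then show ?thesis by (simp add: L_def)
  qed
  have step: "step_of (L k) u = step_fun (m k) (s k) (a k) u" for k u
  proof -
    have "step_of (L k) u = lincomb (L k) (\<lambda>t. indicator {0<..t} u)"
      by (simp add: step_of_def lincomb_def)
    also have "\<dots> = step_fun (m k) (s k) (a k) u"
      unfolding lin step_fun_def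
    proof (intro sum.cong refl arg_cong2[where f="(*)"])
      fix j
      show "indicator {0<..s k (Suc j)} u - indicator {0<..s k j} u = (indicator {s k j<..s k (Suc j)} u :: real)"
        using s0[of k j] by (auto simp: indicator_def)
    qed
    finally show ?thesis .
  qed
  \<comment> \<open>The approximants vanish off [0, t], as does the truncated integrand, so the
    mean-square distance over the whole line is the one over [0, t].\<close>
  have supp: "step_fun (m k) (s k) (a k) u = 0" if "u \<notin> {0..t}" for k u
    unfolding step_fun_def
  proof (intro sum.neutral ballI)
    fix j assume "j \<in> {..<m k}"
    then have "u \<notin> {s k j<..s k (Suc j)}" using that s0(1)[of k j] st[of j k] by auto
    then show "a k j * indicator {s k j<..s k (Suc j)} u = 0" by simp
  qed
  have "(\<integral>\<^sup>+u. ennreal ((step_of (L k) u - indicator {0..t} u * f u)\<^sup>2) \<partial>lborel)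
      = (\<integral>\<^sup>+u\<in>{0..t}. ennreal ((step_fun (m k) (s k) (a k) u - f u)\<^sup>2) \<partial>lborel)" for k
    using supp[of _ k] by (intro nn_integral_cong) (auto simp: step indicator_def)
  moreover have "lincomb (L k) (\<lambda>t. B t \<omega>) = step_integral B (m k) (s k) (a k) \<omega>" for k \<omega>
    by (simp add: lin step_integral_def)
  moreover have "\<forall>k. \<forall>(c, t)\<in>set (L k). 0 \<le> t"
    using s0 by (auto simp: L_def)
  ultimately show ?thesis
    using assms lim1 lim2 unfolding wiener_integral_def has_stochastic_integral_def set_borel_measurable_def
    by (auto intro!: exI[of _ L])
qed

lemma L2_tendsto_add:
  assumes [measurable]: "\<And>k::nat. f k \<in> borel_measurable M" "\<And>k. g k \<in> borel_measurable M"
    "z \<in> borel_measurable M" "w \<in> borel_measurable M"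
  assumes f: "L2_converges M f z"
    and g: "L2_converges M g w"
  shows "(\<lambda>k. \<integral>\<^sup>+x. ennreal ((f k x + g k x - (z x + w x))\<^sup>2) \<partial>M) \<longlonglongrightarrow> 0"
proof (rule tendsto_sandwich[OF _ _ tendsto_const])
  have "(\<integral>\<^sup>+x. ennreal ((f k x + g k x - (z x + w x))\<^sup>2) \<partial>M)
      \<le> (\<integral>\<^sup>+x. 2 * ennreal ((f k x - z x)\<^sup>2) + 2 * ennreal ((g k x - w x)\<^sup>2) \<partial>M)" for k
  proof (rule nn_integral_mono)
    fix x
    have "(f k x + g k x - (z x + w x))\<^sup>2 \<le> 2 * (f k x - z x)\<^sup>2 + 2 * (g k x - w x)\<^sup>2"
      using sum_squares_bound[of "f k x - z x" "g k x - w x"] by (simp add: power2_eq_square algebra_simps)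
    then have "ennreal ((f k x + g k x - (z x + w x))\<^sup>2) \<le> ennreal (2 * (f k x - z x)\<^sup>2 + 2 * (g k x - w x)\<^sup>2)"
      by (rule ennreal_leI)
    then show "ennreal ((f k x + g k x - (z x + w x))\<^sup>2) \<le> 2 * ennreal ((f k x - z x)\<^sup>2) + 2 * ennreal ((g k x - w x)\<^sup>2)"
      by (simp add: ennreal_mult)
  qed
  then show "\<forall>\<^sub>F k in sequentially. (\<integral>\<^sup>+x. ennreal ((f k x + g k x - (z x + w x))\<^sup>2) \<partial>M)
      \<le> 2 * (\<integral>\<^sup>+x. ennreal ((f k x - z x)\<^sup>2) \<partial>M) + 2 * (\<integral>\<^sup>+x. ennreal ((g k x - w x)\<^sup>2) \<partial>M)"
    by (auto simp: nn_integral_add nn_integral_cmult)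
  show "(\<lambda>k. 2 * (\<integral>\<^sup>+x. ennreal ((f k x - z x)\<^sup>2) \<partial>M) + 2 * (\<integral>\<^sup>+x. ennreal ((g k x - w x)\<^sup>2) \<partial>M)) \<longlonglongrightarrow> 0"
    using tendsto_add[OF ennreal_tendsto_cmult[OF _ f, of 2] ennreal_tendsto_cmult[OF _ g, of 2]] by simp
qed auto

lemma wiener_integral_add:
  assumes B: "\<And>t. 0 \<le> t \<Longrightarrow> B t \<in> borel_measurable M"
    and "wiener_integral M B z Z" "wiener_integral M B w W"
  shows "wiener_integral M B (\<lambda>u. z u + w u) (\<lambda>\<omega>. Z \<omega> + W \<omega>)"
proof -
  note [measurable] = assms(2,3)[unfolded wiener_integral_def, THEN conjunct1]
    assms(2,3)[unfolded wiener_integral_def, THEN conjunct2, THEN conjunct1]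
  obtain L where L: "\<forall>k. \<forall>(c, t)\<in>set (L k). 0 \<le> t"
    "L2_converges lborel (\<lambda>k. step_of (L k)) z"
    "L2_converges M (\<lambda>k \<omega>. lincomb (L k) (\<lambda>t. B t \<omega>)) Z"
    using assms(2) unfolding wiener_integral_def by blast
  obtain K where K: "\<forall>k. \<forall>(c, t)\<in>set (K k). 0 \<le> t"
    "L2_converges lborel (\<lambda>k. step_of (K k)) w"
    "L2_converges M (\<lambda>k \<omega>. lincomb (K k) (\<lambda>t. B t \<omega>)) W"
    using assms(3) unfolding wiener_integral_def by blast
  have [measurable]: "(\<lambda>\<omega>. lincomb (L k) (\<lambda>t. B t \<omega>)) \<in> borel_measurable M"
    "(\<lambda>\<omega>. lincomb (K k) (\<lambda>t. B t \<omega>)) \<in> borel_measurable M" for k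
    using L(1) K(1) by (auto intro!: measurable_lincomb B)
  show ?thesis
    unfolding wiener_integral_def
  proof (intro conjI exI[of _ "\<lambda>k. L k @ K k"])
    show "(\<lambda>k. \<integral>\<^sup>+u. ennreal ((step_of (L k @ K k) u - (z u + w u))\<^sup>2) \<partial>lborel) \<longlonglongrightarrow> 0"
      unfolding step_of_append by (rule L2_tendsto_add[OF _ _ _ _ L(2) K(2)]) auto
    show "(\<lambda>k. \<integral>\<^sup>+\<omega>. ennreal ((lincomb (L k @ K k) (\<lambda>t. B t \<omega>) - (Z \<omega> + W \<omega>))\<^sup>2) \<partial>M) \<longlonglongrightarrow> 0"
      unfolding lincomb_append by (rule L2_tendsto_add[OF _ _ _ _ L(3) K(3)]) auto
  qed (use L(1) K(1) in auto)
qed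

lemma wiener_integral_scale:
  assumes "wiener_integral M B z Z" and B: "\<And>t. 0 \<le> t \<Longrightarrow> B t \<in> borel_measurable M"
  shows "wiener_integral M B (\<lambda>u. r * z u) (\<lambda>\<omega>. r * Z \<omega>)"
proof -
  note [measurable] = assms(1)[unfolded wiener_integral_def, THEN conjunct1]
    assms(1)[unfolded wiener_integral_def, THEN conjunct2, THEN conjunct1]
  obtain L where L: "\<forall>k. \<forall>(c, t)\<in>set (L k). 0 \<le> t"
    "L2_converges lborel (\<lambda>k. step_of (L k)) z"
    "L2_converges M (\<lambda>k \<omega>. lincomb (L k) (\<lambda>t. B t \<omega>)) Z"
    using assms(1) unfolding wiener_integral_def by blast
  have [measurable]: "(\<lambda>\<omega>. lincomb (L k) (\<lambda>t. B t \<omega>)) \<in> borel_measurable M" for k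
    using L(1) by (auto intro!: measurable_lincomb B)
  have sq: "ennreal ((r * x - r * y)\<^sup>2) = ennreal (r\<^sup>2) * ennreal ((x - y)\<^sup>2)" for x y
    by (simp add: right_diff_distrib[symmetric] power_mult_distrib ennreal_mult)
  show ?thesis
    unfolding wiener_integral_def
  proof (intro conjI exI[of _ "\<lambda>k. map (\<lambda>(c, t). (r * c, t)) (L k)"])
    show "(\<lambda>k. \<integral>\<^sup>+u. ennreal ((step_of (map (\<lambda>(c, t). (r * c, t)) (L k)) u - r * z u)\<^sup>2) \<partial>lborel) \<longlonglongrightarrow> 0"
      using ennreal_tendsto_cmult[OF _ L(2), of "ennreal (r\<^sup>2)"]
      by (simp add: step_of_scale sq nn_integral_cmult)
    show "(\<lambda>k. \<integral>\<^sup>+\<omega>. ennreal ((lincomb (map (\<lambda>(c, t). (r * c, t)) (L k)) (\<lambda>t. B t \<omega>) - r * Z \<omega>)\<^sup>2) \<partial>M) \<longlonglongrightarrow> 0"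
      using ennreal_tendsto_cmult[OF _ L(3), of "ennreal (r\<^sup>2)"]
      by (simp add: lincomb_scale sq nn_integral_cmult)
  qed (use L(1) in \<open>fastforce+\<close>)
qed

lemma wiener_integral_zero: "wiener_integral M B (\<lambda>_. 0) (\<lambda>_. 0)"
  unfolding wiener_integral_def by (auto intro!: exI[of _ "\<lambda>_. []"] simp: step_of_def lincomb_def)

lemma wiener_integral_sum:
  assumes B: "\<And>t. 0 \<le> t \<Longrightarrow> B t \<in> borel_measurable M"
    and "finite J" "\<And>j. j \<in> J \<Longrightarrow> wiener_integral M B (z j) (Z j)"
  shows "wiener_integral M B (\<lambda>u. \<Sum>j\<in>J. r j * z j u) (\<lambda>\<omega>. \<Sum>j\<in>J. r j * Z j \<omega>)"
  using assms(2,3)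
proof (induction J rule: finite_induct)
  case (insert j J)
  then have "wiener_integral M B (\<lambda>u. r j * z j u + (\<Sum>j\<in>J. r j * z j u)) (\<lambda>\<omega>. r j * Z j \<omega> + (\<Sum>j\<in>J. r j * Z j \<omega>))"
    by (intro wiener_integral_add wiener_integral_scale B) auto
  with insert show ?case by simp
qed (simp add: wiener_integral_zero)

section \<open>Passage to the mean-square limit\<close>

lemma cmod_iexp_diff_le: "cmod (iexp x - iexp y) \<le> \<bar>x - y\<bar>"
proof -
  have "iexp x - iexp y = iexp y * (iexp (x - y) - 1)"
    by (simp add: right_diff_distrib flip: exp_add)
  then show ?thesis
    using iexp_approx1[of "x - y" 0] by (simp add: norm_mult)
qed

text \<open>With d = |X k - Y| the two expectations differ by at most E d, and d \<le> \<eta> + d^2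
  / \<eta> bounds this by \<eta> plus a multiple of the mean-square distance. Extended nonnegative
  integrals handle the k for which that distance is infinite.\<close>

lemma (in prob_space) expectation_iexp_tendsto:
  assumes [measurable]: "\<And>k::nat. X k \<in> borel_measurable M" "Y \<in> borel_measurable M"
    and lim: "L2_converges M X Y"
  shows "(\<lambda>k. \<integral>\<omega>. iexp (X k \<omega>) \<partial>M) \<longlonglongrightarrow> (\<integral>\<omega>. iexp (Y \<omega>) \<partial>M)"
proof (rule LIMSEQ_I)
  fix \<epsilon> :: real assume "0 < \<epsilon>"
  define \<eta> where "\<eta> = \<epsilon> / 2"
  have \<eta>: "0 < \<eta>" using \<open>0 < \<epsilon>\<close> by (simp add: \<eta>_def)
  have int: "integrable M (\<lambda>\<omega>. iexp (Z \<omega>))" if "Z \<in> borel_measurable M" for Z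
    using that by (auto intro!: integrable_iexp)
  have bound: "ennreal (cmod ((\<integral>\<omega>. iexp (X k \<omega>) \<partial>M) - (\<integral>\<omega>. iexp (Y \<omega>) \<partial>M)))
      \<le> ennreal \<eta> + ennreal (1 / \<eta>) * (\<integral>\<^sup>+\<omega>. ennreal ((X k \<omega> - Y \<omega>)\<^sup>2) \<partial>M)" for k
  proof -
    have "ennreal (cmod ((\<integral>\<omega>. iexp (X k \<omega>) \<partial>M) - (\<integral>\<omega>. iexp (Y \<omega>) \<partial>M)))
        = ennreal (cmod (\<integral>\<omega>. iexp (X k \<omega>) - iexp (Y \<omega>) \<partial>M))"
      by (subst Bochner_Integration.integral_diff) (auto intro!: int)
    also have "\<dots> \<le> (\<integral>\<^sup>+\<omega>. ennreal (cmod (iexp (X k \<omega>) - iexp (Y \<omega>))) \<partial>M)"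
      by (intro integral_norm_bound_ennreal Bochner_Integration.integrable_diff int) auto
    also have "\<dots> \<le> (\<integral>\<^sup>+\<omega>. ennreal \<eta> + ennreal (1 / \<eta>) * ennreal ((X k \<omega> - Y \<omega>)\<^sup>2) \<partial>M)"
    proof (rule nn_integral_mono)
      fix \<omega>
      let ?d = "\<bar>X k \<omega> - Y \<omega>\<bar>"
      have "?d \<le> \<eta> + ?d\<^sup>2 / \<eta>"
      proof (cases "?d \<le> \<eta>")
        case False
        then have "?d * \<eta> \<le> ?d * ?d" by (intro mult_left_mono) auto
        then have "?d \<le> ?d\<^sup>2 / \<eta>" using \<eta> by (simp add: field_simps power2_eq_square)
        then show ?thesis using \<eta> by simp
      qed (use \<eta> in \<open>simp add: add_increasing2\<close>)
      then have "cmod (iexp (X k \<omega>) - iexp (Y \<omega>)) \<le> \<eta> + 1 / \<eta> * (X k \<omega> - Y \<omega>)\<^sup>2"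
        using cmod_iexp_diff_le[of "X k \<omega>" "Y \<omega>"] by simp
      then have "ennreal (cmod (iexp (X k \<omega>) - iexp (Y \<omega>))) \<le> ennreal (\<eta> + 1 / \<eta> * (X k \<omega> - Y \<omega>)\<^sup>2)"
        by (rule ennreal_leI)
      also have "\<dots> = ennreal \<eta> + ennreal (1 / \<eta>) * ennreal ((X k \<omega> - Y \<omega>)\<^sup>2)"
        using \<eta> by (subst ennreal_plus) (auto simp: ennreal_mult[symmetric])
      finally show "ennreal (cmod (iexp (X k \<omega>) - iexp (Y \<omega>))) \<le> ennreal \<eta> + ennreal (1 / \<eta>) * ennreal ((X k \<omega> - Y \<omega>)\<^sup>2)" .
    qed
    also have "\<dots> = ennreal \<eta> + ennreal (1 / \<eta>) * (\<integral>\<^sup>+\<omega>. ennreal ((X k \<omega> - Y \<omega>)\<^sup>2) \<partial>M)"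
      by (simp add: nn_integral_add nn_integral_cmult emeasure_space_1)
    finally show ?thesis .
  qed
  have "(\<lambda>k. ennreal \<eta> + ennreal (1 / \<eta>) * (\<integral>\<^sup>+\<omega>. ennreal ((X k \<omega> - Y \<omega>)\<^sup>2) \<partial>M)) \<longlonglongrightarrow> ennreal \<eta> + ennreal (1 / \<eta>) * 0"
    by (intro tendsto_add tendsto_const ennreal_tendsto_cmult lim) auto
  moreover have "ennreal \<eta> + ennreal (1 / \<eta>) * 0 < ennreal \<epsilon>"
    using \<open>0 < \<epsilon>\<close> by (simp add: \<eta>_def ennreal_less_iff)
  ultimately have "\<forall>\<^sub>F k in sequentially. ennreal \<eta> + ennreal (1 / \<eta>) * (\<integral>\<^sup>+\<omega>. ennreal ((X k \<omega> - Y \<omega>)\<^sup>2) \<partial>M) < ennreal \<epsilon>"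
    by (rule order_tendstoD)
  then have "\<forall>\<^sub>F k in sequentially. cmod ((\<integral>\<omega>. iexp (X k \<omega>) \<partial>M) - (\<integral>\<omega>. iexp (Y \<omega>) \<partial>M)) < \<epsilon>"
  proof eventually_elim
    case (elim k)
    from le_less_trans[OF bound this] show ?case by (simp add: ennreal_less_iff)
  qed
  then show "\<exists>k0. \<forall>k\<ge>k0. norm ((\<integral>\<omega>. iexp (X k \<omega>) \<partial>M) - (\<integral>\<omega>. iexp (Y \<omega>) \<partial>M)) < \<epsilon>"
    by (simp add: eventually_sequentially)
qed

text \<open>With f = z + e, Young's inequality gives |f^2 - z^2| \<le> \<eta> z^2 + (1 + 1/\<eta>)
  e^2. The first part is small by the choice of \<eta>, the second tends to 0 for fixed
  \<eta>.\<close>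

lemma L2_norm_tendsto:
  fixes f :: "nat \<Rightarrow> 'a \<Rightarrow> real"
  assumes [measurable]: "\<And>k. f k \<in> borel_measurable M" "z \<in> borel_measurable M"
    and int: "\<And>k. integrable M (\<lambda>x. (f k x)\<^sup>2)"
    and lim: "L2_converges M f z"
  shows "integrable M (\<lambda>x. (z x)\<^sup>2)" and "(\<lambda>k. \<integral>x. (f k x)\<^sup>2 \<partial>M) \<longlonglongrightarrow> (\<integral>x. (z x)\<^sup>2 \<partial>M)"
proof -
  have fin: "\<forall>\<^sub>F k in sequentially. integrable M (\<lambda>x. (f k x - z x)\<^sup>2)"
    using order_tendstoD(2)[OF lim zero_less_one]
  proof eventually_elim
    case (elim k)
    have "(\<integral>\<^sup>+x. ennreal ((f k x - z x)\<^sup>2) \<partial>M) < \<infinity>"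
      using less_trans[OF elim, of \<infinity>] by simp
    then show ?case by (intro integrableI_nonneg) auto
  qed
  then obtain k where k: "integrable M (\<lambda>x. (f k x - z x)\<^sup>2)"
    using eventually_happens'[OF sequentially_bot] by blast
  show intz: "integrable M (\<lambda>x. (z x)\<^sup>2)"
  proof (rule Bochner_Integration.integrable_bound)
    show "integrable M (\<lambda>x. 2 * (f k x)\<^sup>2 + 2 * (f k x - z x)\<^sup>2)"
      using int k by auto
    show "AE x in M. norm ((z x)\<^sup>2) \<le> norm (2 * (f k x)\<^sup>2 + 2 * (f k x - z x)\<^sup>2)"
    proof (rule AE_I2)
      fix x
      \<comment> \<open>This square equals 2 f^2 + 2 (f - z)^2 - z^2.\<close>
      have "0 \<le> (2 * f k x - z x)\<^sup>2" by simp
      then show "norm ((z x)\<^sup>2) \<le> norm (2 * (f k x)\<^sup>2 + 2 * (f k x - z x)\<^sup>2)"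
        by (simp add: power2_eq_square algebra_simps)
    qed
  qed auto
  define d where "d k = (\<integral>x. (f k x - z x)\<^sup>2 \<partial>M)" for k
  have d: "d \<longlonglongrightarrow> 0"
  proof -
    have "(\<lambda>k. enn2real (\<integral>\<^sup>+x. ennreal ((f k x - z x)\<^sup>2) \<partial>M)) \<longlonglongrightarrow> enn2real 0"
      using lim by (intro tendsto_enn2real) (simp_all add: ennreal_0)
    then show ?thesis by (simp add: d_def[abs_def] integral_eq_nn_integral)
  qed
  define N where "N = (\<integral>x. (z x)\<^sup>2 \<partial>M)"
  have N0: "0 \<le> N" by (simp add: N_def)
  show "(\<lambda>k. \<integral>x. (f k x)\<^sup>2 \<partial>M) \<longlonglongrightarrow> (\<integral>x. (z x)\<^sup>2 \<partial>M)"
    unfolding N_def[symmetric]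
  proof (rule LIMSEQ_I)
    fix \<epsilon> :: real assume "0 < \<epsilon>"
    define \<eta> where "\<eta> = \<epsilon> / (2 * (N + 1))"
    have \<eta>: "0 < \<eta>" using \<open>0 < \<epsilon>\<close> N0 by (simp add: \<eta>_def)
    have bound: "\<bar>(\<integral>x. (f k x)\<^sup>2 \<partial>M) - N\<bar> \<le> \<eta> * N + (1 + 1 / \<eta>) * d k"
      if k: "integrable M (\<lambda>x. (f k x - z x)\<^sup>2)" for k
    proof -
      have "(\<integral>x. (f k x)\<^sup>2 \<partial>M) - N = (\<integral>x. (f k x)\<^sup>2 - (z x)\<^sup>2 \<partial>M)"
        using int intz by (simp add: N_def)
      also have "\<bar>\<dots>\<bar> \<le> (\<integral>x. \<bar>(f k x)\<^sup>2 - (z x)\<^sup>2\<bar> \<partial>M)"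
        by (rule integral_abs_bound)
      also have "\<dots> \<le> (\<integral>x. \<eta> * (z x)\<^sup>2 + (1 + 1 / \<eta>) * (f k x - z x)\<^sup>2 \<partial>M)"
      proof (rule integral_mono)
        fix x
        define e where "e = f k x - z x"
        have f: "f k x = z x + e" by (simp add: e_def)
        have young: "2 * z x * r \<le> \<eta> * (z x)\<^sup>2 + r\<^sup>2 / \<eta>" for r
        proof (rule mult_left_le_imp_le[OF _ \<eta>])
          have "0 \<le> (\<eta> * z x - r)\<^sup>2" by simp
          also have "\<dots> = \<eta> * (\<eta> * (z x)\<^sup>2) + r\<^sup>2 - \<eta> * (2 * z x * r)"
            by (simp add: power2_eq_square algebra_simps)
          finally show "\<eta> * (2 * z x * r) \<le> \<eta> * (\<eta> * (z x)\<^sup>2 + r\<^sup>2 / \<eta>)"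
            using \<eta> by (simp add: distrib_left)
        qed
        have "2 * z x * e \<le> \<eta> * (z x)\<^sup>2 + e\<^sup>2 / \<eta>" "- (2 * z x * e) \<le> \<eta> * (z x)\<^sup>2 + e\<^sup>2 / \<eta>"
          using young[of e] young[of "- e"] by simp_all
        moreover have "(f k x)\<^sup>2 - (z x)\<^sup>2 = 2 * z x * e + e\<^sup>2"
          by (simp add: f power2_eq_square algebra_simps)
        moreover have "(1 + 1 / \<eta>) * e\<^sup>2 = e\<^sup>2 + e\<^sup>2 / \<eta>" by (simp add: distrib_right)
        moreover have "0 \<le> e\<^sup>2" by simp
        ultimately show "\<bar>(f k x)\<^sup>2 - (z x)\<^sup>2\<bar> \<le> \<eta> * (z x)\<^sup>2 + (1 + 1 / \<eta>) * (f k x - z x)\<^sup>2"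
          unfolding e_def[symmetric] abs_le_iff by linarith
      qed (use int intz k in auto)
      also have "\<dots> = \<eta> * N + (1 + 1 / \<eta>) * d k"
        using intz k by (simp add: N_def d_def)
      finally show ?thesis .
    qed
    have "(\<lambda>k. \<eta> * N + (1 + 1 / \<eta>) * d k) \<longlonglongrightarrow> \<eta> * N + (1 + 1 / \<eta>) * 0"
      by (intro tendsto_intros d)
    moreover have "\<eta> * N + (1 + 1 / \<eta>) * 0 < \<epsilon>"
    proof -
      have "\<epsilon> * N < \<epsilon> * (2 * (N + 1))"
        using \<open>0 < \<epsilon>\<close> N0 by (intro mult_strict_left_mono) auto
      then show ?thesis using N0 by (simp add: \<eta>_def pos_divide_less_eq)
    qed
    ultimately have "\<forall>\<^sub>F k in sequentially. \<eta> * N + (1 + 1 / \<eta>) * d k < \<epsilon>"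
      by (rule order_tendstoD)
    with fin have "\<forall>\<^sub>F k in sequentially. \<bar>(\<integral>x. (f k x)\<^sup>2 \<partial>M) - N\<bar> < \<epsilon>"
    proof eventually_elim
      case (elim k)
      then show ?case using bound[of k] by simp
    qed
    then show "\<exists>k0. \<forall>k\<ge>k0. norm ((\<integral>x. (f k x)\<^sup>2 \<partial>M) - N) < \<epsilon>"
      by (simp add: eventually_sequentially)
  qed
qed

text \<open>The step approximants of the two integrands have the Gaussian characteristic function,
  and both sides of that identity pass to the mean-square limit.\<close>

lemma independent_wiener_integral_char:
  assumes bm: "brownian_motion M B" "brownian_motion M B'" and ind: "independent_processes M B B'"
    and W: "wiener_integral M B z Z" "wiener_integral M B' z' Z'"
  shows "(\<integral>\<omega>. iexp (Z \<omega> + Z' \<omega>) \<partial>M)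
    = of_real (exp (- ((\<integral>u. (z u)\<^sup>2 \<partial>lborel) + (\<integral>u. (z' u)\<^sup>2 \<partial>lborel)) / 2))"
proof -
  interpret prob_space M using bm by (simp add: brownian_motion_def)
  have B: "B t \<in> borel_measurable M" "B' t \<in> borel_measurable M" if "0 \<le> t" for t
    using bm that by (auto simp: brownian_motion_def)
  note [measurable] = W[unfolded wiener_integral_def, THEN conjunct1]
    W[unfolded wiener_integral_def, THEN conjunct2, THEN conjunct1]
  obtain L where L: "\<forall>k. \<forall>(c, t)\<in>set (L k). 0 \<le> t"
    "L2_converges lborel (\<lambda>k. step_of (L k)) z"
    "L2_converges M (\<lambda>k \<omega>. lincomb (L k) (\<lambda>t. B t \<omega>)) Z"
    using W(1) unfolding wiener_integral_def by blast
  obtain K where K: "\<forall>k. \<forall>(c, t)\<in>set (K k). 0 \<le> t"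
    "L2_converges lborel (\<lambda>k. step_of (K k)) z'"
    "L2_converges M (\<lambda>k \<omega>. lincomb (K k) (\<lambda>t. B' t \<omega>)) Z'"
    using W(2) unfolding wiener_integral_def by blast
  have L0: "\<And>c t. (c, t) \<in> set (L k) \<Longrightarrow> 0 \<le> t" and K0: "\<And>c t. (c, t) \<in> set (K k) \<Longrightarrow> 0 \<le> t" for k
    using L(1) K(1) by auto
  have [measurable]: "(\<lambda>\<omega>. lincomb (L k) (\<lambda>t. B t \<omega>)) \<in> borel_measurable M"
    "(\<lambda>\<omega>. lincomb (K k) (\<lambda>t. B' t \<omega>)) \<in> borel_measurable M" for k
    using L0 K0 by (auto intro!: measurable_lincomb B)
  have char: "(\<integral>\<omega>. iexp (lincomb (L k) (\<lambda>t. B t \<omega>) + lincomb (K k) (\<lambda>t. B' t \<omega>)) \<partial>M)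
      = of_real (exp (- ((\<integral>u. (step_of (L k) u)\<^sup>2 \<partial>lborel) + (\<integral>u. (step_of (K k) u)\<^sup>2 \<partial>lborel)) / 2))" for k
    by (rule independent_lincomb_char[OF bm ind]) (fact L0 K0)+
  have int: "integrable lborel (\<lambda>u. (step_of (L k) u)\<^sup>2)" "integrable lborel (\<lambda>u. (step_of (K k) u)\<^sup>2)" for k
    by (rule brownian_lincomb_char(2)[OF bm(1)], fact L0) (rule brownian_lincomb_char(2)[OF bm(2)], fact K0)
  have lim: "(\<lambda>k. \<integral>\<omega>. iexp (lincomb (L k) (\<lambda>t. B t \<omega>) + lincomb (K k) (\<lambda>t. B' t \<omega>)) \<partial>M) \<longlonglongrightarrow> (\<integral>\<omega>. iexp (Z \<omega> + Z' \<omega>) \<partial>M)"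
    by (rule expectation_iexp_tendsto[OF _ _ L2_tendsto_add[OF _ _ _ _ L(3) K(3)]]) measurable
  have "(\<lambda>k. \<integral>u. (step_of (L k) u)\<^sup>2 \<partial>lborel) \<longlonglongrightarrow> (\<integral>u. (z u)\<^sup>2 \<partial>lborel)"
    by (rule L2_norm_tendsto(2)[OF _ _ int(1) L(2)]) measurable
  moreover have "(\<lambda>k. \<integral>u. (step_of (K k) u)\<^sup>2 \<partial>lborel) \<longlonglongrightarrow> (\<integral>u. (z' u)\<^sup>2 \<partial>lborel)"
    by (rule L2_norm_tendsto(2)[OF _ _ int(2) K(2)]) measurable
  ultimately have "(\<lambda>k. \<integral>\<omega>. iexp (lincomb (L k) (\<lambda>t. B t \<omega>) + lincomb (K k) (\<lambda>t. B' t \<omega>)) \<partial>M)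
      \<longlonglongrightarrow> of_real (exp (- ((\<integral>u. (z u)\<^sup>2 \<partial>lborel) + (\<integral>u. (z' u)\<^sup>2 \<partial>lborel)) / 2))"
    unfolding char by (intro tendsto_of_real tendsto_exp tendsto_divide tendsto_minus tendsto_add tendsto_const) auto
  with lim show ?thesis
    by (rule LIMSEQ_unique)
qed

section \<open>Independence from a factorizing characteristic function\<close>

text \<open>A bounded nonnegative weight \<open>W\<close>, divided by its mean, is the density of a
  new probability measure. The hypothesis says that under it X has the characteristic function of
  \<mu>, hence the law \<mu>.\<close>

lemma (in prob_space) weighted_char_imp_weighted_measure:
  fixes X W :: "'a \<Rightarrow> real"
  assumes [measurable]: "X \<in> borel_measurable M" "W \<in> borel_measurable M" "A \<in> sets borel"
    and W: "\<And>\<omega>. 0 \<le> W \<omega>" "\<And>\<omega>. W \<omega> \<le> K" and \<mu>: "real_distribution \<mu>"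
    and char: "\<And>u. (\<integral>\<omega>. iexp (u * X \<omega>) * W \<omega> \<partial>M) = char \<mu> u * of_real (\<integral>\<omega>. W \<omega> \<partial>M)"
  shows "(\<integral>\<omega>. indicator A (X \<omega>) * W \<omega> \<partial>M) = measure \<mu> A * (\<integral>\<omega>. W \<omega> \<partial>M)"
proof -
  interpret \<mu>: real_distribution \<mu> by fact
  have intW: "integrable M W"
    by (rule integrable_const_bound[where B=K]) (use W in auto)
  define w where "w = (\<integral>\<omega>. W \<omega> \<partial>M)"
  show ?thesis
  proof (cases "w = 0")
    case True
    then have "AE \<omega> in M. W \<omega> = 0"
      using integral_nonneg_eq_0_iff_AE[OF intW] W by (auto simp: w_def)
    then have "(\<integral>\<omega>. indicator A (X \<omega>) * W \<omega> \<partial>M) = (\<integral>\<omega>. 0 \<partial>M)"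
      by (intro integral_cong_AE) auto
    with True show ?thesis by (simp add: w_def)
  next
    case False
    have "0 \<le> w" unfolding w_def by (rule Bochner_Integration.integral_nonneg) (rule W)
    with False have "0 < w" by simp
    define N where "N = density M (\<lambda>\<omega>. W \<omega> / w)"
    have [measurable_cong]: "sets N = sets M" by (simp add: N_def)
    have "emeasure N (space N) = (\<integral>\<^sup>+\<omega>. ennreal (W \<omega> / w) \<partial>M)"
      using \<open>0 < w\<close> W by (auto simp: N_def emeasure_density intro!: nn_integral_cong)
    also have "\<dots> = ennreal (\<integral>\<omega>. W \<omega> / w \<partial>M)"
      using \<open>0 < w\<close> W intW by (intro nn_integral_eq_integral) auto
    also have "\<dots> = 1" using \<open>0 < w\<close> by (simp add: w_def[symmetric])
    finally interpret N: prob_space N by (rule prob_spaceI)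
    interpret D: real_distribution "distr N borel X"
      by (auto intro!: real_distribution.intro N.prob_space_distr simp: real_distribution_axioms_def)
    have "char (distr N borel X) = char \<mu>"
    proof
      fix u
      have "char (distr N borel X) u = (\<integral>\<omega>. iexp (u * X \<omega>) \<partial>N)"
        unfolding char_def by (subst integral_distr) auto
      also have "\<dots> = (\<integral>\<omega>. (W \<omega> / w) *\<^sub>R iexp (u * X \<omega>) \<partial>M)"
        unfolding N_def using \<open>0 < w\<close> W by (subst integral_density) auto
      also have "\<dots> = (\<integral>\<omega>. iexp (u * X \<omega>) * W \<omega> \<partial>M) / of_real w"
        by (subst Bochner_Integration.integral_divide_zero[symmetric]) (simp add: scaleR_conv_of_real mult.commute)
      also have "\<dots> = char \<mu> u"
        using char[of u] False by (simp add: w_def)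
      finally show "char (distr N borel X) u = char \<mu> u" .
    qed
    then have "distr N borel X = \<mu>"
      using D.real_distribution_axioms \<mu> by (intro Levy_uniqueness)
    then have "measure \<mu> A = measure N (X -` A \<inter> space N)"
      by (auto simp: measure_distr)
    also have "\<dots> = (\<integral>\<omega>. indicator (X -` A \<inter> space N) \<omega> \<partial>N)"
      by simp
    also have "\<dots> = (\<integral>\<omega>. indicator A (X \<omega>) \<partial>N)"
      by (intro Bochner_Integration.integral_cong) (auto simp: indicator_def)
    also have "\<dots> = (\<integral>\<omega>. (W \<omega> / w) *\<^sub>R indicator A (X \<omega>) \<partial>M)"
      unfolding N_def using \<open>0 < w\<close> W by (subst integral_density) auto
    also have "\<dots> = (\<integral>\<omega>. indicator A (X \<omega>) * W \<omega> \<partial>M) / w"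
      by (simp add: mult.commute)
    finally show ?thesis using False by (simp add: w_def)
  qed
qed

text \<open>The preceding lemma needs a nonnegative weight, while
  \<open>iexp (Y \<omega>) * V \<omega>\<close> is complex. It is recovered from the nonnegative
  weights V, V (1 + cos Y) and V (1 + sin Y), which involve only the frequencies r = 0, 1 and -1 of
  the hypothesis.\<close>

lemma (in prob_space) factor_indicator_of_char:
  fixes X Y V :: "'a \<Rightarrow> real"
  assumes [measurable]: "X \<in> borel_measurable M" "Y \<in> borel_measurable M" "V \<in> borel_measurable M" "A \<in> sets borel"
    and V: "\<And>\<omega>. 0 \<le> V \<omega>" "\<And>\<omega>. V \<omega> \<le> 1" and \<mu>: "real_distribution \<mu>"
    and char: "\<And>u r. (\<integral>\<omega>. iexp (u * X \<omega> + r * Y \<omega>) * V \<omega> \<partial>M) = char \<mu> u * (\<integral>\<omega>. iexp (r * Y \<omega>) * V \<omega> \<partial>M)"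
  shows "(\<integral>\<omega>. iexp (Y \<omega>) * (indicator A (X \<omega>) * V \<omega>) \<partial>M) = measure \<mu> A * (\<integral>\<omega>. iexp (Y \<omega>) * V \<omega> \<partial>M)"
proof -
  define F where "F u r = (\<integral>\<omega>. iexp (u * X \<omega> + r * Y \<omega>) * V \<omega> \<partial>M)" for u r
  have int: "integrable M (\<lambda>\<omega>. iexp (u * X \<omega> + r * Y \<omega>) * V \<omega>)" for u r
    by (rule integrable_const_bound[where B=1]) (use V in \<open>auto simp: norm_mult\<close>)
  have intr: "integrable M (\<lambda>\<omega>. f \<omega> * V \<omega>)" if "f \<in> borel_measurable M" "\<And>\<omega>. \<bar>f \<omega>\<bar> \<le> 1" for f :: "'a \<Rightarrow> real"
    using that V by (intro integrable_const_bound[where B=1]) (auto simp: abs_mult intro!: mult_le_one)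
  have cos_eq: "of_real (cos y) = (iexp y + iexp (- y)) / 2"
    and sin_eq: "of_real (sin y) = (iexp y - iexp (- y)) / (2 * \<i>)" for y :: real
    by (simp_all add: cos_of_real[symmetric] sin_of_real[symmetric] cos_exp_eq sin_exp_eq)
  have F0: "F u r = char \<mu> u * F 0 r" for u r
    using char[of u r] by (simp add: F_def)
  have zero: "(\<integral>\<omega>. indicator A (X \<omega>) * V \<omega> \<partial>M) = measure \<mu> A * (\<integral>\<omega>. V \<omega> \<partial>M)"
  proof (rule weighted_char_imp_weighted_measure[OF _ _ _ V \<mu>])
    show "(\<integral>\<omega>. iexp (u * X \<omega>) * V \<omega> \<partial>M) = char \<mu> u * of_real (\<integral>\<omega>. V \<omega> \<partial>M)" for u
      using F0[of u 0] by (simp add: F_def)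
  qed auto
  have trig: "(\<integral>\<omega>. indicator A (X \<omega>) * (V \<omega> * (1 + f (Y \<omega>))) \<partial>M) = measure \<mu> A * (\<integral>\<omega>. V \<omega> * (1 + f (Y \<omega>)) \<partial>M)"
    if f: "\<And>y. \<bar>f y\<bar> \<le> (1::real)" "\<And>y. of_real (f y) = a * iexp y + b * iexp (- y)" and [measurable]: "f \<in> borel_measurable borel"
    for f a b
  proof (rule weighted_char_imp_weighted_measure[where K=2])
    show "0 \<le> V \<omega> * (1 + f (Y \<omega>))" "V \<omega> * (1 + f (Y \<omega>)) \<le> 2" for \<omega>
      using V[of \<omega>] f(1)[of "Y \<omega>"] mult_mono[of "V \<omega>" 1 "1 + f (Y \<omega>)" 2] by (auto simp: abs_le_iff)
    have *: "(\<integral>\<omega>. iexp (u * X \<omega>) * of_real (V \<omega> * (1 + f (Y \<omega>))) \<partial>M) = F u 0 + (a * F u 1 + b * F u (- 1))" for u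
    proof -
      have "(\<integral>\<omega>. iexp (u * X \<omega>) * of_real (V \<omega> * (1 + f (Y \<omega>))) \<partial>M)
        = (\<integral>\<omega>. iexp (u * X \<omega> + 0 * Y \<omega>) * V \<omega> + (a * (iexp (u * X \<omega> + 1 * Y \<omega>) * V \<omega>) + b * (iexp (u * X \<omega> + (-1) * Y \<omega>) * V \<omega>)) \<partial>M)"
        by (simp add: f(2) algebra_simps exp_add exp_diff exp_minus divide_inverse)
      also have "\<dots> = F u 0 + (a * F u 1 + b * F u (- 1))"
        unfolding F_def
        by (subst Bochner_Integration.integral_add, intro int,
            intro Bochner_Integration.integrable_add integrable_mult_right int,
            subst Bochner_Integration.integral_add, intro integrable_mult_right int,
            intro integrable_mult_right int, simp only: integral_mult_right_zero)
      finally show ?thesis .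
    qed
    show "(\<integral>\<omega>. iexp (u * X \<omega>) * of_real (V \<omega> * (1 + f (Y \<omega>))) \<partial>M) = char \<mu> u * of_real (\<integral>\<omega>. V \<omega> * (1 + f (Y \<omega>)) \<partial>M)" for u
    proof -
      have "of_real (\<integral>\<omega>. V \<omega> * (1 + f (Y \<omega>)) \<partial>M) = (\<integral>\<omega>. iexp (0 * X \<omega>) * of_real (V \<omega> * (1 + f (Y \<omega>))) \<partial>M)"
        by (simp del: of_real_mult of_real_add)
      also have "\<dots> = F 0 0 + (a * F 0 1 + b * F 0 (- 1))" by (rule *)
      finally show ?thesis
        unfolding * using F0[of u 0] F0[of u 1] F0[of u "- 1"] by (simp add: algebra_simps)
    qed
  qed (use \<mu> in auto)
  have trig': "(\<integral>\<omega>. f (Y \<omega>) * (indicator A (X \<omega>) * V \<omega>) \<partial>M) = measure \<mu> A * (\<integral>\<omega>. f (Y \<omega>) * V \<omega> \<partial>M)"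
    if f: "\<And>y. \<bar>f y\<bar> \<le> (1::real)" "\<And>y. of_real (f y) = a * iexp y + b * iexp (- y)" and [measurable]: "f \<in> borel_measurable borel"
    for f a b
  proof -
    have "integrable M (\<lambda>\<omega>. indicator A (X \<omega>) * f (Y \<omega>) * V \<omega>)"
      by (rule intr) (use f(1) in \<open>auto simp: indicator_def\<close>)
    moreover have "integrable M (\<lambda>\<omega>. indicator A (X \<omega>) * V \<omega>)" "integrable M (\<lambda>\<omega>. f (Y \<omega>) * V \<omega>)"
      by (rule intr; use f(1) in \<open>simp add: indicator_def\<close>)+
    moreover have "integrable M V"
      using intr[of "\<lambda>_. 1"] by simp
    ultimately show ?thesis
      using trig[OF f] zero by (simp add: algebra_simps)
  qed
  have c: "(\<integral>\<omega>. cos (Y \<omega>) * (indicator A (X \<omega>) * V \<omega>) \<partial>M) = measure \<mu> A * (\<integral>\<omega>. cos (Y \<omega>) * V \<omega> \<partial>M)"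
    by (rule trig'[of cos "1/2" "1/2"]) (auto simp: cos_eq add_divide_distrib)
  have s: "(\<integral>\<omega>. sin (Y \<omega>) * (indicator A (X \<omega>) * V \<omega>) \<partial>M) = measure \<mu> A * (\<integral>\<omega>. sin (Y \<omega>) * V \<omega> \<partial>M)"
    by (rule trig'[of sin "1/(2*\<i>)" "- 1/(2*\<i>)"]) (auto simp: sin_eq diff_divide_distrib right_diff_distrib)
  have split: "(\<integral>\<omega>. iexp (Y \<omega>) * of_real (G \<omega>) \<partial>M)
      = of_real (\<integral>\<omega>. cos (Y \<omega>) * G \<omega> \<partial>M) + \<i> * of_real (\<integral>\<omega>. sin (Y \<omega>) * G \<omega> \<partial>M)"
    if [measurable]: "G \<in> borel_measurable M" and "\<And>\<omega>. \<bar>G \<omega>\<bar> \<le> 1" for G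
  proof -
    have 1: "integrable M (\<lambda>\<omega>. cos (Y \<omega>) * G \<omega>)" "integrable M (\<lambda>\<omega>. sin (Y \<omega>) * G \<omega>)"
      using that by (auto intro!: integrable_const_bound[where B=1] simp: abs_mult mult_le_one)
    have "(\<integral>\<omega>. iexp (Y \<omega>) * of_real (G \<omega>) \<partial>M) = (\<integral>\<omega>. complex_of_real (cos (Y \<omega>) * G \<omega>) + \<i> * complex_of_real (sin (Y \<omega>) * G \<omega>) \<partial>M)"
      by (simp add: exp_Euler algebra_simps cos_of_real sin_of_real)
    also have "\<dots> = of_real (\<integral>\<omega>. cos (Y \<omega>) * G \<omega> \<partial>M) + \<i> * of_real (\<integral>\<omega>. sin (Y \<omega>) * G \<omega> \<partial>M)"
      using 1 by (subst Bochner_Integration.integral_add) (auto simp del: of_real_mult)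
    finally show ?thesis .
  qed
  have "(\<integral>\<omega>. iexp (Y \<omega>) * of_real (indicator A (X \<omega>) * V \<omega>) \<partial>M) = measure \<mu> A * (\<integral>\<omega>. iexp (Y \<omega>) * of_real (V \<omega>) \<partial>M)"
  proof -
    have "\<bar>indicator A (X \<omega>) * V \<omega>\<bar> \<le> 1" "\<bar>V \<omega>\<bar> \<le> 1" for \<omega>
      using V[of \<omega>] by (auto simp: indicator_def)
    then show ?thesis
      by (subst (1 2) split) (simp_all add: c s distrib_left del: of_real_mult, simp add: mult_ac)
  qed
  then show ?thesis by simp
qed

text \<open>Kac's criterion. Starting from characters in all coordinates, the coordinates are turned
  one at a time into indicators of Borel sets; once all are turned, the identity gives the joint law
  on rectangles.\<close>

lemma (in prob_space) indep_vars_of_char: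
  fixes X :: "'i \<Rightarrow> 'a \<Rightarrow> real" and \<mu> :: "'i \<Rightarrow> real measure"
  assumes J: "finite J" and X [measurable]: "\<And>j. X j \<in> borel_measurable M" and \<mu>: "\<And>j. real_distribution (\<mu> j)"
    and char: "\<And>u. (\<integral>\<omega>. iexp (\<Sum>j\<in>J. u j * X j \<omega>) \<partial>M) = (\<Prod>j\<in>J. char (\<mu> j) (u j))"
  shows "indep_vars (\<lambda>_. borel) X J" and "\<And>j. j \<in> J \<Longrightarrow> distr M borel (X j) = \<mu> j"
proof -
  interpret \<mu>: real_distribution "\<mu> j" for j by (rule \<mu>)
  show marg: "distr M borel (X j) = \<mu> j" if "j \<in> J" for j
  proof (rule Levy_uniqueness)
    show "real_distribution (distr M borel (X j))"
      by (auto intro!: real_distribution.intro prob_space_distr simp: real_distribution_axioms_def)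
    show "char (distr M borel (X j)) = char (\<mu> j)"
    proof
      fix u
      have eq: "(\<Sum>k\<in>J. (if k = j then u else 0) * X k \<omega>) = u * X j \<omega>" for \<omega>
        using J \<open>j \<in> J\<close> by (subst sum.remove[of J j]) auto
      have "char (distr M borel (X j)) u = (\<integral>\<omega>. iexp (u * X j \<omega>) \<partial>M)"
        unfolding char_def by (subst integral_distr) auto
      also have "\<dots> = (\<Prod>k\<in>J. char (\<mu> k) (if k = j then u else 0))"
        using char[of "\<lambda>k. if k = j then u else 0"] unfolding eq .
      also have "\<dots> = char (\<mu> j) u"
        using J \<open>j \<in> J\<close> by (subst prod.remove[of J j]) (auto simp: \<mu>.char_zero)
      finally show "char (distr M borel (X j)) u = char (\<mu> j) u" .
    qed
  qed (rule \<mu>)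
  \<comment> \<open>\<open>K\<close> holds the coordinates already turned into indicators. The
    frequencies stay arbitrary because the induction step uses the hypothesis at several of
    them.\<close>
  have main: "(\<integral>\<omega>. iexp (\<Sum>j\<in>J - K. u j * X j \<omega>) * of_real (\<Prod>j\<in>K. indicator (A j) (X j \<omega>)) \<partial>M)
      = (\<Prod>j\<in>K. measure (\<mu> j) (A j)) * (\<Prod>j\<in>J - K. char (\<mu> j) (u j))"
    if "finite K" "K \<subseteq> J" and A: "\<And>j. A j \<in> sets borel" for K A u
    using that(1,2)
  proof (induction K arbitrary: u rule: finite_induct)
    case empty
    then show ?case using char[of u] by simp
  next
    case (insert i K)
    note [measurable] = A
    define Y where "Y \<omega> = (\<Sum>j\<in>J - insert i K. u j * X j \<omega>)" for \<omega>
    define V where "V \<omega> = (\<Prod>j\<in>K. indicator (A j) (X j \<omega>) :: real)" for \<omega>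
    have i: "i \<in> J - K" "J - K - {i} = J - insert i K" "finite (J - K)" using insert J by auto
    have meas [measurable]: "Y \<in> borel_measurable M" "V \<in> borel_measurable M"
      unfolding Y_def[abs_def] V_def[abs_def] by measurable
    have V01: "0 \<le> V \<omega>" "V \<omega> \<le> 1" for \<omega>
      unfolding V_def by (auto intro!: prod_nonneg prod_le_1)
    \<comment> \<open>The factor r scales all remaining frequencies at once, so the remaining
      coordinates act as the single variable \<open>Y\<close>.\<close>
    define C where "C r = (\<Prod>j\<in>K. measure (\<mu> j) (A j)) * (\<Prod>j\<in>J - insert i K. char (\<mu> j) (r * u j))" for r
    have IH: "(\<integral>\<omega>. iexp (v * X i \<omega> + r * Y \<omega>) * V \<omega> \<partial>M) = char (\<mu> i) v * C r" for v r
    proof -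
      define u' where "u' j = (if j = i then v else r * u j)" for j
      have "(\<Sum>j\<in>J - K. u' j * X j \<omega>) = v * X i \<omega> + r * Y \<omega>" for \<omega>
        using i(2) by (subst sum.remove[OF i(3,1)])
          (auto simp: u'_def Y_def sum_distrib_left mult.assoc intro!: sum.cong)
      moreover have "(\<Prod>j\<in>J - K. char (\<mu> j) (u' j)) = char (\<mu> i) v * (\<Prod>j\<in>J - insert i K. char (\<mu> j) (r * u j))"
        using i(2) by (subst prod.remove[OF i(3,1)]) (auto simp: u'_def intro!: prod.cong)
      ultimately show ?thesis
        using insert.IH[of u'] insert.prems by (simp add: V_def C_def mult_ac)
    qed
    have "(\<integral>\<omega>. iexp (Y \<omega>) * (indicator (A i) (X i \<omega>) * V \<omega>) \<partial>M) = measure (\<mu> i) (A i) * (\<integral>\<omega>. iexp (Y \<omega>) * V \<omega> \<partial>M)"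
    proof (rule factor_indicator_of_char[OF X meas A V01 \<mu>])
      show "(\<integral>\<omega>. iexp (v * X i \<omega> + r * Y \<omega>) * V \<omega> \<partial>M) = char (\<mu> i) v * (\<integral>\<omega>. iexp (r * Y \<omega>) * V \<omega> \<partial>M)" for v r
        using IH[of v r] IH[of 0 r] by (simp add: \<mu>.char_zero)
    qed
    also have "(\<integral>\<omega>. iexp (Y \<omega>) * V \<omega> \<partial>M) = C 1"
      using IH[of 0 1] by (simp add: \<mu>.char_zero)
    finally show ?case
      using insert by (simp add: Y_def V_def C_def mult_ac)
  qed
  show "indep_vars (\<lambda>_. borel) X J"
  proof (cases "J = {}")
    case False
    have "distr M (\<Pi>\<^sub>M j\<in>J. borel) (\<lambda>\<omega>. \<lambda>j\<in>J. X j \<omega>) = (\<Pi>\<^sub>M j\<in>J. \<mu> j)"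
    proof (rule product_sigma_finite.PiM_eqI[OF _ J])
      show "product_sigma_finite \<mu>"
        by (simp add: product_sigma_finite_def \<mu>.sigma_finite_measure_axioms)
      show "sets (distr M (\<Pi>\<^sub>M j\<in>J. borel) (\<lambda>\<omega>. \<lambda>j\<in>J. X j \<omega>)) = sets (Pi\<^sub>M J \<mu>)"
        by (auto intro!: sets_PiM_cong)
      fix A assume A: "\<And>j. j \<in> J \<Longrightarrow> A j \<in> sets (\<mu> j)"
      \<comment> \<open>The empty set off \<open>J\<close> makes \<open>A'\<close> measurable at
        every index, as \<open>main\<close> demands.\<close>
      define A' where "A' j = (if j \<in> J then A j else {})" for j
      have A' [measurable]: "A' j \<in> sets borel" for j using A[of j] by (simp add: A'_def)
      have eq: "(\<lambda>\<omega>. \<lambda>j\<in>J. X j \<omega>) -` Pi\<^sub>E J A \<inter> space M = {\<omega> \<in> space M. \<forall>j\<in>J. X j \<omega> \<in> A' j}"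
        by (auto simp: A'_def PiE_iff)
      have "(\<integral>\<omega>. (\<Prod>j\<in>J. indicator (A' j) (X j \<omega>) :: real) \<partial>M) = (\<Prod>j\<in>J. measure (\<mu> j) (A' j))"
      proof -
        have "complex_of_real (\<integral>\<omega>. (\<Prod>j\<in>J. indicator (A' j) (X j \<omega>)) \<partial>M) = of_real (\<Prod>j\<in>J. measure (\<mu> j) (A' j))"
          using main[OF J subset_refl A', of "\<lambda>_. 0"] by (simp flip: of_real_prod)
        then show ?thesis by (simp only: of_real_eq_iff)
      qed
      also have "(\<integral>\<omega>. (\<Prod>j\<in>J. indicator (A' j) (X j \<omega>) :: real) \<partial>M) = (\<integral>\<omega>. indicator {\<omega> \<in> space M. \<forall>j\<in>J. X j \<omega> \<in> A' j} \<omega> \<partial>M)"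
        using J by (intro Bochner_Integration.integral_cong) (auto simp: indicator_def prod_eq_1_iff)
      also have "\<dots> = measure M {\<omega> \<in> space M. \<forall>j\<in>J. X j \<omega> \<in> A' j}"
        by (simp add: Int_absorb2 subset_iff)
      finally have "emeasure M {\<omega> \<in> space M. \<forall>j\<in>J. X j \<omega> \<in> A' j} = ennreal (\<Prod>j\<in>J. measure (\<mu> j) (A' j))"
        by (simp add: emeasure_eq_measure)
      also have "\<dots> = (\<Prod>j\<in>J. emeasure (\<mu> j) (A j))"
        by (simp add: prod_ennreal[symmetric] \<mu>.emeasure_eq_measure A'_def)
      finally show "emeasure (distr M (\<Pi>\<^sub>M j\<in>J. borel) (\<lambda>\<omega>. \<lambda>j\<in>J. X j \<omega>)) (Pi\<^sub>E J A) = (\<Prod>j\<in>J. emeasure (\<mu> j) (A j))"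
        using A J by (subst emeasure_distr) (auto simp: eq intro!: sets_PiM_I_finite)
    qed
    also have "\<dots> = (\<Pi>\<^sub>M j\<in>J. distr M borel (X j))"
      by (intro PiM_cong) (auto simp: marg)
    finally show ?thesis
      by (subst indep_vars_iff_distr_eq_PiM[OF False]) auto
  qed (auto simp: indep_vars_def indep_sets_def)
qed

section \<open>The law of the data\<close>

text \<open>The integrands of the two noises are kept apart, since the characteristic function
  involves the norm of each. The equality is almost sure because a stochastic integral is fixed only
  up to null sets.\<close>

definition mixed_wiener ::
  "'w measure \<Rightarrow> (real \<Rightarrow> 'w \<Rightarrow> real) \<Rightarrow> (real \<Rightarrow> 'w \<Rightarrow> real) \<Rightarrow> (real \<Rightarrow> real) \<Rightarrow> (real \<Rightarrow> real) \<Rightarrow> ('w \<Rightarrow> real) \<Rightarrow> bool" where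
  "mixed_wiener M B B' z z' X \<longleftrightarrow> X \<in> borel_measurable M
    \<and> (\<exists>Z Z'. wiener_integral M B z Z \<and> wiener_integral M B' z' Z' \<and> (AE \<omega> in M. X \<omega> = Z \<omega> + Z' \<omega>))"

lemma mixed_wiener_sum:
  assumes bm: "brownian_motion M B" "brownian_motion M B'"
    and J: "finite J" "\<And>j. j \<in> J \<Longrightarrow> mixed_wiener M B B' (z j) (z' j) (X j)"
  shows "mixed_wiener M B B' (\<lambda>u. \<Sum>j\<in>J. r j * z j u) (\<lambda>u. \<Sum>j\<in>J. r j * z' j u) (\<lambda>\<omega>. \<Sum>j\<in>J. r j * X j \<omega>)"
proof -
  have B: "B t \<in> borel_measurable M" "B' t \<in> borel_measurable M" if "0 \<le> t" for t
    using bm that by (auto simp: brownian_motion_def)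
  have "\<forall>j\<in>J. \<exists>Z Z'. wiener_integral M B (z j) Z \<and> wiener_integral M B' (z' j) Z' \<and> (AE \<omega> in M. X j \<omega> = Z \<omega> + Z' \<omega>)"
    using J unfolding mixed_wiener_def by blast
  then obtain Z Z' where Z: "\<And>j. j \<in> J \<Longrightarrow> wiener_integral M B (z j) (Z j)"
      "\<And>j. j \<in> J \<Longrightarrow> wiener_integral M B' (z' j) (Z' j)"
    and AE: "\<And>j. j \<in> J \<Longrightarrow> AE \<omega> in M. X j \<omega> = Z j \<omega> + Z' j \<omega>"
    by metis
  have "AE \<omega> in M. \<forall>j\<in>J. X j \<omega> = Z j \<omega> + Z' j \<omega>"
    using AE J(1) by (subst AE_ball_countable) (auto intro: countable_finite)
  then have "AE \<omega> in M. (\<Sum>j\<in>J. r j * X j \<omega>) = (\<Sum>j\<in>J. r j * Z j \<omega>) + (\<Sum>j\<in>J. r j * Z' j \<omega>)"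
    by eventually_elim (simp add: sum.distrib[symmetric] distrib_left)
  moreover have "(\<lambda>\<omega>. \<Sum>j\<in>J. r j * X j \<omega>) \<in> borel_measurable M"
    using J by (intro borel_measurable_sum borel_measurable_times) (auto simp: mixed_wiener_def)
  ultimately show ?thesis
    unfolding mixed_wiener_def
    by (intro conjI exI[of _ "\<lambda>\<omega>. \<Sum>j\<in>J. r j * Z j \<omega>"] exI[of _ "\<lambda>\<omega>. \<Sum>j\<in>J. r j * Z' j \<omega>"] wiener_integral_sum B J(1) Z)
qed

lemma mixed_wiener_lincomb2:
  assumes bm: "brownian_motion M B" "brownian_motion M B'"
    and "mixed_wiener M B B' z z' X" "mixed_wiener M B B' w w' Y"
  shows "mixed_wiener M B B' (\<lambda>u. a * z u + b * w u) (\<lambda>u. a * z' u + b * w' u) (\<lambda>\<omega>. a * X \<omega> + b * Y \<omega>)"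
proof -
  let ?c = "case_bool a b"
  have "mixed_wiener M B B' (\<lambda>u. \<Sum>j\<in>UNIV. ?c j * case_bool z w j u) (\<lambda>u. \<Sum>j\<in>UNIV. ?c j * case_bool z' w' j u)
      (\<lambda>\<omega>. \<Sum>j\<in>UNIV. ?c j * case_bool X Y j \<omega>)"
    by (rule mixed_wiener_sum[OF bm]) (use assms in \<open>auto split: bool.split\<close>)
  then show ?thesis by (simp add: UNIV_bool add.commute)
qed

lemma mixed_wiener_char:
  assumes bm: "brownian_motion M B" "brownian_motion M B'" and ind: "independent_processes M B B'"
    and X: "mixed_wiener M B B' z z' X"
  shows "(\<integral>\<omega>. iexp (X \<omega>) \<partial>M) = of_real (exp (- ((\<integral>u. (z u)\<^sup>2 \<partial>lborel) + (\<integral>u. (z' u)\<^sup>2 \<partial>lborel)) / 2))"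
proof -
  obtain Z Z' where Z: "wiener_integral M B z Z" "wiener_integral M B' z' Z'" "AE \<omega> in M. X \<omega> = Z \<omega> + Z' \<omega>"
    and [measurable]: "X \<in> borel_measurable M"
    using X unfolding mixed_wiener_def by blast
  have [measurable]: "Z \<in> borel_measurable M" "Z' \<in> borel_measurable M"
    using Z by (auto simp: wiener_integral_def)
  have "(\<integral>\<omega>. iexp (X \<omega>) \<partial>M) = (\<integral>\<omega>. iexp (Z \<omega> + Z' \<omega>) \<partial>M)"
    using Z(3) by (intro integral_cong_AE) auto
  then show ?thesis
    by (simp only: independent_wiener_integral_char[OF bm ind Z(1,2)])
qed

text \<open>The truncations to [0, t] and [0, s] differ by the half-open cell (s, t], and the
  initial value cancels. Half-open cells are disjoint, which later separates the increments.\<close>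

lemma forward_price_increment:
  assumes bm: "brownian_motion M B" "brownian_motion M B'"
    and X: "forward_price M T x0 (\<theta>, \<sigma>, \<sigma>') B B' Tj X" and st: "0 \<le> s" "s \<le> t" "t \<le> T"
  shows "mixed_wiener M B B' (\<lambda>u. indicator {s<..t} u * (exp (- \<theta> * (Tj - u)) * \<sigma> u)) (\<lambda>u. indicator {s<..t} u * \<sigma>' u)
    (\<lambda>\<omega>. X t \<omega> - X s \<omega>)"
proof -
  let ?f = "\<lambda>u. exp (- \<theta> * (Tj - u)) * \<sigma> u"
  have val: "mixed_wiener M B B' (\<lambda>u. indicator {0..r} u * ?f u) (\<lambda>u. indicator {0..r} u * \<sigma>' u) (\<lambda>\<omega>. X r \<omega> - x0)"
    if "r \<in> {0..T}" for r
  proof -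
    from X that obtain I J where IJ: "has_stochastic_integral M B r ?f I" "has_stochastic_integral M B' r \<sigma>' J"
      "AE \<omega> in M. X r \<omega> = x0 + I \<omega> + J \<omega>" "X r \<in> borel_measurable M"
      unfolding forward_price_def by fastforce
    have "AE \<omega> in M. X r \<omega> - x0 = I \<omega> + J \<omega>"
      using IJ(3) by eventually_elim simp
    then show ?thesis
      unfolding mixed_wiener_def
      using has_stochastic_integral_imp_wiener[OF IJ(1)] has_stochastic_integral_imp_wiener[OF IJ(2)] IJ(4) that by auto
  qed
  have "mixed_wiener M B B' (\<lambda>u. 1 * (indicator {0..t} u * ?f u) + (- 1) * (indicator {0..s} u * ?f u))
      (\<lambda>u. 1 * (indicator {0..t} u * \<sigma>' u) + (- 1) * (indicator {0..s} u * \<sigma>' u)) (\<lambda>\<omega>. 1 * (X t \<omega> - x0) + (- 1) * (X s \<omega> - x0))"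
    by (rule mixed_wiener_lincomb2[OF bm val val]) (use st in auto)
  moreover have eq: "1 * (indicator {0..t} u * g u) + (- 1) * (indicator {0..s} u * g u) = indicator {s<..t} u * g u"
    for u and g :: "real \<Rightarrow> real"
    using st by (auto simp: indicator_def)
  ultimately have "mixed_wiener M B B' (\<lambda>u. indicator {s<..t} u * ?f u) (\<lambda>u. indicator {s<..t} u * \<sigma>' u)
      (\<lambda>\<omega>. 1 * (X t \<omega> - x0) + (- 1) * (X s \<omega> - x0))"
    by (simp only: eq[of _ ?f] eq[of _ \<sigma>'])
  then show ?thesis by simp
qed

section \<open>The bivariate normal law of a cell\<close>

text \<open>The law of (d, r d + e) for independent centred normals d and e with variances a and b.
  It is given by its density since likelihood ratios are formed from it.\<close>

definition pair_law :: "real \<Rightarrow> real \<Rightarrow> real \<Rightarrow> (real \<times> real) measure" where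
  "pair_law a b r = density lborel (\<lambda>(d, y). ennreal (normal_density 0 (sqrt a) d * normal_density (r * d) (sqrt b) y))"

lemma sets_pair_law [measurable_cong, simp]: "sets (pair_law a b r) = sets borel"
  by (simp add: pair_law_def)

text \<open>For fixed d the shear is a translation of the second coordinate, so Fubini and
  translation invariance of Lebesgue measure yield the density.\<close>

lemma distr_shear_normal:
  fixes a b r :: real
  assumes "0 < a" "0 < b"
  defines "Na \<equiv> density lborel (normal_density 0 (sqrt a))" and "Nb \<equiv> density lborel (normal_density 0 (sqrt b))"
  shows "distr (Na \<Otimes>\<^sub>M Nb) borel (\<lambda>(d, e). (d, e + r * d)) = pair_law a b r"
proof (rule measure_eqI)
  fix A :: "(real \<times> real) set" assume "A \<in> sets (distr (Na \<Otimes>\<^sub>M Nb) borel (\<lambda>(d, e). (d, e + r * d)))"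
  then have [measurable]: "A \<in> sets borel" by simp
  then have [measurable]: "A \<in> sets (borel \<Otimes>\<^sub>M borel)" by (simp only: borel_prod)
  interpret Nb: prob_space Nb using assms by (auto simp: Nb_def intro: prob_space_normal_density)
  have sets: "sets (Na \<Otimes>\<^sub>M Nb) = sets borel" "space (Na \<Otimes>\<^sub>M Nb) = UNIV"
    by (auto simp: Na_def Nb_def borel_prod[symmetric] space_pair_measure intro!: sets_pair_measure_cong)
  have "(\<lambda>(d, e). (d, e + r * d)) \<in> borel_measurable (Na \<Otimes>\<^sub>M Nb)"
    unfolding borel_prod[symmetric] by (simp add: Na_def Nb_def)
  then have "emeasure (distr (Na \<Otimes>\<^sub>M Nb) borel (\<lambda>(d, e). (d, e + r * d))) A
      = (\<integral>\<^sup>+x. indicator A (case x of (d, e) \<Rightarrow> (d, e + r * d)) \<partial>(Na \<Otimes>\<^sub>M Nb))"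
    by (subst nn_integral_indicator[symmetric], simp, subst nn_integral_distr) auto
  also have "\<dots> = (\<integral>\<^sup>+d. \<integral>\<^sup>+e. indicator A (d, e + r * d) \<partial>Nb \<partial>Na)"
    by (subst Nb.nn_integral_fst[symmetric]) (auto simp: Na_def Nb_def)
  also have "\<dots> = (\<integral>\<^sup>+d. ennreal (normal_density 0 (sqrt a) d) *
      (\<integral>\<^sup>+e. ennreal (normal_density 0 (sqrt b) e) * indicator A (d, e + r * d) \<partial>lborel) \<partial>lborel)"
    unfolding Na_def Nb_def
    by (subst nn_integral_density) (auto simp: nn_integral_density intro!: nn_integral_cong)
  also have "\<dots> = (\<integral>\<^sup>+d. \<integral>\<^sup>+y. ennreal (normal_density 0 (sqrt a) d * normal_density (r * d) (sqrt b) y) * indicator A (d, y) \<partial>lborel \<partial>lborel)"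
  proof (rule nn_integral_cong)
    fix d :: real
    have "(\<integral>\<^sup>+y. ennreal (normal_density (r * d) (sqrt b) y) * indicator A (d, y) \<partial>lborel)
      = (\<integral>\<^sup>+e. ennreal (normal_density (r * d) (sqrt b) (r * d + 1 * e)) * indicator A (d, r * d + 1 * e) \<partial>lborel)"
      using nn_integral_real_affine[of "\<lambda>y. ennreal (normal_density (r * d) (sqrt b) y) * indicator A (d, y)" 1 "r * d"] by simp
    also have "\<dots> = (\<integral>\<^sup>+e. ennreal (normal_density 0 (sqrt b) e) * indicator A (d, e + r * d) \<partial>lborel)"
      by (simp add: normal_density_def add.commute)
    finally show "ennreal (normal_density 0 (sqrt a) d) * (\<integral>\<^sup>+e. ennreal (normal_density 0 (sqrt b) e) * indicator A (d, e + r * d) \<partial>lborel)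
      = (\<integral>\<^sup>+y. ennreal (normal_density 0 (sqrt a) d * normal_density (r * d) (sqrt b) y) * indicator A (d, y) \<partial>lborel)"
      by (simp add: ennreal_mult mult.assoc nn_integral_cmult)
  qed
  also have "\<dots> = (\<integral>\<^sup>+x. (case x of (d, y) \<Rightarrow> ennreal (normal_density 0 (sqrt a) d * normal_density (r * d) (sqrt b) y)) * indicator A x \<partial>(lborel \<Otimes>\<^sub>M lborel))"
    by (subst lborel.nn_integral_fst[symmetric]) (auto simp: normal_density_def)
  also have "\<dots> = emeasure (pair_law a b r) A"
    unfolding pair_law_def lborel_prod by (subst emeasure_density) (auto simp: normal_density_def simp flip: borel_prod)
  finally show "emeasure (distr (Na \<Otimes>\<^sub>M Nb) borel (\<lambda>(d, e). (d, e + r * d))) A = emeasure (pair_law a b r) A" .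
qed simp

lemma lborel_integral_Ioc:
  fixes g :: "real \<Rightarrow> real"
  assumes "continuous_on {a..b} g"
  shows "integrable lborel (\<lambda>u. indicator {a<..b} u * g u)" "(\<integral>u. indicator {a<..b} u * g u \<partial>lborel) = integral {a..b} g"
proof -
  have int: "set_integrable lborel {a..b} g"
    using assms by (rule borel_integrable_atLeastAtMost')
  then have int': "set_integrable lborel {a<..b} g"
    by (rule set_integrable_subset) auto
  then show "integrable lborel (\<lambda>u. indicator {a<..b} u * g u)"
    by (simp add: set_integrable_def)
  have ae: "AE u in lborel. indicator {a<..b} u * g u = indicator {a..b} u *\<^sub>R g u"
    using AE_lborel_singleton[of a] by eventually_elim (auto simp: indicator_def)
  have "(\<integral>u. indicator {a<..b} u * g u \<partial>lborel) = (\<integral>u. indicator {a..b} u *\<^sub>R g u \<partial>lborel)"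
    using int int' ae by (intro integral_cong_AE) (auto simp: set_integrable_def)
  also have "\<dots> = integral {a..b} g"
    using set_borel_integral_eq_integral(2)[OF int] by (simp add: set_lebesgue_integral_def)
  finally show "(\<integral>u. indicator {a<..b} u * g u \<partial>lborel) = integral {a..b} g" .
qed

lemma disjoint_indicator_sum_square:
  fixes f :: "'i \<Rightarrow> real"
  assumes "finite S" "disjoint_family_on I S"
  shows "(\<Sum>i\<in>S. indicator (I i) x * f i)\<^sup>2 = (\<Sum>i\<in>S. indicator (I i) x * (f i)\<^sup>2)"
proof (cases "\<exists>i\<in>S. x \<in> I i")
  case True
  then obtain i where i: "i \<in> S" "x \<in> I i" by auto
  then have "x \<notin> I j" if "j \<in> S - {i}" for j
    using assms(2) that by (auto simp: disjoint_family_on_def)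
  then have "(\<Sum>j\<in>S. indicator (I j) x * g j) = g i" for g :: "'i \<Rightarrow> real"
    using assms(1) i by (subst sum.remove[of S i]) auto
  then show ?thesis by simp
next
  case False
  then show ?thesis by simp
qed

lemma integral_pos_of_pos:
  fixes g :: "real \<Rightarrow> real"
  assumes "a < b" "continuous_on {a..b} g" "\<And>x. x \<in> {a..b} \<Longrightarrow> 0 < g x"
  shows "0 < integral {a..b} g"
proof -
  obtain x where x: "x \<in> {a..b}" "\<forall>y\<in>{a..b}. g x \<le> g y"
    using continuous_attains_inf[of "{a..b}" g] assms by auto
  have "0 < g x * (b - a)" using x assms by simp
  also have "\<dots> = integral {a..b} (\<lambda>_. g x)" using assms(1) by simp
  also have "\<dots> \<le> integral {a..b} g"
    using x assms by (intro integral_le integrable_continuous_interval) auto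
  finally show ?thesis .
qed

section \<open>Cells of the observation grid and the change of coordinates\<close>

definition cell_integral :: "real \<Rightarrow> nat \<Rightarrow> (real \<Rightarrow> real) \<Rightarrow> nat \<Rightarrow> real" where
  "cell_integral T n g i = integral {(real i - 1) * (T / real n)..real i * (T / real n)} g"

definition price_scale :: "real \<Rightarrow> real \<Rightarrow> real \<Rightarrow> real" where
  "price_scale T1 T2 \<theta> = exp (- \<theta> * T1) - exp (- \<theta> * T2)"

definition regression_slope :: "real \<Rightarrow> real \<Rightarrow> real \<Rightarrow> real" where
  "regression_slope T1 T2 \<theta> = exp (- \<theta> * T2) / price_scale T1 T2 \<theta>"

text \<open>Recovers the increments of X1 and X2 from the coordinates (X1 - X2, X2). A bounded
  statistic of the data stays bounded after composition with it, so divergences can be computed in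
  the regression coordinates.\<close>

definition observe :: "nat \<Rightarrow> (nat \<Rightarrow> real \<times> real) \<Rightarrow> nat \<Rightarrow> real \<times> real" where
  "observe n y = (\<lambda>i\<in>{1..n}. (fst (y i) + snd (y i), snd (y i)))"

lemma measurable_observe [measurable]: "observe n \<in> measurable (data_space n) (data_space n)"
  unfolding observe_def[abs_def] by (intro measurable_restrict) (simp add: borel_prod[symmetric])

lemma cell_subset:
  assumes "0 < T" "i \<in> {1..n}"
  shows "{(real i - 1) * (T / real n)..real i * (T / real n)} \<subseteq> {0..T}"
    and "real i * (T / real n) - (real i - 1) * (T / real n) = T / real n"
    and "(real i - 1) * (T / real n) < real i * (T / real n)"
proof -
  have n: "0 < real n" using assms by simp
  have "real i * T \<le> real n * T" using assms by (intro mult_right_mono) auto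
  then have "real i * (T / real n) \<le> T" using n by (simp add: field_simps)
  moreover have "0 \<le> (real i - 1) * (T / real n)" using assms by (intro mult_nonneg_nonneg) auto
  ultimately show "{(real i - 1) * (T / real n)..real i * (T / real n)} \<subseteq> {0..T}" by auto
  show "real i * (T / real n) - (real i - 1) * (T / real n) = T / real n"
    by (simp add: left_diff_distrib diff_divide_distrib)
  moreover have "0 < T / real n" using n assms(1) by simp
  ultimately show "(real i - 1) * (T / real n) < real i * (T / real n)" by linarith
qed

text \<open>In the coordinates \<open>(\<Delta>X\<^sup>1 - \<Delta>X\<^sup>2, \<Delta>X\<^sup>2)\<close> the second factor enters the second coordinate
  only, so the second coordinate is a regression on the first one with independent noise.\<close>

lemma data_law_eq:
  fixes n :: nat
  assumes model: "two_factor_model M T T1 T2 x1 x2 (\<theta>, \<sigma>, \<sigma>') B B' X1 X2"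
    and pos: "0 < T" "0 < \<theta>" "T1 < T2" "1 \<le> n"
    and cont: "continuous_on {0..T} \<sigma>" "continuous_on {0..T} \<sigma>'"
    and vol_pos: "\<And>t. t \<in> {0..T} \<Longrightarrow> 0 < \<sigma> t" "\<And>t. t \<in> {0..T} \<Longrightarrow> 0 < \<sigma>' t"
  defines "a \<equiv> cell_integral T n (\<lambda>s. (price_scale T1 T2 \<theta>)\<^sup>2 * exp (2 * \<theta> * s) * (\<sigma> s)\<^sup>2)"
    and "b \<equiv> cell_integral T n (\<lambda>s. (\<sigma>' s)\<^sup>2)"
  shows "data_law M T n X1 X2 = distr (\<Pi>\<^sub>M i\<in>{1..n}. pair_law (a i) (b i) (regression_slope T1 T2 \<theta>)) (data_space n) (observe n)"
proof -
  have bm: "brownian_motion M B" "brownian_motion M B'" and ind: "independent_processes M B B'"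
    and X: "forward_price M T x1 (\<theta>, \<sigma>, \<sigma>') B B' T1 X1" "forward_price M T x2 (\<theta>, \<sigma>, \<sigma>') B B' T2 X2"
    using model by (auto simp: two_factor_model_def)
  interpret prob_space M using bm by (simp add: brownian_motion_def)
  define k where "k = price_scale T1 T2 \<theta>"
  define \<rho> where "\<rho> = regression_slope T1 T2 \<theta>"
  define lo where "lo i = (real i - 1) * (T / real n)" for i :: nat
  define hi where "hi i = real i * (T / real n)" for i :: nat
  have k: "0 < k" using pos by (simp add: k_def price_scale_def)
  have \<rho>k: "\<rho> * k = exp (- \<theta> * T2)" using k by (simp add: \<rho>_def k_def regression_slope_def)
  have lohi: "0 \<le> lo i" "lo i < hi i" "hi i \<le> T" if "i \<in> {1..n}" for i
    using that pos by (auto simp: lo_def hi_def field_simps)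
  have sub: "{lo i..hi i} \<subseteq> {0..T}" if "i \<in> {1..n}" for i
    using lohi[OF that] by auto
  define I where "I i = {lo i<..hi i}" for i
  have disj: "disjoint_family_on I {1..n}"
    unfolding disjoint_family_on_def
  proof (intro ballI impI)
    fix i j assume "i \<in> {1..n}" "j \<in> {1..n}" "i \<noteq> j"
    have "hi i \<le> lo j" if "i < j" for i j
      using that pos unfolding lo_def hi_def by (intro mult_right_mono) auto
    with \<open>i \<noteq> j\<close> show "I i \<inter> I j = {}"
      by (cases i j rule: linorder_cases) (force simp: I_def)+
  qed
  define g where "g u = k * exp (\<theta> * u) * \<sigma> u" for u
  have g2: "(g u)\<^sup>2 = k\<^sup>2 * exp (2 * \<theta> * u) * (\<sigma> u)\<^sup>2" for u
    by (simp add: g_def power_mult_distrib exp_double[symmetric] mult.assoc)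
  have cont_cell: "continuous_on {lo i..hi i} (\<lambda>u. (g u)\<^sup>2)" "continuous_on {lo i..hi i} (\<lambda>u. (\<sigma>' u)\<^sup>2)" if "i \<in> {1..n}" for i
    using continuous_on_subset[OF cont(1) sub[OF that]] continuous_on_subset[OF cont(2) sub[OF that]]
    unfolding g_def by (auto intro!: continuous_intros)
  have a: "a i = integral {lo i..hi i} (\<lambda>u. (g u)\<^sup>2)" and b: "b i = integral {lo i..hi i} (\<lambda>u. (\<sigma>' u)\<^sup>2)" for i
    by (simp_all add: a_def b_def cell_integral_def lo_def hi_def g2 k_def)
  have a_pos: "0 < a i" and b_pos: "0 < b i" if "i \<in> {1..n}" for i
    unfolding a b using that cont_cell lohi[OF that] k vol_pos sub[OF that]
    by (auto intro!: integral_pos_of_pos zero_less_power simp: g_def intro: mult_pos_pos dest!: subsetD)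
  define X where "X i = increment T n X1 i" for i
  define Y where "Y i = increment T n X2 i" for i
  have XY: "X i = (\<lambda>\<omega>. X1 (hi i) \<omega> - X1 (lo i) \<omega>)" "Y i = (\<lambda>\<omega>. X2 (hi i) \<omega> - X2 (lo i) \<omega>)" for i
    by (auto simp: X_def Y_def increment_def lo_def hi_def)
  have mX: "mixed_wiener M B B' (\<lambda>u. indicator (I i) u * (exp (- \<theta> * (T1 - u)) * \<sigma> u)) (\<lambda>u. indicator (I i) u * \<sigma>' u) (X i)"
    and mY: "mixed_wiener M B B' (\<lambda>u. indicator (I i) u * (exp (- \<theta> * (T2 - u)) * \<sigma> u)) (\<lambda>u. indicator (I i) u * \<sigma>' u) (Y i)"
    if "i \<in> {1..n}" for i
    using forward_price_increment[OF bm X(1), of "lo i" "hi i"] forward_price_increment[OF bm X(2), of "lo i" "hi i"] lohi[OF that]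
    unfolding XY I_def by auto
  define D where "D i \<omega> = X i \<omega> - Y i \<omega>" for i \<omega>
  define E where "E i \<omega> = Y i \<omega> - \<rho> * D i \<omega>" for i \<omega>
  have mD: "mixed_wiener M B B' (\<lambda>u. indicator (I i) u * g u) (\<lambda>u. 0) (D i)" if "i \<in> {1..n}" for i
  proof -
    have "1 * (indicator (I i) u * (exp (- \<theta> * (T1 - u)) * \<sigma> u)) + (- 1) * (indicator (I i) u * (exp (- \<theta> * (T2 - u)) * \<sigma> u))
        = indicator (I i) u * g u" for u
      by (simp add: g_def k_def price_scale_def algebra_simps exp_diff exp_minus divide_inverse)
    then show ?thesis
      using mixed_wiener_lincomb2[OF bm mX[OF that] mY[OF that], of 1 "- 1"] by (simp add: D_def[abs_def])
  qed
  have mE: "mixed_wiener M B B' (\<lambda>u. 0) (\<lambda>u. indicator (I i) u * \<sigma>' u) (E i)" if "i \<in> {1..n}" for i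
  proof -
    \<comment> \<open>The slope matches the loading of \<open>Y\<close> on the first noise exactly,
      so that noise cancels in \<open>E\<close> and only the second one remains.\<close>
    have "\<rho> * g u = exp (- \<theta> * (T2 - u)) * \<sigma> u" for u
    proof -
      have "\<rho> * g u = (\<rho> * k) * exp (\<theta> * u) * \<sigma> u" by (simp add: g_def)
      also have "\<dots> = exp (- \<theta> * (T2 - u)) * \<sigma> u" unfolding \<rho>k by (simp add: right_diff_distrib exp_add[symmetric])
      finally show ?thesis .
    qed
    then have eq: "1 * (indicator (I i) u * (exp (- \<theta> * (T2 - u)) * \<sigma> u)) + (- \<rho>) * (indicator (I i) u * g u) = 0" for u
      by (simp add: indicator_def)
    show ?thesis
      using mixed_wiener_lincomb2[OF bm mY[OF that] mD[OF that], of 1 "- \<rho>"] unfolding eq by (simp add: E_def[abs_def])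
  qed
  have D_meas: "D i \<in> borel_measurable M" and E_meas: "E i \<in> borel_measurable M" if "i \<in> {1..n}" for i
    using mD[OF that] mE[OF that] by (auto simp: mixed_wiener_def)
  define J where "J = {1..n} \<times> (UNIV :: bool set)"
  \<comment> \<open>Index (i, True) carries \<open>D i\<close> and (i, False) carries
    \<open>E i\<close>. Off the cells \<open>F\<close> is 0 and the variance \<open>v\<close> is 1,
    because the independence criterion asks for measurability and a probability law at every
    index.\<close>
  define F where "F j = (if fst j \<in> {1..n} then if snd j then D (fst j) else E (fst j) else (\<lambda>_. 0))" for j
  define v where "v j = (if fst j \<in> {1..n} then if snd j then a (fst j) else b (fst j) else 1)" for j
  define \<mu> where "\<mu> j = density lborel (normal_density 0 (sqrt (v j)))" for j
  have finJ: "finite J" by (simp add: J_def)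
  have F_meas [measurable]: "F j \<in> borel_measurable M" for j
    using D_meas[of "fst j"] E_meas[of "fst j"] by (simp add: F_def)
  have v_pos: "0 < v j" for j using a_pos b_pos by (simp add: v_def)
  have \<mu>_prob: "prob_space (\<mu> j)" for j
    unfolding \<mu>_def using v_pos[of j] by (intro prob_space_normal_density) simp
  have \<mu>_dist: "real_distribution (\<mu> j)" for j
    using \<mu>_prob[of j] by (auto intro!: real_distribution.intro simp: real_distribution_axioms_def \<mu>_def)
  have sumJ: "(\<Sum>j\<in>J. h j) = (\<Sum>i\<in>{1..n}. h (i, True) + h (i, False))" for h :: "nat \<times> bool \<Rightarrow> real"
    unfolding J_def by (subst sum.cartesian_product') (simp add: UNIV_bool add.commute)
  \<comment> \<open>The cells are disjoint, so the square of the sum has no cross terms and each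
    frequency meets only the variance of its own cell.\<close>
  have cell_sum: "(\<integral>x. (\<Sum>i\<in>{1..n}. indicator (I i) x * (c i * f x))\<^sup>2 \<partial>lborel)
      = (\<Sum>i\<in>{1..n}. (c i)\<^sup>2 * integral {lo i..hi i} (\<lambda>x. (f x)\<^sup>2))"
    if f: "\<And>i. i \<in> {1..n} \<Longrightarrow> continuous_on {lo i..hi i} (\<lambda>x. (f x)\<^sup>2)" for c :: "nat \<Rightarrow> real" and f :: "real \<Rightarrow> real"
  proof -
    have "(\<integral>x. (\<Sum>i\<in>{1..n}. indicator (I i) x * (c i * f x))\<^sup>2 \<partial>lborel)
        = (\<integral>x. (\<Sum>i\<in>{1..n}. (c i)\<^sup>2 * (indicator (I i) x * (f x)\<^sup>2)) \<partial>lborel)"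
      by (rule Bochner_Integration.integral_cong[OF refl], subst disjoint_indicator_sum_square[OF _ disj])
        (auto simp: power_mult_distrib mult_ac)
    also have "\<dots> = (\<Sum>i\<in>{1..n}. (c i)\<^sup>2 * (\<integral>x. indicator (I i) x * (f x)\<^sup>2 \<partial>lborel))"
      using lborel_integral_Ioc(1)[OF f] unfolding I_def
      by (subst Bochner_Integration.integral_sum) (auto intro!: integrable_mult_right)
    also have "\<dots> = (\<Sum>i\<in>{1..n}. (c i)\<^sup>2 * integral {lo i..hi i} (\<lambda>x. (f x)\<^sup>2))"
      using lborel_integral_Ioc(2)[OF f] unfolding I_def by (intro sum.cong refl) auto
    finally show ?thesis .
  qed
  have char: "(\<integral>\<omega>. iexp (\<Sum>j\<in>J. u j * F j \<omega>) \<partial>M) = (\<Prod>j\<in>J. char (\<mu> j) (u j))" for u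
  proof -
    define z where "z j x = (if snd j then indicator (I (fst j)) x * g x else 0)" for j :: "nat \<times> bool" and x
    define z' where "z' j x = (if snd j then 0 else indicator (I (fst j)) x * \<sigma>' x)" for j :: "nat \<times> bool" and x
    have "mixed_wiener M B B' (\<lambda>x. \<Sum>j\<in>J. u j * z j x) (\<lambda>x. \<Sum>j\<in>J. u j * z' j x) (\<lambda>\<omega>. \<Sum>j\<in>J. u j * F j \<omega>)"
    proof (rule mixed_wiener_sum[OF bm finJ])
      fix j assume "j \<in> J"
      then show "mixed_wiener M B B' (z j) (z' j) (F j)"
        using mD[of "fst j"] mE[of "fst j"] by (cases "snd j") (auto simp: J_def F_def z_def[abs_def] z'_def[abs_def])
    qed
    from mixed_wiener_char[OF bm ind this]
    have "(\<integral>\<omega>. iexp (\<Sum>j\<in>J. u j * F j \<omega>) \<partial>M)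
        = of_real (exp (- ((\<integral>x. (\<Sum>j\<in>J. u j * z j x)\<^sup>2 \<partial>lborel) + (\<integral>x. (\<Sum>j\<in>J. u j * z' j x)\<^sup>2 \<partial>lborel)) / 2))" .
    also have "(\<lambda>x. (\<Sum>j\<in>J. u j * z j x)\<^sup>2) = (\<lambda>x. (\<Sum>i\<in>{1..n}. indicator (I i) x * (u (i, True) * g x))\<^sup>2)"
      by (auto simp: sumJ z_def mult_ac)
    also have "(\<lambda>x. (\<Sum>j\<in>J. u j * z' j x)\<^sup>2) = (\<lambda>x. (\<Sum>i\<in>{1..n}. indicator (I i) x * (u (i, False) * \<sigma>' x))\<^sup>2)"
      by (auto simp: sumJ z'_def mult_ac)
    also have "(\<integral>x. (\<Sum>i\<in>{1..n}. indicator (I i) x * (u (i, True) * g x))\<^sup>2 \<partial>lborel)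
        + (\<integral>x. (\<Sum>i\<in>{1..n}. indicator (I i) x * (u (i, False) * \<sigma>' x))\<^sup>2 \<partial>lborel) = (\<Sum>j\<in>J. (u j)\<^sup>2 * v j)"
      by (subst (1 2) cell_sum) (auto simp: cont_cell sumJ v_def a b sum.distrib intro!: arg_cong2[where f="(+)"] sum.cong)
    also have "of_real (exp (- (\<Sum>j\<in>J. (u j)\<^sup>2 * v j) / 2)) = (\<Prod>j\<in>J. complex_of_real (exp (- (u j * sqrt (v j))\<^sup>2 / 2)))"
      using v_pos by (simp add: sum_negf[symmetric] sum_divide_distrib exp_sum[OF finJ] power_mult_distrib less_imp_le
          del: of_real_exp sum_negf flip: of_real_prod)
    also have "\<dots> = (\<Prod>j\<in>J. char (\<mu> j) (u j))"
      using v_pos by (simp add: \<mu>_def char_normal)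
    finally show ?thesis .
  qed
  note indep = indep_vars_of_char[OF finJ F_meas \<mu>_dist char]
  have pair: "indep_vars (\<lambda>_. borel) (\<lambda>i \<omega>. (D i \<omega>, Y i \<omega>)) {1..n}"
  proof -
    \<comment> \<open>The independent variables are grouped by cells, and Y = E + \<rho> D is then a
      function of its own group.\<close>
    have "indep_vars (\<lambda>i. Pi\<^sub>M ({i} \<times> UNIV) (\<lambda>_. borel)) (\<lambda>i \<omega>. restrict (\<lambda>j. F j \<omega>) ({i} \<times> UNIV)) {1..n}"
      by (rule indep_vars_restrict[OF indep(1)]) (auto simp: J_def disjoint_family_on_def)
    then have "indep_vars (\<lambda>_. borel) (\<lambda>i \<omega>. (\<lambda>y. (y (i, True), y (i, False) + \<rho> * y (i, True))) (restrict (\<lambda>j. F j \<omega>) ({i} \<times> UNIV))) {1..n}"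
      by (rule indep_vars_compose2) (simp add: borel_prod[symmetric])
    then show ?thesis
      by (rule indep_vars_cong[THEN iffD1, rotated -1]) (auto simp: F_def E_def)
  qed
  have DE: "indep_var borel (D i) borel (E i)" if i: "i \<in> {1..n}" for i
  proof -
    have "indep_vars (\<lambda>c. Pi\<^sub>M {(i, c)} (\<lambda>_. borel)) (\<lambda>c \<omega>. restrict (\<lambda>j. F j \<omega>) {(i, c)}) (UNIV :: bool set)"
      using i by (intro indep_vars_restrict[OF indep(1)]) (auto simp: J_def disjoint_family_on_def)
    then have "indep_vars (\<lambda>_. borel) (\<lambda>c \<omega>. (\<lambda>y. y (i, c)) (restrict (\<lambda>j. F j \<omega>) {(i, c)})) (UNIV :: bool set)"
      by (rule indep_vars_compose2) simp
    then show ?thesis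
      unfolding indep_var_def by (rule indep_vars_cong[THEN iffD1, rotated -1]) (use i in \<open>auto simp: F_def split: bool.split\<close>)
  qed
  have law: "distr M borel (\<lambda>\<omega>. (D i \<omega>, Y i \<omega>)) = pair_law (a i) (b i) \<rho>" if i: "i \<in> {1..n}" for i
  proof -
    note [measurable] = D_meas[OF i] E_meas[OF i]
    have "distr M borel (D i) = \<mu> (i, True)" "distr M borel (E i) = \<mu> (i, False)"
      using indep(2)[of "(i, True)"] indep(2)[of "(i, False)"] i by (auto simp: J_def F_def)
    then have joint: "distr M (borel \<Otimes>\<^sub>M borel) (\<lambda>\<omega>. (D i \<omega>, E i \<omega>)) = \<mu> (i, True) \<Otimes>\<^sub>M \<mu> (i, False)"
      using DE[OF i] by (simp add: indep_var_distribution_eq)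
    have "distr M borel (\<lambda>\<omega>. (D i \<omega>, Y i \<omega>)) = distr M borel ((\<lambda>(d, e). (d, e + \<rho> * d)) \<circ> (\<lambda>\<omega>. (D i \<omega>, E i \<omega>)))"
      by (simp add: comp_def E_def)
    also have "\<dots> = distr (distr M (borel \<Otimes>\<^sub>M borel) (\<lambda>\<omega>. (D i \<omega>, E i \<omega>))) borel (\<lambda>(d, e). (d, e + \<rho> * d))"
      by (rule distr_distr[symmetric]) (auto simp: borel_prod[symmetric])
    also have "\<dots> = pair_law (a i) (b i) \<rho>"
      unfolding joint \<mu>_def using i a_pos[OF i] b_pos[OF i] by (simp add: v_def distr_shear_normal)
    finally show ?thesis .
  qed
  have DY_meas: "(\<lambda>\<omega>. (D i \<omega>, Y i \<omega>)) \<in> borel_measurable M" if "i \<in> {1..n}" for i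
    using pair that by (auto simp: indep_vars_def)
  have prod: "distr M (data_space n) (\<lambda>\<omega>. \<lambda>i\<in>{1..n}. (D i \<omega>, Y i \<omega>)) = (\<Pi>\<^sub>M i\<in>{1..n}. pair_law (a i) (b i) \<rho>)"
  proof -
    have "distr M (data_space n) (\<lambda>\<omega>. \<lambda>i\<in>{1..n}. (D i \<omega>, Y i \<omega>)) = (\<Pi>\<^sub>M i\<in>{1..n}. distr M borel (\<lambda>\<omega>. (D i \<omega>, Y i \<omega>)))"
      using indep_vars_iff_distr_eq_PiM'[where I="{1..n}" and M'="\<lambda>_. borel" and X="\<lambda>i \<omega>. (D i \<omega>, Y i \<omega>)"]
        pair pos DY_meas by simp
    also have "\<dots> = (\<Pi>\<^sub>M i\<in>{1..n}. pair_law (a i) (b i) \<rho>)"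
      by (intro PiM_cong) (auto simp: law)
    finally show ?thesis .
  qed
  have "data_law M T n X1 X2 = distr M (data_space n)
      (observe n \<circ> (\<lambda>\<omega>. \<lambda>i\<in>{1..n}. (D i \<omega>, Y i \<omega>)))"
    unfolding data_law_def by (intro distr_cong refl) (auto simp: observe_def D_def X_def Y_def)
  also have "\<dots> = distr (distr M (data_space n) (\<lambda>\<omega>. \<lambda>i\<in>{1..n}. (D i \<omega>, Y i \<omega>))) (data_space n) (observe n)"
  proof (rule distr_distr[symmetric])
    show "(\<lambda>\<omega>. \<lambda>i\<in>{1..n}. (D i \<omega>, Y i \<omega>)) \<in> measurable M (data_space n)"
      by (intro measurable_restrict DY_meas)
    show "observe n \<in> measurable (data_space n) (data_space n)" by measurable
  qed
  finally show ?thesis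
    unfolding prod \<rho>_def .
qed

section \<open>The chi-square divergence of the regression experiments\<close>

lemma integral_mult_square_le:
  fixes f g :: "'a \<Rightarrow> real"
  assumes f: "integrable M (\<lambda>x. (f x)\<^sup>2)" and g: "integrable M (\<lambda>x. (g x)\<^sup>2)" and fg: "integrable M (\<lambda>x. f x * g x)"
  shows "(\<integral>x. f x * g x \<partial>M)\<^sup>2 \<le> (\<integral>x. (f x)\<^sup>2 \<partial>M) * (\<integral>x. (g x)\<^sup>2 \<partial>M)"
proof -
  define F where "F = (\<integral>x. (f x)\<^sup>2 \<partial>M)"
  define G where "G = (\<integral>x. (g x)\<^sup>2 \<partial>M)"
  define S where "S = (\<integral>x. f x * g x \<partial>M)"
  have nonneg: "0 \<le> F" "0 \<le> G" by (simp_all add: F_def G_def)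
  have quad: "0 \<le> F - 2 * t * S + t\<^sup>2 * G" for t
  proof -
    have "0 \<le> (\<integral>x. (f x - t * g x)\<^sup>2 \<partial>M)" by simp
    also have "\<dots> = (\<integral>x. (f x)\<^sup>2 - 2 * t * (f x * g x) + t\<^sup>2 * (g x)\<^sup>2 \<partial>M)"
      by (simp add: power2_eq_square algebra_simps)
    also have "\<dots> = F - 2 * t * S + t\<^sup>2 * G"
      using f g fg by (simp add: F_def G_def S_def)
    finally show ?thesis .
  qed
  have "S\<^sup>2 \<le> F * G"
  proof (cases "G = 0")
    case True
    have "S = 0"
    proof (rule ccontr)
      assume "S \<noteq> 0"
      \<comment> \<open>With G = 0 the quadratic is affine in t, and this t gives it the value - F -
        2.\<close>
      then show False using quad[of "(F + 1) / S"] nonneg True by simp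
    qed
    then show ?thesis using nonneg by simp
  next
    case False
    then have "0 < G" using nonneg by simp
    then have "0 \<le> F - S\<^sup>2 / G"
      using quad[of "S / G"] by (simp add: power2_eq_square)
    then show ?thesis using \<open>0 < G\<close> by (simp add: pos_divide_le_eq)
  qed
  then show ?thesis by (simp add: F_def G_def S_def)
qed

section \<open>Likelihood ratios of product measures\<close>

lemma PiM_density:
  fixes P Q :: "'i \<Rightarrow> 'b measure" and L :: "'i \<Rightarrow> 'b \<Rightarrow> ennreal"
  assumes I: "finite I" and P: "\<And>i. prob_space (P i)" and Q: "\<And>i. prob_space (Q i)"
    and L [measurable]: "\<And>i. L i \<in> borel_measurable (P i)" and dens: "\<And>i. Q i = density (P i) (L i)"
  shows "Pi\<^sub>M I Q = density (Pi\<^sub>M I P) (\<lambda>y. \<Prod>i\<in>I. L i (y i))"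
proof (rule product_sigma_finite.PiM_eqI[symmetric, OF _ I])
  interpret P: product_sigma_finite P
    using P by (simp add: product_sigma_finite_def prob_space_imp_sigma_finite)
  show "product_sigma_finite Q"
    using Q by (simp add: product_sigma_finite_def prob_space_imp_sigma_finite)
  have sets: "sets (Q i) = sets (P i)" for i by (simp add: dens)
  show "sets (density (Pi\<^sub>M I P) (\<lambda>y. \<Prod>i\<in>I. L i (y i))) = sets (Pi\<^sub>M I Q)"
    by (auto simp: sets intro!: sets_PiM_cong)
  fix A assume "\<And>i. i \<in> I \<Longrightarrow> A i \<in> sets (Q i)"
  then have A: "A i \<in> sets (P i)" if "i \<in> I" for i using that by (simp add: sets)
  then have meas: "Pi\<^sub>E I A \<in> sets (Pi\<^sub>M I P)"
    using I by (intro sets_PiM_I_finite)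
  have "emeasure (density (Pi\<^sub>M I P) (\<lambda>y. \<Prod>i\<in>I. L i (y i))) (Pi\<^sub>E I A)
      = (\<integral>\<^sup>+y. (\<Prod>i\<in>I. L i (y i)) * indicator (Pi\<^sub>E I A) y \<partial>Pi\<^sub>M I P)"
    using meas by (subst emeasure_density) auto
  also have "\<dots> = (\<integral>\<^sup>+y. (\<Prod>i\<in>I. L i (y i) * indicator (A i) (y i)) \<partial>Pi\<^sub>M I P)"
  proof (rule nn_integral_cong)
    fix y assume "y \<in> space (Pi\<^sub>M I P)"
    then have "indicator (Pi\<^sub>E I A) y = (\<Prod>i\<in>I. indicator (A i) (y i) :: ennreal)"
      using I by (auto simp: indicator_def space_PiM PiE_iff prod_zero_iff split: if_splits)
    then show "(\<Prod>i\<in>I. L i (y i)) * indicator (Pi\<^sub>E I A) y = (\<Prod>i\<in>I. L i (y i) * indicator (A i) (y i))"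
      by (simp add: prod.distrib)
  qed
  also have "\<dots> = (\<Prod>i\<in>I. \<integral>\<^sup>+x. L i x * indicator (A i) x \<partial>P i)"
    using A by (intro P.product_nn_integral_prod I) auto
  also have "\<dots> = (\<Prod>i\<in>I. emeasure (Q i) (A i))"
    using A by (intro prod.cong refl) (auto simp: dens emeasure_density)
  finally show "emeasure (density (Pi\<^sub>M I P) (\<lambda>y. \<Prod>i\<in>I. L i (y i))) (Pi\<^sub>E I A) = (\<Prod>i\<in>I. emeasure (Q i) (A i))" .
qed

text \<open>The difference of the means is the P-integral of g (\<Lambda> - 1), with \<Lambda> the
  likelihood ratio. Independence makes the second moment of \<Lambda> the product of the C i, and E
  \<Lambda> = 1 turns this into the integral of (\<Lambda> - 1)^2.\<close>

lemma product_chi_square_bound: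
  fixes P Q :: "'i \<Rightarrow> 'b measure" and L :: "'i \<Rightarrow> 'b \<Rightarrow> real"
  assumes I: "finite I" and P: "\<And>i. prob_space (P i)" and Q: "\<And>i. prob_space (Q i)"
    and L [measurable]: "\<And>i. L i \<in> borel_measurable (P i)" and L0: "\<And>i x. 0 \<le> L i x" and dens: "\<And>i. Q i = density (P i) (L i)"
    and C: "\<And>i. (\<integral>\<^sup>+x. ennreal ((L i x)\<^sup>2) \<partial>P i) = ennreal (C i)" "\<And>i. 0 \<le> C i"
    and g [measurable]: "g \<in> borel_measurable (Pi\<^sub>M I P)" and g1: "\<And>y. \<bar>g y\<bar> \<le> (1 :: real)"
  shows "((\<integral>y. g y \<partial>Pi\<^sub>M I Q) - (\<integral>y. g y \<partial>Pi\<^sub>M I P))\<^sup>2 \<le> (\<integral>y. (g y)\<^sup>2 \<partial>Pi\<^sub>M I P) * ((\<Prod>i\<in>I. C i) - 1)"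
proof -
  interpret PP: prob_space "Pi\<^sub>M I P" by (rule prob_space_PiM) (rule P)
  interpret P: product_sigma_finite P
    using P by (simp add: product_sigma_finite_def prob_space_imp_sigma_finite)
  interpret QQ: prob_space "Pi\<^sub>M I Q" by (rule prob_space_PiM) (rule Q)
  define \<Lambda> where "\<Lambda> y = (\<Prod>i\<in>I. L i (y i))" for y
  have [measurable]: "\<Lambda> \<in> borel_measurable (Pi\<^sub>M I P)" unfolding \<Lambda>_def[abs_def] by measurable
  have \<Lambda>0: "0 \<le> \<Lambda> y" for y by (simp add: \<Lambda>_def prod_nonneg L0)
  have QP: "Pi\<^sub>M I Q = density (Pi\<^sub>M I P) \<Lambda>"
    using PiM_density[OF I P Q _ dens] L by (simp add: \<Lambda>_def[abs_def] prod_ennreal L0)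
  have "(\<integral>\<^sup>+y. ennreal (\<Lambda> y) \<partial>Pi\<^sub>M I P) = emeasure (density (Pi\<^sub>M I P) \<Lambda>) (space (Pi\<^sub>M I P))"
    by (auto simp: emeasure_density intro!: nn_integral_cong)
  also have "\<dots> = 1"
    using QQ.emeasure_space_1 by (simp add: QP)
  finally have nn\<Lambda>: "(\<integral>\<^sup>+y. ennreal (\<Lambda> y) \<partial>Pi\<^sub>M I P) = 1" .
  have int\<Lambda>: "integrable (Pi\<^sub>M I P) \<Lambda>"
    by (rule integrableI_nonneg) (auto simp: \<Lambda>0 nn\<Lambda>)
  have E\<Lambda>: "(\<integral>y. \<Lambda> y \<partial>Pi\<^sub>M I P) = 1"
    using nn\<Lambda> by (subst integral_eq_nn_integral) (auto simp: \<Lambda>0)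
  have "(\<integral>\<^sup>+y. ennreal ((\<Lambda> y)\<^sup>2) \<partial>Pi\<^sub>M I P) = (\<integral>\<^sup>+y. (\<Prod>i\<in>I. ennreal ((L i (y i))\<^sup>2)) \<partial>Pi\<^sub>M I P)"
    by (simp add: \<Lambda>_def prod_power_distrib prod_ennreal)
  also have "\<dots> = (\<Prod>i\<in>I. \<integral>\<^sup>+x. ennreal ((L i x)\<^sup>2) \<partial>P i)"
    by (intro P.product_nn_integral_prod I) auto
  also have "\<dots> \<le> (\<Prod>i\<in>I. ennreal (C i))"
    by (simp add: C)
  also have "\<dots> = ennreal (\<Prod>i\<in>I. C i)"
    by (intro prod_ennreal C)
  finally have nn\<Lambda>2: "(\<integral>\<^sup>+y. ennreal ((\<Lambda> y)\<^sup>2) \<partial>Pi\<^sub>M I P) \<le> ennreal (\<Prod>i\<in>I. C i)" .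
  have int\<Lambda>2: "integrable (Pi\<^sub>M I P) (\<lambda>y. (\<Lambda> y)\<^sup>2)"
    using le_less_trans[OF nn\<Lambda>2, of \<infinity>] by (intro integrableI_nonneg) auto
  have E\<Lambda>2: "(\<integral>y. (\<Lambda> y)\<^sup>2 \<partial>Pi\<^sub>M I P) \<le> (\<Prod>i\<in>I. C i)"
  proof -
    have "ennreal (\<integral>y. (\<Lambda> y)\<^sup>2 \<partial>Pi\<^sub>M I P) \<le> ennreal (\<Prod>i\<in>I. C i)"
      using nn\<Lambda>2 int\<Lambda>2 by (simp add: nn_integral_eq_integral)
    then show ?thesis by (simp add: prod_nonneg C)
  qed
  have int_g: "integrable (Pi\<^sub>M I P) g" "integrable (Pi\<^sub>M I P) (\<lambda>y. (g y)\<^sup>2)"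
    using g1 by (auto intro!: PP.integrable_const_bound[where B=1] simp: abs_square_le_1 power_abs[symmetric])
  have int_g\<Lambda>: "integrable (Pi\<^sub>M I P) (\<lambda>y. g y * \<Lambda> y)"
    using int\<Lambda> g1 \<Lambda>0 by (rule_tac Bochner_Integration.integrable_bound[OF int\<Lambda>]) (auto simp: abs_mult intro!: mult_left_le_one_le)
  have "(\<integral>y. g y \<partial>Pi\<^sub>M I Q) = (\<integral>y. g y * \<Lambda> y \<partial>Pi\<^sub>M I P)"
    unfolding QP by (subst integral_density) (auto simp: \<Lambda>0 mult.commute)
  then have diff: "(\<integral>y. g y \<partial>Pi\<^sub>M I Q) - (\<integral>y. g y \<partial>Pi\<^sub>M I P) = (\<integral>y. g y * (\<Lambda> y - 1) \<partial>Pi\<^sub>M I P)"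
    using int_g int_g\<Lambda> by (simp add: right_diff_distrib)
  have sq: "(\<lambda>y. (\<Lambda> y - 1)\<^sup>2) = (\<lambda>y. (\<Lambda> y)\<^sup>2 - 2 * \<Lambda> y + 1)"
    by (auto simp: power2_eq_square algebra_simps)
  have "((\<integral>y. g y \<partial>Pi\<^sub>M I Q) - (\<integral>y. g y \<partial>Pi\<^sub>M I P))\<^sup>2 \<le> (\<integral>y. (g y)\<^sup>2 \<partial>Pi\<^sub>M I P) * (\<integral>y. (\<Lambda> y - 1)\<^sup>2 \<partial>Pi\<^sub>M I P)"
    unfolding diff using int_g int_g\<Lambda> int\<Lambda> int\<Lambda>2
    by (intro integral_mult_square_le) (auto simp: sq right_diff_distrib)
  also have "(\<integral>y. (\<Lambda> y - 1)\<^sup>2 \<partial>Pi\<^sub>M I P) = (\<integral>y. (\<Lambda> y)\<^sup>2 \<partial>Pi\<^sub>M I P) - 1"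
    unfolding sq using int\<Lambda> int\<Lambda>2 E\<Lambda> by (simp add: PP.prob_space)
  also have "(\<integral>y. (g y)\<^sup>2 \<partial>Pi\<^sub>M I P) * ((\<integral>y. (\<Lambda> y)\<^sup>2 \<partial>Pi\<^sub>M I P) - 1) \<le> (\<integral>y. (g y)\<^sup>2 \<partial>Pi\<^sub>M I P) * ((\<Prod>i\<in>I. C i) - 1)"
    using E\<Lambda>2 by (intro mult_left_mono) auto
  finally show ?thesis .
qed

section \<open>Second moments of Gaussian likelihood ratios\<close>

definition pair_density :: "real \<Rightarrow> real \<Rightarrow> real \<Rightarrow> real \<times> real \<Rightarrow> real" where
  "pair_density a b r = (\<lambda>(d, y). normal_density 0 (sqrt a) d * normal_density (r * d) (sqrt b) y)"

lemma pair_law_density: "pair_law a b r = density lborel (pair_density a b r)"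
  by (simp add: pair_law_def pair_density_def case_prod_beta')

lemma measurable_pair_density [measurable]: "pair_density a b r \<in> borel_measurable borel"
  unfolding pair_density_def borel_prod[symmetric] normal_density_def by measurable

lemma pair_density_pos: "0 < a \<Longrightarrow> 0 < b \<Longrightarrow> 0 < pair_density a b r x"
  by (auto simp: pair_density_def normal_density_pos split: prod.split)

lemma prob_space_pair_law:
  assumes "0 < a" "0 < b"
  shows "prob_space (pair_law a b r)"
proof -
  let ?Na = "density lborel (normal_density 0 (sqrt a))" and ?Nb = "density lborel (normal_density 0 (sqrt b))"
  interpret A: prob_space ?Na using assms by (intro prob_space_normal_density) simp
  interpret B: prob_space ?Nb using assms by (intro prob_space_normal_density) simp
  interpret pair_prob_space ?Na ?Nb ..
  have "(\<lambda>(d, e). (d, e + r * d)) \<in> borel_measurable (?Na \<Otimes>\<^sub>M ?Nb)"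
    unfolding borel_prod[symmetric] by simp
  then show ?thesis
    unfolding distr_shear_normal[OF assms, symmetric] by (intro prob_space_distr) simp
qed

text \<open>Since m2 is the midpoint of m1 and 2 m2 - m1, the parallelogram identity rewrites 2 (y -
  m2)^2. Up to a constant, the squared density divided by the density at m1 is therefore again a
  normal density.\<close>

lemma normal_density_square:
  assumes "0 < b"
  shows "(normal_density m2 (sqrt b) y)\<^sup>2
    = exp ((m2 - m1)\<^sup>2 / b) * normal_density (2 * m2 - m1) (sqrt b) y * normal_density m1 (sqrt b) y"
proof -
  have "- (y - m2)\<^sup>2 / (2 * b) + - (y - m2)\<^sup>2 / (2 * b)
      = (m2 - m1)\<^sup>2 / b + (- (y - (2 * m2 - m1))\<^sup>2 / (2 * b) + - (y - m1)\<^sup>2 / (2 * b))"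
    using assms by (simp add: field_simps power2_eq_square)
  then have "exp (- (y - m2)\<^sup>2 / (2 * b)) * exp (- (y - m2)\<^sup>2 / (2 * b))
      = exp ((m2 - m1)\<^sup>2 / b) * (exp (- (y - (2 * m2 - m1))\<^sup>2 / (2 * b)) * exp (- (y - m1)\<^sup>2 / (2 * b)))"
    by (simp only: exp_add[symmetric])
  then show ?thesis
    using assms by (simp add: normal_density_def power2_eq_square[of "_ * exp _"] power2_eq_square[of "exp _ / _"] mult_ac)
qed

text \<open>Precisions combine linearly: the left side divided by the density of variance a1 is
  Gaussian with precision 2/a2 - 1/a1 - 2 c, which equals (1 - x) a1 / a2^2. So x < 1 says exactly
  that the quotient is integrable.\<close>

lemma normal_density_square_tilt:
  fixes a1 a2 c :: real
  assumes "0 < a1" "0 < a2" and x: "(1 - a2 / a1)\<^sup>2 + 2 * c * a2\<^sup>2 / a1 < 1"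
  defines "x \<equiv> (1 - a2 / a1)\<^sup>2 + 2 * c * a2\<^sup>2 / a1"
  defines "v \<equiv> a2\<^sup>2 / a1 / (1 - x)"
  shows "(normal_density 0 (sqrt a2) d)\<^sup>2 * exp (c * d\<^sup>2)
    = 1 / sqrt (1 - x) * normal_density 0 (sqrt v) d * normal_density 0 (sqrt a1) d"
proof -
  have x1: "0 < 1 - x" using x by (simp add: x_def)
  have v: "0 < v" using assms(1,2) x1 by (simp add: v_def)
  have "1 / v = (1 - x) * a1 / a2\<^sup>2" by (simp add: v_def)
  also have "\<dots> = 2 / a2 - 1 / a1 - 2 * c"
    using assms(1,2) by (simp add: x_def field_simps power2_eq_square)
  finally have inv: "1 / v = 2 / a2 - 1 / a1 - 2 * c" .
  have "- (d\<^sup>2) / (2 * v) = - (d\<^sup>2) / 2 * (1 / v)" by simp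
  also have "\<dots> = - (d\<^sup>2) / (2 * a2) + - (d\<^sup>2) / (2 * a2) + c * d\<^sup>2 - (- (d\<^sup>2) / (2 * a1))"
    unfolding inv by (simp add: algebra_simps)
  finally have "exp (- (d\<^sup>2) / (2 * v) + - (d\<^sup>2) / (2 * a1)) = exp (- (d\<^sup>2) / (2 * a2) + - (d\<^sup>2) / (2 * a2) + c * d\<^sup>2)"
    by simp
  then have e: "exp (- (d\<^sup>2) / (2 * v)) * exp (- (d\<^sup>2) / (2 * a1)) = exp (- (d\<^sup>2) / (2 * a2)) * exp (- (d\<^sup>2) / (2 * a2)) * exp (c * d\<^sup>2)"
    by (simp only: exp_add)
  have "sqrt (1 - x) * sqrt v * sqrt a1 = sqrt ((1 - x) * v * a1)" by (simp add: real_sqrt_mult)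
  also have "(1 - x) * v * a1 = a2\<^sup>2" using x1 assms(1) by (simp add: v_def)
  finally have s: "sqrt (1 - x) * sqrt v * sqrt a1 = a2" using assms(2) by simp
  have nd: "normal_density 0 (sqrt w) d = 1 / (sqrt (2 * pi) * sqrt w) * exp (- (d\<^sup>2) / (2 * w))" if "0 < w" for w
    using that by (simp add: normal_density_def real_sqrt_mult)
  have "(normal_density 0 (sqrt a2) d)\<^sup>2 * exp (c * d\<^sup>2)
      = 1 / (sqrt (2 * pi) * sqrt a2)\<^sup>2 * (exp (- (d\<^sup>2) / (2 * a2)) * exp (- (d\<^sup>2) / (2 * a2)) * exp (c * d\<^sup>2))"
    unfolding nd[OF assms(2)] by (simp add: power2_eq_square)
  also have "1 / (sqrt (2 * pi) * sqrt a2)\<^sup>2 = 1 / sqrt (1 - x) * (1 / (sqrt (2 * pi) * sqrt v)) * (1 / (sqrt (2 * pi) * sqrt a1))"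
  proof -
    have "sqrt (1 - x) * (sqrt (2 * pi) * sqrt v) * (sqrt (2 * pi) * sqrt a1) = (sqrt (2 * pi))\<^sup>2 * (sqrt (1 - x) * sqrt v * sqrt a1)"
      by (simp add: power2_eq_square)
    also have "\<dots> = (sqrt (2 * pi) * sqrt a2)\<^sup>2"
      unfolding s using assms(2) by (simp add: power_mult_distrib)
    finally show ?thesis by simp
  qed
  finally show ?thesis
    unfolding nd[OF v] nd[OF assms(1)] e[symmetric] by (simp add: mult_ac)
qed

text \<open>Conditionally on d the two laws of y differ by the mean shift (r2 - r1) d, which
  contributes exp (c d^2) with c = (r2 - r1)^2 / b. The integral over d that remains is the tilted
  Gaussian one, of mass 1 / sqrt (1 - x).\<close>

lemma pair_law_chi_square:
  fixes a1 a2 b r1 r2 :: real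
  assumes pos: "0 < a1" "0 < a2" "0 < b"
  defines "x \<equiv> (1 - a2 / a1)\<^sup>2 + 2 * (r2 - r1)\<^sup>2 * a2\<^sup>2 / (a1 * b)"
  assumes x: "x < 1"
  defines "L \<equiv> \<lambda>z. pair_density a2 b r2 z / pair_density a1 b r1 z"
  shows "pair_law a2 b r2 = density (pair_law a1 b r1) L"
    and "(\<integral>\<^sup>+z. ennreal ((L z)\<^sup>2) \<partial>pair_law a1 b r1) = ennreal (1 / sqrt (1 - x))"
proof -
  have [measurable]: "L \<in> borel_measurable borel" unfolding L_def by measurable
  have L0: "0 \<le> L z" for z
    using pair_density_pos pos unfolding L_def by (intro divide_nonneg_nonneg less_imp_le) auto
  have p1: "0 < pair_density a1 b r1 z" "0 \<le> pair_density a1 b r1 z" for z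
    using pair_density_pos[OF pos(1,3), of r1 z] by auto
  show "pair_law a2 b r2 = density (pair_law a1 b r1) L"
    unfolding pair_law_density
    by (subst density_density_eq) (auto intro!: density_cong simp: L_def ennreal_mult'[symmetric] p1 less_imp_le less_imp_neq[OF p1(1), symmetric])
  define c where "c = (r2 - r1)\<^sup>2 / b"
  have x': "x = (1 - a2 / a1)\<^sup>2 + 2 * c * a2\<^sup>2 / a1"
    using pos by (simp add: x_def c_def)
  define v where "v = a2\<^sup>2 / a1 / (1 - x)"
  have v: "0 < v" using pos x by (simp add: v_def)
  have key: "(L z)\<^sup>2 * pair_density a1 b r1 z = 1 / sqrt (1 - x) * pair_density v b (2 * r2 - r1) z" for z
  proof -
    obtain d y where z: "z = (d, y)" by fastforce
    have "(pair_density a2 b r2 z)\<^sup>2 = ((normal_density 0 (sqrt a2) d)\<^sup>2 * exp (c * d\<^sup>2))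
        * (normal_density ((2 * r2 - r1) * d) (sqrt b) y * normal_density (r1 * d) (sqrt b) y)"
    proof -
      have "(r2 * d - r1 * d)\<^sup>2 / b = c * d\<^sup>2" "2 * (r2 * d) - r1 * d = (2 * r2 - r1) * d"
        by (simp_all add: c_def power_mult_distrib flip: left_diff_distrib) (simp add: algebra_simps)
      then show ?thesis
        unfolding pair_density_def z prod.case power_mult_distrib
        using normal_density_square[OF pos(3), of "r2 * d" y "r1 * d"] by (simp add: mult_ac)
    qed
    also have "(normal_density 0 (sqrt a2) d)\<^sup>2 * exp (c * d\<^sup>2)
        = 1 / sqrt (1 - x) * normal_density 0 (sqrt v) d * normal_density 0 (sqrt a1) d"
      unfolding v_def x' by (rule normal_density_square_tilt[OF pos(1,2)]) (use x in \<open>simp add: x'\<close>)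
    finally have "(pair_density a2 b r2 z)\<^sup>2 = 1 / sqrt (1 - x) * pair_density v b (2 * r2 - r1) z * pair_density a1 b r1 z"
      by (simp add: pair_density_def z mult_ac)
    then show ?thesis
      using p1(1)[of z] by (simp add: L_def power2_eq_square)
  qed
  have "(\<integral>\<^sup>+z. ennreal ((L z)\<^sup>2) \<partial>pair_law a1 b r1) = (\<integral>\<^sup>+z. ennreal (pair_density a1 b r1 z) * ennreal ((L z)\<^sup>2) \<partial>lborel)"
    unfolding pair_law_density by (subst nn_integral_density) auto
  also have "\<dots> = (\<integral>\<^sup>+z. ennreal (1 / sqrt (1 - x)) * ennreal (pair_density v b (2 * r2 - r1) z) \<partial>lborel)"
  proof (rule nn_integral_cong)
    fix z
    have "ennreal (pair_density a1 b r1 z) * ennreal ((L z)\<^sup>2) = ennreal ((L z)\<^sup>2 * pair_density a1 b r1 z)"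
      using p1 by (simp add: ennreal_mult mult.commute)
    also have "\<dots> = ennreal (1 / sqrt (1 - x)) * ennreal (pair_density v b (2 * r2 - r1) z)"
      unfolding key using x pair_density_pos[OF v pos(3), of "2 * r2 - r1" z] by (intro ennreal_mult) auto
    finally show "ennreal (pair_density a1 b r1 z) * ennreal ((L z)\<^sup>2) = ennreal (1 / sqrt (1 - x)) * ennreal (pair_density v b (2 * r2 - r1) z)" .
  qed
  also have "\<dots> = ennreal (1 / sqrt (1 - x)) * (\<integral>\<^sup>+z. ennreal (pair_density v b (2 * r2 - r1) z) \<partial>lborel)"
    by (rule nn_integral_cmult) measurable
  also have "(\<integral>\<^sup>+z. ennreal (pair_density v b (2 * r2 - r1) z) \<partial>lborel) = emeasure (pair_law v b (2 * r2 - r1)) UNIV"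
    unfolding pair_law_density by (simp add: emeasure_density)
  also have "\<dots> = 1"
    using prob_space.emeasure_space_1[OF prob_space_pair_law[OF v pos(3), of "2 * r2 - r1"]] by (simp add: pair_law_def)
  finally show "(\<integral>\<^sup>+z. ennreal ((L z)\<^sup>2) \<partial>pair_law a1 b r1) = ennreal (1 / sqrt (1 - x))" by simp
qed

section \<open>First-order expansions\<close>

text \<open>\<open>c\<close> is the logarithmic derivative at e = 0, uniformly in s with a quadratic
  remainder. With the normalisation to 1 the coefficients of products add up, so cancelling
  first-order terms amounts to adding coefficients.\<close>

definition first_order :: "real \<Rightarrow> (real \<Rightarrow> real \<Rightarrow> real) \<Rightarrow> (real \<Rightarrow> real) \<Rightarrow> bool" where
  "first_order T F c \<longleftrightarrow> (\<exists>K e0. 0 < e0 \<and> (\<forall>s\<in>{0..T}. \<bar>c s\<bar> \<le> K)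
    \<and> (\<forall>e s. 0 < e \<and> e \<le> e0 \<and> s \<in> {0..T} \<longrightarrow> \<bar>F e s - 1 - c s * e\<bar> \<le> K * e\<^sup>2))"

lemma first_orderI:
  assumes "0 < e0" "\<And>s. s \<in> {0..T} \<Longrightarrow> \<bar>c s\<bar> \<le> K1"
    "\<And>e s. 0 < e \<Longrightarrow> e \<le> e0 \<Longrightarrow> s \<in> {0..T} \<Longrightarrow> \<bar>F e s - 1 - c s * e\<bar> \<le> K2 * e\<^sup>2"
  shows "first_order T F c"
  unfolding first_order_def
proof (rule exI[of _ "max K1 K2"], rule exI[of _ e0], intro conjI allI impI ballI)
  fix e s assume "0 < e \<and> e \<le> e0 \<and> s \<in> {0..T}"
  then have "\<bar>F e s - 1 - c s * e\<bar> \<le> K2 * e\<^sup>2" using assms by auto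
  also have "\<dots> \<le> max K1 K2 * e\<^sup>2" by (intro mult_right_mono) auto
  finally show "\<bar>F e s - 1 - c s * e\<bar> \<le> max K1 K2 * e\<^sup>2" .
next
  fix s assume "s \<in> {0..T}"
  then show "\<bar>c s\<bar> \<le> max K1 K2" using assms(2)[of s] by simp
qed (rule assms)

lemma first_orderE:
  assumes "first_order T F c"
  obtains K e0 where "0 < e0" "\<And>s. s \<in> {0..T} \<Longrightarrow> \<bar>c s\<bar> \<le> K"
    "\<And>e s. 0 < e \<Longrightarrow> e \<le> e0 \<Longrightarrow> s \<in> {0..T} \<Longrightarrow> \<bar>F e s - 1 - c s * e\<bar> \<le> K * e\<^sup>2"
  using assms unfolding first_order_def by blast

lemma first_order_mult:
  assumes F: "first_order T F c" and G: "first_order T G d"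
  shows "first_order T (\<lambda>e s. F e s * G e s) (\<lambda>s. c s + d s)"
proof -
  obtain K e0 where K: "0 < e0" "\<And>s. s \<in> {0..T} \<Longrightarrow> \<bar>c s\<bar> \<le> K"
    "\<And>e s. 0 < e \<Longrightarrow> e \<le> e0 \<Longrightarrow> s \<in> {0..T} \<Longrightarrow> \<bar>F e s - 1 - c s * e\<bar> \<le> K * e\<^sup>2"
    using F by (rule first_orderE) blast
  obtain L e1 where L: "0 < e1" "\<And>s. s \<in> {0..T} \<Longrightarrow> \<bar>d s\<bar> \<le> L"
    "\<And>e s. 0 < e \<Longrightarrow> e \<le> e1 \<Longrightarrow> s \<in> {0..T} \<Longrightarrow> \<bar>G e s - 1 - d s * e\<bar> \<le> L * e\<^sup>2"
    using G by (rule first_orderE) blast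
  show ?thesis
  proof (rule first_orderI[where ?e0.0="min 1 (min e0 e1)" and ?K1.0="K + L" and ?K2.0="K * L + K * (1 + L + L) + L * (1 + K)"])
    fix e s :: real assume e: "0 < e" "e \<le> min 1 (min e0 e1)" and s: "s \<in> {0..T}"
    define A where "A = F e s - 1 - c s * e"
    define B where "B = G e s - 1 - d s * e"
    have A: "\<bar>A\<bar> \<le> K * e\<^sup>2" and B: "\<bar>B\<bar> \<le> L * e\<^sup>2" and c: "\<bar>c s\<bar> \<le> K" and d: "\<bar>d s\<bar> \<le> L"
      using K L e s unfolding A_def B_def by auto
    have nn: "0 \<le> K" "0 \<le> L" using c d by linarith+
    have e2: "e\<^sup>2 \<le> 1" using e by (simp add: power_le_one)
    have "\<bar>c s * d s * e\<^sup>2\<bar> \<le> K * L * e\<^sup>2"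
      unfolding abs_mult using c d nn by (intro mult_mono) auto
    moreover have "\<bar>A * (1 + d s * e + B)\<bar> \<le> K * e\<^sup>2 * (1 + L + L)"
    proof -
      have "\<bar>d s * e\<bar> \<le> L * 1" unfolding abs_mult using d e nn by (intro mult_mono) auto
      moreover have "\<bar>B\<bar> \<le> L * 1" using B mult_left_mono[OF e2 nn(2)] by simp
      ultimately have "\<bar>1 + d s * e + B\<bar> \<le> 1 + L + L" by linarith
      then show ?thesis unfolding abs_mult using A nn by (intro mult_mono) auto
    qed
    moreover have "\<bar>B * (1 + c s * e)\<bar> \<le> L * e\<^sup>2 * (1 + K)"
    proof -
      have "\<bar>c s * e\<bar> \<le> K * 1" unfolding abs_mult using c e nn by (intro mult_mono) auto
      then have "\<bar>1 + c s * e\<bar> \<le> 1 + K" by linarith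
      then show ?thesis unfolding abs_mult using B nn by (intro mult_mono) auto
    qed
    \<comment> \<open>Expansion of the product of 1 + c e + A and 1 + d e + B; every summand has
      order e^2.\<close>
    moreover have "F e s * G e s - 1 - (c s + d s) * e = c s * d s * e\<^sup>2 + A * (1 + d s * e + B) + B * (1 + c s * e)"
      by (simp add: A_def B_def power2_eq_square algebra_simps)
    ultimately show "\<bar>F e s * G e s - 1 - (c s + d s) * e\<bar> \<le> (K * L + K * (1 + L + L) + L * (1 + K)) * e\<^sup>2"
      by (simp add: algebra_simps)
  next
    fix s assume "s \<in> {0..T}"
    then show "\<bar>c s + d s\<bar> \<le> K + L" using K(2)[of s] L(2)[of s] by linarith
  qed (use K(1) L(1) in simp)
qed

text \<open>For negative x, exp (- x) \<ge> 1 - x gives exp x \<le> 1 / (1 - x), and (1 + x + x^2)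
  (1 - x) = 1 - x^3 is at least 1.\<close>

lemma abs_exp_minus_one_minus_le:
  fixes x :: real
  assumes "\<bar>x\<bar> \<le> 1"
  shows "\<bar>exp x - 1 - x\<bar> \<le> x\<^sup>2"
proof (cases "0 \<le> x")
  case True
  then show ?thesis
    using exp_bound[of x] assms exp_ge_add_one_self[of x] zero_le_power2[of x] by linarith
next
  case False
  have "0 \<le> exp x - 1 - x" using exp_ge_add_one_self[of x] by linarith
  moreover have "exp x \<le> 1 + x + x\<^sup>2"
  proof -
    have "exp x * (1 - x) \<le> exp x * exp (- x)"
      using exp_ge_add_one_self[of "- x"] by (intro mult_left_mono) auto
    then have "exp x \<le> 1 / (1 - x)"
      using False by (simp add: exp_minus pos_le_divide_eq)
    also have "1 / (1 - x) \<le> 1 + x + x\<^sup>2"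
    proof -
      have "(1 + x + x\<^sup>2) * (1 - x) = 1 + (- x) * x\<^sup>2" by (simp add: power2_eq_square algebra_simps)
      also have "\<dots> \<ge> 1" using mult_nonneg_nonneg[of "- x" "x\<^sup>2"] False by simp
      finally show ?thesis using False by (simp add: divide_le_eq)
    qed
    finally show ?thesis .
  qed
  ultimately show ?thesis by simp
qed

lemma first_order_exp:
  assumes "\<And>s. s \<in> {0..T} \<Longrightarrow> \<bar>c s\<bar> \<le> K"
  shows "first_order T (\<lambda>e s. exp (c s * e)) c"
proof (cases "0 \<le> T")
  case True
  then have K: "0 \<le> K" using assms[of 0] by auto
  show ?thesis
  proof (rule first_orderI[where ?e0.0="1 / (K + 1)" and ?K1.0=K and ?K2.0="K\<^sup>2"])
    fix e s :: real assume e: "0 < e" "e \<le> 1 / (K + 1)" and s: "s \<in> {0..T}"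
    have c: "\<bar>c s\<bar> \<le> K" using assms s by auto
    have "\<bar>c s * e\<bar> \<le> K * (1 / (K + 1))"
      unfolding abs_mult using c e K by (intro mult_mono) auto
    also have "\<dots> \<le> 1" using K by simp
    finally have "\<bar>exp (c s * e) - 1 - c s * e\<bar> \<le> (c s * e)\<^sup>2"
      by (rule abs_exp_minus_one_minus_le)
    also have "\<dots> \<le> K\<^sup>2 * e\<^sup>2"
      unfolding power_mult_distrib using c K by (intro mult_right_mono) (auto simp: abs_le_square_iff[symmetric])
    finally show "\<bar>exp (c s * e) - 1 - c s * e\<bar> \<le> K\<^sup>2 * e\<^sup>2" .
  qed (use K assms in auto)
qed (rule first_orderI[of 1 _ _ 0 _ 0], auto)

text \<open>The weights may have opposite signs, and p + q = 1 preserves the normalisation. It is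
  meant for \<open>price_scale\<close>, a difference of two exponentials.\<close>

lemma first_order_affine:
  assumes F: "first_order T F c" and G: "first_order T G d" and "p + q = 1"
  shows "first_order T (\<lambda>e s. p * F e s + q * G e s) (\<lambda>s. p * c s + q * d s)"
proof -
  obtain K e0 where K: "0 < e0" "\<And>s. s \<in> {0..T} \<Longrightarrow> \<bar>c s\<bar> \<le> K"
    "\<And>e s. 0 < e \<Longrightarrow> e \<le> e0 \<Longrightarrow> s \<in> {0..T} \<Longrightarrow> \<bar>F e s - 1 - c s * e\<bar> \<le> K * e\<^sup>2"
    using F by (rule first_orderE) blast
  obtain L e1 where L: "0 < e1" "\<And>s. s \<in> {0..T} \<Longrightarrow> \<bar>d s\<bar> \<le> L"
    "\<And>e s. 0 < e \<Longrightarrow> e \<le> e1 \<Longrightarrow> s \<in> {0..T} \<Longrightarrow> \<bar>G e s - 1 - d s * e\<bar> \<le> L * e\<^sup>2"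
    using G by (rule first_orderE) blast
  have tri: "\<bar>p * x + q * y\<bar> \<le> \<bar>p\<bar> * X + \<bar>q\<bar> * Y" if "\<bar>x\<bar> \<le> X" "\<bar>y\<bar> \<le> Y" for x y X Y
    using abs_triangle_ineq[of "p * x" "q * y"] mult_left_mono[OF that(1), of "\<bar>p\<bar>"] mult_left_mono[OF that(2), of "\<bar>q\<bar>"]
    unfolding abs_mult by linarith
  show ?thesis
  proof (rule first_orderI[where ?e0.0="min e0 e1" and ?K1.0="\<bar>p\<bar> * K + \<bar>q\<bar> * L" and ?K2.0="\<bar>p\<bar> * K + \<bar>q\<bar> * L"])
    fix e s :: real assume e: "0 < e" "e \<le> min e0 e1" and s: "s \<in> {0..T}"
    have "p * F e s + q * G e s - 1 - (p * c s + q * d s) * e = p * (F e s - 1 - c s * e) + q * (G e s - 1 - d s * e)"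
    proof -
      have q: "q = 1 - p" using assms(3) by simp
      show ?thesis unfolding q by (simp add: algebra_simps)
    qed
    also have "\<bar>\<dots>\<bar> \<le> \<bar>p\<bar> * (K * e\<^sup>2) + \<bar>q\<bar> * (L * e\<^sup>2)"
      using K(3)[of e s] L(3)[of e s] e s by (intro tri) auto
    finally show "\<bar>p * F e s + q * G e s - 1 - (p * c s + q * d s) * e\<bar> \<le> (\<bar>p\<bar> * K + \<bar>q\<bar> * L) * e\<^sup>2"
      by (simp add: algebra_simps)
  next
    fix s assume "s \<in> {0..T}"
    then show "\<bar>p * c s + q * d s\<bar> \<le> \<bar>p\<bar> * K + \<bar>q\<bar> * L" using K(2) L(2) by (intro tri)
  qed (use K(1) L(1) in simp)
qed

lemma sum_cell_integral:
  assumes "0 < T" "1 \<le> n" "continuous_on {0..T} g"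
  shows "(\<Sum>i\<in>{1..n}. cell_integral T n g i) = integral {0..T} g"
proof -
  have "(\<Sum>i\<in>{1..k}. cell_integral T n g i) = integral {0..real k * (T / real n)} g" if "k \<le> n" for k
    using that
  proof (induction k)
    case (Suc k)
    have "real (Suc k) * T \<le> real n * T"
      using Suc.prems assms by (intro mult_right_mono) auto
    then have le: "real (Suc k) * (T / real n) \<le> T"
      using assms by (simp add: field_simps)
    have "integral {0..real k * (T / real n)} g + integral {real k * (T / real n)..real (Suc k) * (T / real n)} g
        = integral {0..real (Suc k) * (T / real n)} g"
    proof (rule Henstock_Kurzweil_Integration.integral_combine)
      show "0 \<le> real k * (T / real n)" "real k * (T / real n) \<le> real (Suc k) * (T / real n)"
        using assms by (auto intro!: mult_right_mono simp del: times_divide_eq_right)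
      have "continuous_on {0..real (Suc k) * (T / real n)} g"
        by (rule continuous_on_subset[OF assms(3)]) (use le in auto)
      then show "g integrable_on {0..real (Suc k) * (T / real n)}"
        by (rule integrable_continuous_interval)
    qed
    with Suc show ?case by (simp add: cell_integral_def)
  qed (simp add: cell_integral_def)
  from this[of n] show ?thesis using assms by simp
qed

text \<open>Turns a product over cells into the exponential of a sum. The term x / 2 is the exact
  first order; x^2 absorbs the rest and is negligible after summation when x has order 1/n.\<close>

lemma inverse_sqrt_le_exp:
  fixes x :: real
  assumes "0 \<le> x" "x \<le> 1 / 2"
  shows "1 / sqrt (1 - x) \<le> exp (x / 2 + x\<^sup>2)"
proof -
  have "- x - 2 * x\<^sup>2 \<le> ln (1 - x)"
    by (rule ln_one_minus_pos_lower_bound) fact+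
  then have "- ln (1 - x) / 2 \<le> x / 2 + x\<^sup>2" by linarith
  moreover have "1 / sqrt (1 - x) = exp (- ln (1 - x) / 2)"
  proof -
    have "ln (sqrt (1 - x)) = ln (1 - x) / 2" by (rule ln_sqrt) (use assms in simp)
    moreover have "exp (ln (sqrt (1 - x))) = sqrt (1 - x)" by (rule exp_ln) (use assms in simp)
    ultimately show ?thesis by (simp only: minus_divide_left[symmetric] exp_minus inverse_eq_divide)
  qed
  ultimately show ?thesis by simp
qed

section \<open>The least favourable alternative\<close>

lemma has_derivative_regression_slope:
  assumes "0 < \<theta>" "T1 < T2"
  shows "((regression_slope T1 T2) has_real_derivative
    - (T2 - T1) * exp (- \<theta> * (T1 + T2)) / (price_scale T1 T2 \<theta>)\<^sup>2) (at \<theta>)"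
proof -
  have k: "price_scale T1 T2 \<theta> \<noteq> 0"
    using assms by (simp add: price_scale_def)
  have "((\<lambda>\<theta>. exp (- \<theta> * T2) / (exp (- \<theta> * T1) - exp (- \<theta> * T2))) has_real_derivative
      (- T2 * exp (- \<theta> * T2) * price_scale T1 T2 \<theta>
        - exp (- \<theta> * T2) * (- T1 * exp (- \<theta> * T1) + T2 * exp (- \<theta> * T2))) / (price_scale T1 T2 \<theta> * price_scale T1 T2 \<theta>)) (at \<theta>)"
    using k unfolding price_scale_def
    by (auto intro!: derivative_eq_intros simp: algebra_simps)
  moreover have "- T2 * exp (- \<theta> * T2) * price_scale T1 T2 \<theta> - exp (- \<theta> * T2) * (- T1 * exp (- \<theta> * T1) + T2 * exp (- \<theta> * T2))
      = - (T2 - T1) * (exp (- \<theta> * T1) * exp (- \<theta> * T2))"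
    by (simp add: price_scale_def algebra_simps)
  moreover have "exp (- \<theta> * T1) * exp (- \<theta> * T2) = exp (- \<theta> * (T1 + T2))"
    by (simp add: exp_add[symmetric] algebra_simps)
  ultimately show ?thesis
    by (simp add: regression_slope_def[abs_def] price_scale_def[abs_def] power2_eq_square)
qed

text \<open>\<open>S\<close> and \<open>S'\<close> stand for the squared volatilities, in which the
  variances are linear, and \<open>lo\<close>, \<open>hi\<close> for their bounds. Below, e plays
  the role of the rate sqrt (T / n) and h is the direction in \<theta>.\<close>

locale local_alternative =
  fixes T T1 T2 \<theta> h m lo hi :: real and S S' :: "real \<Rightarrow> real"
  assumes T: "0 < T" and \<theta>: "0 < \<theta>" and h: "0 < h" and T12: "T1 < T2" and lo: "0 < lo" and m: "lo \<le> m" "m \<le> hi"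
    and cont: "continuous_on {0..T} S" "continuous_on {0..T} S'"
    and bounds: "\<And>s. s \<in> {0..T} \<Longrightarrow> lo \<le> S s" "\<And>s. s \<in> {0..T} \<Longrightarrow> S s \<le> hi"
      "\<And>s. s \<in> {0..T} \<Longrightarrow> lo \<le> S' s" "\<And>s. s \<in> {0..T} \<Longrightarrow> S' s \<le> hi"
begin

abbreviation "k \<equiv> price_scale T1 T2"
abbreviation "\<rho> \<equiv> regression_slope T1 T2"

text \<open>The logarithmic derivative of \<open>price_scale T1 T2\<close> at \<theta>.\<close>

definition log_slope :: real where
  "log_slope = (T2 * exp (- \<theta> * T2) - T1 * exp (- \<theta> * T1)) / k \<theta>"

text \<open>The perturbation of \<open>\<sigma>\<^sup>2\<close> that makes the variance of \<open>\<Delta>X\<^sup>1 - \<Delta>X\<^sup>2\<close> insensitive, to first order,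
  to the perturbation \<open>h\<close> of \<open>\<theta>\<close>: the least favourable direction.\<close>

definition tilt :: "real \<Rightarrow> real" where
  "tilt s = - h * (2 * log_slope + 2 * s) * S s"

text \<open>The unperturbed sequence moves too: S may touch the bounds or exhaust the Hoelder
  constant, so S + e * tilt may be inadmissible, while convex combinations of S with m, or with m +
  tilt for small h, are admissible. The common pull leaves the difference e * tilt between
  \<open>alt_vol\<close> and \<open>base_vol\<close>.\<close>

definition base_vol :: "real \<Rightarrow> real \<Rightarrow> real" where
  "base_vol e s = S s + e * (m - S s)"

definition alt_vol :: "real \<Rightarrow> real \<Rightarrow> real" where
  "alt_vol e s = S s + e * (m + tilt s - S s)"

definition noise_vol :: "real \<Rightarrow> real \<Rightarrow> real" where
  "noise_vol e s = S' s + e * (m - S' s)"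

definition base_var :: "real \<Rightarrow> real \<Rightarrow> real" where
  "base_var e s = (k \<theta>)\<^sup>2 * exp (2 * \<theta> * s) * base_vol e s"

definition alt_var :: "real \<Rightarrow> real \<Rightarrow> real" where
  "alt_var e s = (k (\<theta> + e * h))\<^sup>2 * exp (2 * (\<theta> + e * h) * s) * alt_vol e s"

text \<open>The variance rate of the regressor over that of the regression noise. Its integral times
  (D h)^2, with D the derivative of the slope, is the exponent of the limiting chi-square
  divergence.\<close>

definition signal :: "real \<Rightarrow> real" where
  "signal s = (k \<theta>)\<^sup>2 * exp (2 * \<theta> * s) * S s / S' s"

lemma k_pos: "0 < k \<theta>"
  using \<theta> T12 by (simp add: price_scale_def)

lemma hi_pos: "0 < hi"
  using lo m by simp

lemma base_vol_bounds:
  assumes "0 \<le> e" "e \<le> 1" "s \<in> {0..T}"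
  shows "lo \<le> base_vol e s" "base_vol e s \<le> hi" "lo \<le> noise_vol e s"
proof -
  have 1: "base_vol e s = (1 - e) * S s + e * m" "noise_vol e s = (1 - e) * S' s + e * m"
    by (simp_all add: base_vol_def noise_vol_def algebra_simps)
  have "(1 - e) * lo + e * lo \<le> base_vol e s" "base_vol e s \<le> (1 - e) * hi + e * hi" "(1 - e) * lo + e * lo \<le> noise_vol e s"
    unfolding 1 using assms bounds m by (auto intro!: add_mono mult_left_mono)
  then show "lo \<le> base_vol e s" "base_vol e s \<le> hi" "lo \<le> noise_vol e s"
    by (simp_all add: algebra_simps)
qed

lemma scale_ratio: "first_order T (\<lambda>e s. k (\<theta> + e * h) / k \<theta>) (\<lambda>s. h * log_slope)"
proof -
  let ?p = "exp (- \<theta> * T1) / k \<theta>" and ?q = "- exp (- \<theta> * T2) / k \<theta>"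
  have pq: "?p + ?q = 1"
  proof -
    have "?p + ?q = k \<theta> / k \<theta>"
      unfolding price_scale_def by (simp only: add_divide_distrib[symmetric] add_uminus_conv_diff)
    then show ?thesis using k_pos by simp
  qed
  have "first_order T (\<lambda>e s. ?p * exp ((- T1 * h) * e) + ?q * exp ((- T2 * h) * e)) (\<lambda>s. ?p * (- T1 * h) + ?q * (- T2 * h))"
    by (intro first_order_affine first_order_exp pq) auto
  moreover have "?p * exp ((- T1 * h) * e) + ?q * exp ((- T2 * h) * e) = k (\<theta> + e * h) / k \<theta>" for e
  proof -
    have "exp (- \<theta> * T1) * exp ((- T1 * h) * e) = exp (- (\<theta> + e * h) * T1)"
      "exp (- \<theta> * T2) * exp ((- T2 * h) * e) = exp (- (\<theta> + e * h) * T2)"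
      by (simp_all add: exp_add[symmetric] algebra_simps)
    then show ?thesis by (simp add: price_scale_def diff_divide_distrib)
  qed
  moreover have "?p * (- T1 * h) + ?q * (- T2 * h) = h * log_slope"
    by (simp add: log_slope_def diff_divide_distrib right_diff_distrib mult_ac)
  ultimately show ?thesis by simp
qed

text \<open>The numerator is \<open>base_vol\<close> plus e c S, with c the claimed coefficient. The
  error is thus c e (S / base_vol - 1), of second order because \<open>base_vol\<close> differs from
  S by O(e).\<close>

lemma vol_ratio: "first_order T (\<lambda>e s. alt_vol e s / base_vol e s) (\<lambda>s. - h * (2 * log_slope + 2 * s))"
proof -
  define R where "R = h * (2 * \<bar>log_slope\<bar> + 2 * T)"
  show ?thesis
  proof (rule first_orderI[where ?e0.0=1 and ?K1.0=R and ?K2.0="R * (hi / lo)"])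
    have c: "\<bar>- h * (2 * log_slope + 2 * s)\<bar> \<le> R" if "s \<in> {0..T}" for s
    proof -
      have "\<bar>2 * log_slope + 2 * s\<bar> \<le> 2 * \<bar>log_slope\<bar> + 2 * T" using that by auto
      then show ?thesis using h by (simp add: R_def abs_mult)
    qed
    show "\<bar>- h * (2 * log_slope + 2 * s)\<bar> \<le> R" if "s \<in> {0..T}" for s by (rule c) fact
    fix e s :: real assume e: "0 < e" "e \<le> 1" and s: "s \<in> {0..T}"
    let ?c = "- h * (2 * log_slope + 2 * s)"
    have b: "lo \<le> base_vol e s" using base_vol_bounds e s by simp
    then have b0: "0 < base_vol e s" using lo by simp
    have "alt_vol e s / base_vol e s - 1 - ?c * e = ?c * e * (S s / base_vol e s - 1)"
    proof -
      have "alt_vol e s = base_vol e s + e * (?c * S s)"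
        by (simp add: alt_vol_def base_vol_def tilt_def algebra_simps)
      then show ?thesis using b0 by (simp add: add_divide_distrib diff_divide_distrib right_diff_distrib)
    qed
    also have "S s / base_vol e s - 1 = e * ((S s - m) / base_vol e s)"
      using b0 by (simp add: base_vol_def field_simps)
    finally have "\<bar>alt_vol e s / base_vol e s - 1 - ?c * e\<bar> = \<bar>?c\<bar> * e\<^sup>2 * \<bar>(S s - m) / base_vol e s\<bar>"
      using e by (simp add: abs_mult power2_eq_square)
    also have "\<dots> \<le> R * e\<^sup>2 * (hi / lo)"
    proof (intro mult_mono c s order_refl)
      have "\<bar>S s - m\<bar> \<le> hi" using bounds[OF s] m lo by auto
      then show "\<bar>(S s - m) / base_vol e s\<bar> \<le> hi / lo"
        unfolding abs_divide using b lo hi_pos by (intro frac_le) auto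
    qed (use c[OF s] in \<open>auto intro!: mult_nonneg_nonneg\<close>)
    finally show "\<bar>alt_vol e s / base_vol e s - 1 - ?c * e\<bar> \<le> R * (hi / lo) * e\<^sup>2"
      by (simp add: mult_ac)
  qed simp
qed

text \<open>The coefficients are h log_slope for each of the two factors k, 2 h s for the
  exponential, and minus their total for the tilted volatility. They sum to zero, which is how
  \<open>tilt\<close> was chosen.\<close>

lemma var_ratio:
  obtains C e0 where "0 < e0" "e0 \<le> 1 / 2" "0 \<le> C"
    "\<And>e s. 0 < e \<Longrightarrow> e \<le> e0 \<Longrightarrow> s \<in> {0..T} \<Longrightarrow> \<bar>alt_var e s - base_var e s\<bar> \<le> C * e\<^sup>2 * base_var e s"
proof -
  have exp: "first_order T (\<lambda>e s. exp ((2 * h * s) * e)) (\<lambda>s. 2 * h * s)"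
    by (rule first_order_exp[where K="2 * h * T"]) (use h in auto)
  define F where "F e s = k (\<theta> + e * h) / k \<theta> * (k (\<theta> + e * h) / k \<theta>) * exp ((2 * h * s) * e) * (alt_vol e s / base_vol e s)" for e s
  have "first_order T F (\<lambda>s. h * log_slope + h * log_slope + 2 * h * s + - h * (2 * log_slope + 2 * s))"
    unfolding F_def by (intro first_order_mult scale_ratio exp vol_ratio)
  moreover have "h * log_slope + h * log_slope + 2 * h * s + - h * (2 * log_slope + 2 * s) = 0" for s
    by (simp add: algebra_simps)
  ultimately have "first_order T F (\<lambda>s. 0)" by simp
  then obtain C e0 where C: "0 < e0" "\<And>s. s \<in> {0..T} \<Longrightarrow> \<bar>0 :: real\<bar> \<le> C"
    "\<And>e s. 0 < e \<Longrightarrow> e \<le> e0 \<Longrightarrow> s \<in> {0..T} \<Longrightarrow> \<bar>F e s - 1 - 0 * e\<bar> \<le> C * e\<^sup>2"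
    by (rule first_orderE) blast
  have "0 \<le> C" using C(2)[of 0] T by simp
  show ?thesis
  proof (rule that[of "min e0 (1/2)" C])
    fix e s assume e: "0 < e" "e \<le> min e0 (1/2)" and s: "s \<in> {0..T}"
    have b: "0 < base_vol e s" using base_vol_bounds(1)[of e s] e s lo by simp
    then have bv: "0 < base_var e s" using k_pos by (simp add: base_var_def)
    have e1: "exp (2 * (\<theta> + e * h) * s) = exp (2 * \<theta> * s) * exp ((2 * h * s) * e)"
      by (simp add: exp_add[symmetric] algebra_simps)
    have "alt_var e s = base_var e s * F e s"
      unfolding alt_var_def base_var_def F_def e1 using b k_pos by (simp add: power2_eq_square)
    then have "\<bar>alt_var e s - base_var e s\<bar> = base_var e s * \<bar>F e s - 1\<bar>"
      using bv by (simp add: abs_mult[symmetric] right_diff_distrib)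
        (metis abs_mult abs_of_pos mult.right_neutral right_diff_distrib)
    also have "\<dots> \<le> base_var e s * (C * e\<^sup>2)"
      using C(3)[of e s] e s bv by (intro mult_left_mono) auto
    finally show "\<bar>alt_var e s - base_var e s\<bar> \<le> C * e\<^sup>2 * base_var e s" by (simp add: mult_ac)
  qed (use C(1) \<open>0 \<le> C\<close> in auto)
qed

lemma signal_to_noise:
  assumes "0 \<le> e" "e \<le> 1 / 2" "s \<in> {0..T}"
  shows "base_var e s \<le> (1 + 2 * hi / lo * e) * (signal s * noise_vol e s)"
proof -
  have pos: "0 < S s" "0 < S' s" using bounds[OF assms(3)] lo by auto
  have "base_vol e s * S' s \<le> (1 + 2 * hi / lo * e) * S s * noise_vol e s"
  proof -
    \<comment> \<open>The bounds m \<le> hi and lo \<le> S s give the ratio hi / lo; the factor 2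
      pays for 1 - e \<ge> 1/2.\<close>
    have "e * m * S' s \<le> (2 * hi / lo * e) * S s * ((1 - e) * S' s)"
    proof -
      have "e * m \<le> e * hi" using assms m by (intro mult_left_mono) auto
      also have "\<dots> = 2 * hi / lo * e * lo * (1 / 2)" using lo by simp
      also have "\<dots> \<le> 2 * hi / lo * e * S s * (1 - e)"
        using assms bounds[OF assms(3)] lo hi_pos by (intro mult_mono) auto
      finally show ?thesis using pos mult_right_mono[of "e * m" "2 * hi / lo * e * S s * (1 - e)" "S' s"] by (simp add: mult_ac)
    qed
    moreover have "(1 + 2 * hi / lo * e) * S s * ((1 - e) * S' s) \<le> (1 + 2 * hi / lo * e) * S s * noise_vol e s"
      using assms pos lo hi_pos m by (intro mult_left_mono) (auto simp: noise_vol_def algebra_simps)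
    ultimately show ?thesis
      by (simp add: base_vol_def algebra_simps)
  qed
  then have "(k \<theta>)\<^sup>2 * exp (2 * \<theta> * s) * (base_vol e s * S' s) \<le> (k \<theta>)\<^sup>2 * exp (2 * \<theta> * s) * ((1 + 2 * hi / lo * e) * S s * noise_vol e s)"
    by (intro mult_left_mono) auto
  then show ?thesis
    using pos by (simp add: base_var_def signal_def field_simps)
qed

lemma continuous_vols:
  "continuous_on {0..T} (base_vol e)" "continuous_on {0..T} (alt_vol e)" "continuous_on {0..T} (noise_vol e)"
  "continuous_on {0..T} (base_var e)" "continuous_on {0..T} (alt_var e)" "continuous_on {0..T} signal"
proof -
  show 1: "continuous_on {0..T} (base_vol e)" "continuous_on {0..T} (alt_vol e)" "continuous_on {0..T} (noise_vol e)"
    using cont unfolding base_vol_def[abs_def] alt_vol_def[abs_def] noise_vol_def[abs_def] tilt_def[abs_def]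
    by (auto intro!: continuous_intros)
  show "continuous_on {0..T} (base_var e)" "continuous_on {0..T} (alt_var e)"
    using 1 unfolding base_var_def[abs_def] alt_var_def[abs_def] by (auto intro!: continuous_intros)
  have "S' s \<noteq> 0" if "s \<in> {0..T}" for s using bounds(3)[OF that] lo by simp
  then show "continuous_on {0..T} signal"
    using cont unfolding signal_def[abs_def] by (auto intro!: continuous_intros)
qed

section \<open>Chi-square factors of the cells and their product\<close>

abbreviation "step n \<equiv> sqrt (T / real n)"
abbreviation "base_cell n \<equiv> cell_integral T n (base_var (step n))"
abbreviation "alt_cell n \<equiv> cell_integral T n (alt_var (step n))"
abbreviation "noise_cell n \<equiv> cell_integral T n (noise_vol (step n))"

text \<open>The number x of \<open>pair_law_chi_square\<close> for cell i. With e = step n, the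
  first summand comes from the change of variance and has order e^4, the second from the change of
  slope and has order e^2 = T / n.\<close>

definition excess :: "nat \<Rightarrow> nat \<Rightarrow> real" where
  "excess n i = (1 - alt_cell n i / base_cell n i)\<^sup>2
    + 2 * (\<rho> (\<theta> + step n * h) - \<rho> \<theta>)\<^sup>2 * (alt_cell n i)\<^sup>2 / (base_cell n i * noise_cell n i)"

lemma cell_integral_mono:
  assumes "i \<in> {1..n}" "continuous_on {0..T} f" "continuous_on {0..T} g"
    "\<And>s. s \<in> {(real i - 1) * (T / real n)..real i * (T / real n)} \<Longrightarrow> f s \<le> g s"
  shows "cell_integral T n f i \<le> cell_integral T n g i"
  unfolding cell_integral_def
  by (intro integral_le integrable_continuous_interval continuous_on_subset[OF assms(2) cell_subset(1)[OF T assms(1)]]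
      continuous_on_subset[OF assms(3) cell_subset(1)[OF T assms(1)]] assms(4))

lemma cell_integral_cmult: "cell_integral T n (\<lambda>s. c * f s) i = c * cell_integral T n f i"
  by (simp add: cell_integral_def)

lemma cell_integral_const:
  assumes "i \<in> {1..n}"
  shows "cell_integral T n (\<lambda>s. c) i = T / real n * c"
  unfolding cell_integral_def using cell_subset(2,3)[OF T assms] by simp

lemma cell_integral_pos:
  assumes "i \<in> {1..n}" "continuous_on {0..T} f" "\<And>s. s \<in> {0..T} \<Longrightarrow> 0 < f s"
  shows "0 < cell_integral T n f i"
  unfolding cell_integral_def using cell_subset[OF T assms(1)] assms(2,3)
  by (intro integral_pos_of_pos continuous_on_subset[OF assms(2)]) auto

text \<open>The variance ratio is 1 + O(e^2), so its part is of order e^4. In the slope part the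
  ratio of base variance to noise variance is compared with the signal, whose values on the cell
  exceed its mean by at most \<eta>. Since e^2 is the cell length, the mean turns into the cell
  integral.\<close>

lemma excess_bound:
  fixes n i :: nat and C \<eta> :: real
  assumes i: "i \<in> {1..n}"
    and e: "step n \<le> 1 / 2" and C0: "0 \<le> C" "C * (step n)\<^sup>2 < 1"
    and C: "\<And>s. s \<in> {0..T} \<Longrightarrow> \<bar>alt_var (step n) s - base_var (step n) s\<bar> \<le> C * (step n)\<^sup>2 * base_var (step n) s"
    and osc: "\<And>s t. s \<in> {0..T} \<Longrightarrow> t \<in> {0..T} \<Longrightarrow> \<bar>s - t\<bar> \<le> (step n)\<^sup>2 \<Longrightarrow> signal s \<le> signal t + \<eta>"
  defines "B \<equiv> 2 * ((\<rho> (\<theta> + step n * h) - \<rho> \<theta>) / step n)\<^sup>2 * (1 + C * (step n)\<^sup>2)\<^sup>2 * (1 + 2 * hi / lo * step n)"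
  shows "0 < base_cell n i" "0 < alt_cell n i" "0 < noise_cell n i" "0 \<le> excess n i"
    and "excess n i \<le> (C * (step n)\<^sup>2)\<^sup>2 + B * (cell_integral T n signal i + \<eta> * (step n)\<^sup>2)"
proof -
  define \<epsilon> where "\<epsilon> = step n"
  have n: "0 < real n" using i by simp
  have \<epsilon>: "0 < \<epsilon>" "\<epsilon> \<le> 1 / 2" and \<epsilon>2: "\<epsilon>\<^sup>2 = T / real n"
    using T n e by (simp_all add: \<epsilon>_def)
  note C = C[folded \<epsilon>_def] and osc = osc[folded \<epsilon>_def] and C0 = C0[folded \<epsilon>_def]
  have base_pos: "0 < base_var \<epsilon> s" if "s \<in> {0..T}" for s
    using base_vol_bounds(1)[of \<epsilon> s] that \<epsilon> lo k_pos by (simp add: base_var_def)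
  have noise_pos: "0 < noise_vol \<epsilon> s" if "s \<in> {0..T}" for s
    using base_vol_bounds(3)[of \<epsilon> s] that \<epsilon> lo by simp
  define a0 where "a0 = base_cell n i"
  define a1 where "a1 = alt_cell n i"
  define b where "b = noise_cell n i"
  have a0: "0 < a0" unfolding a0_def \<epsilon>_def[symmetric] by (rule cell_integral_pos[OF i continuous_vols(4) base_pos])
  have b: "0 < b" unfolding b_def \<epsilon>_def[symmetric] by (rule cell_integral_pos[OF i continuous_vols(3) noise_pos])
  have sub: "s \<in> {0..T}" if "s \<in> {(real i - 1) * (T / real n)..real i * (T / real n)}" for s
    using cell_subset(1)[OF T i] that by blast
  have up: "a1 \<le> (1 + C * \<epsilon>\<^sup>2) * a0"
    unfolding a0_def a1_def \<epsilon>_def[symmetric] cell_integral_cmult[symmetric]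
  proof (rule cell_integral_mono[OF i continuous_vols(5)])
    fix s assume "s \<in> {(real i - 1) * (T / real n)..real i * (T / real n)}"
    then show "alt_var \<epsilon> s \<le> (1 + C * \<epsilon>\<^sup>2) * base_var \<epsilon> s"
      using C[OF sub, of s] by (simp add: distrib_right)
  qed (intro continuous_intros continuous_vols)
  have down: "(1 - C * \<epsilon>\<^sup>2) * a0 \<le> a1"
    unfolding a0_def a1_def \<epsilon>_def[symmetric] cell_integral_cmult[symmetric]
  proof (rule cell_integral_mono[OF i _ continuous_vols(5)])
    fix s assume "s \<in> {(real i - 1) * (T / real n)..real i * (T / real n)}"
    then show "(1 - C * \<epsilon>\<^sup>2) * base_var \<epsilon> s \<le> alt_var \<epsilon> s"
      using C[OF sub, of s] by (simp add: left_diff_distrib)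
  qed (intro continuous_intros continuous_vols)
  have a1: "0 < a1"
    using less_le_trans[OF mult_pos_pos[OF _ a0] down] C0 by simp
  define r where "r = a1 / a0"
  have r: "1 - C * \<epsilon>\<^sup>2 \<le> r" "r \<le> 1 + C * \<epsilon>\<^sup>2" "0 \<le> r"
    using up down a0 a1 by (simp_all add: r_def pos_le_divide_eq pos_divide_le_eq)
  define w where "w = cell_integral T n signal i / \<epsilon>\<^sup>2 + \<eta>"
  have w: "signal s \<le> w" if s: "s \<in> {(real i - 1) * (T / real n)..real i * (T / real n)}" for s
  proof -
    have "cell_integral T n (\<lambda>_. signal s - \<eta>) i \<le> cell_integral T n signal i"
    proof (rule cell_integral_mono[OF i _ continuous_vols(6)])
      fix t assume t: "t \<in> {(real i - 1) * (T / real n)..real i * (T / real n)}"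
      have "\<bar>s - t\<bar> \<le> \<epsilon>\<^sup>2"
        unfolding \<epsilon>2 using s t cell_subset(2)[OF T i] by (simp only: atLeastAtMost_iff) linarith
      then show "signal s - \<eta> \<le> signal t" using osc[OF sub[OF s] sub[OF t]] by simp
    qed simp
    then have "\<epsilon>\<^sup>2 * (signal s - \<eta>) \<le> cell_integral T n signal i"
      by (simp add: cell_integral_const[OF i] \<epsilon>2)
    then show ?thesis using \<epsilon> by (simp add: w_def pos_le_divide_eq mult.commute flip: diff_le_eq)
  qed
  \<comment> \<open>Integrating the pointwise comparison against the noise variance requires a
    constant in place of the signal; the bound \<open>w\<close> supplies it.\<close>
  have "a0 \<le> ((1 + 2 * hi / lo * \<epsilon>) * w) * b"
    unfolding a0_def b_def \<epsilon>_def[symmetric] cell_integral_cmult[symmetric]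
  proof (rule cell_integral_mono[OF i continuous_vols(4)])
    fix s assume s: "s \<in> {(real i - 1) * (T / real n)..real i * (T / real n)}"
    have "base_var \<epsilon> s \<le> (1 + 2 * hi / lo * \<epsilon>) * (signal s * noise_vol \<epsilon> s)"
      using signal_to_noise[of \<epsilon> s] \<epsilon> sub[OF s] by simp
    also have "\<dots> \<le> (1 + 2 * hi / lo * \<epsilon>) * (w * noise_vol \<epsilon> s)"
      using w[OF s] noise_pos[OF sub[OF s]] \<epsilon> hi_pos lo by (intro mult_left_mono mult_right_mono) auto
    finally show "base_var \<epsilon> s \<le> (1 + 2 * hi / lo * \<epsilon>) * w * noise_vol \<epsilon> s" by (simp add: mult.assoc)
  qed (intro continuous_intros continuous_vols)
  then have a0b: "a0 / b \<le> (1 + 2 * hi / lo * \<epsilon>) * w" using b by (simp add: pos_divide_le_eq)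
  define \<delta> where "\<delta> = \<rho> (\<theta> + \<epsilon> * h) - \<rho> \<theta>"
  have ex: "excess n i = (1 - r)\<^sup>2 + 2 * \<delta>\<^sup>2 * (r\<^sup>2 * (a0 / b))"
  proof -
    have "excess n i = (1 - a1 / a0)\<^sup>2 + 2 * \<delta>\<^sup>2 * a1\<^sup>2 / (a0 * b)"
      by (simp only: excess_def \<delta>_def a0_def a1_def b_def \<epsilon>_def)
    then show ?thesis using a0 by (simp add: r_def power2_eq_square)
  qed
  have "(1 - r)\<^sup>2 \<le> (C * \<epsilon>\<^sup>2)\<^sup>2"
    using r C0 by (intro abs_le_square_iff[THEN iffD1]) auto
  moreover have "2 * \<delta>\<^sup>2 * (r\<^sup>2 * (a0 / b)) \<le> 2 * \<delta>\<^sup>2 * ((1 + C * \<epsilon>\<^sup>2)\<^sup>2 * ((1 + 2 * hi / lo * \<epsilon>) * w))"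
    using r a0b a0 b by (intro mult_left_mono mult_mono power_mono) auto
  moreover have "2 * \<delta>\<^sup>2 * ((1 + C * \<epsilon>\<^sup>2)\<^sup>2 * ((1 + 2 * hi / lo * \<epsilon>) * w)) = B * (cell_integral T n signal i + \<eta> * \<epsilon>\<^sup>2)"
  proof -
    have "cell_integral T n signal i + \<eta> * \<epsilon>\<^sup>2 = \<epsilon>\<^sup>2 * w" using \<epsilon> by (simp add: w_def distrib_left)
    moreover have "B = 2 * (\<delta> / \<epsilon>)\<^sup>2 * (1 + C * \<epsilon>\<^sup>2)\<^sup>2 * (1 + 2 * hi / lo * \<epsilon>)"
      by (simp add: B_def \<delta>_def \<epsilon>_def)
    moreover have "\<delta>\<^sup>2 = (\<delta> / \<epsilon>)\<^sup>2 * \<epsilon>\<^sup>2" using \<epsilon> by (simp add: power_divide)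
    ultimately show ?thesis by (simp only:) (simp add: mult_ac)
  qed
  ultimately show "excess n i \<le> (C * (step n)\<^sup>2)\<^sup>2 + B * (cell_integral T n signal i + \<eta> * (step n)\<^sup>2)"
    unfolding ex \<epsilon>_def[symmetric] by linarith
  show "0 \<le> excess n i" unfolding ex using a0 b by (intro add_nonneg_nonneg mult_nonneg_nonneg) auto
  show "0 < base_cell n i" "0 < alt_cell n i" "0 < noise_cell n i"
    using a0 a1 b by (simp_all add: a0_def a1_def b_def)
qed

text \<open>Since n e^2 = T, bounds of the form e^2 Y summed over the n cells stay bounded, while
  their squares sum to T e^2 Y^2, which vanishes. The bound L on the cell means of the signal makes
  Y common to all cells.\<close>

lemma prod_excess_le_exp:
  fixes n :: nat and K L :: real
  assumes n: "1 \<le> n" and L: "0 \<le> L"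
    and cell: "\<And>i. i \<in> {1..n} \<Longrightarrow> cell_integral T n signal i \<le> (step n)\<^sup>2 * L"
    and x: "\<And>i. i \<in> {1..n} \<Longrightarrow> 0 \<le> excess n i"
      "\<And>i. i \<in> {1..n} \<Longrightarrow> excess n i \<le> (C * (step n)\<^sup>2)\<^sup>2 + B * (cell_integral T n signal i + \<eta> * (step n)\<^sup>2)"
    and B: "0 \<le> B"
  defines "Y \<equiv> C\<^sup>2 * (step n)\<^sup>2 + B * (L + \<eta>)"
  assumes small: "(step n)\<^sup>2 * Y \<le> 1 / 2"
  shows "(\<Prod>i\<in>{1..n}. 1 / sqrt (1 - excess n i))
    \<le> exp ((C\<^sup>2 * T * (step n)\<^sup>2 + B * (integral {0..T} signal + \<eta> * T)) / 2 + T * (step n)\<^sup>2 * Y\<^sup>2)"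
    and "\<And>i. i \<in> {1..n} \<Longrightarrow> excess n i \<le> 1 / 2"
proof -
  define \<epsilon> where "\<epsilon> = step n"
  have \<epsilon>2: "\<epsilon>\<^sup>2 = T / real n" using T by (simp add: \<epsilon>_def)
  have n\<epsilon>: "real n * \<epsilon>\<^sup>2 = T" using n by (simp add: \<epsilon>2)
  have xY: "excess n i \<le> \<epsilon>\<^sup>2 * Y" if i: "i \<in> {1..n}" for i
  proof -
    have "B * (cell_integral T n signal i + \<eta> * \<epsilon>\<^sup>2) \<le> B * (\<epsilon>\<^sup>2 * L + \<eta> * \<epsilon>\<^sup>2)"
      using cell[OF i] B by (intro mult_left_mono) (auto simp: \<epsilon>_def)
    then have "excess n i \<le> (C * \<epsilon>\<^sup>2)\<^sup>2 + B * (\<epsilon>\<^sup>2 * L + \<eta> * \<epsilon>\<^sup>2)"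
      using x(2)[OF i] unfolding \<epsilon>_def by linarith
    also have "\<dots> = \<epsilon>\<^sup>2 * Y"
      unfolding Y_def \<epsilon>_def[symmetric] by (simp add: power2_eq_square algebra_simps)
    finally show ?thesis .
  qed
  show half: "excess n i \<le> 1 / 2" if "i \<in> {1..n}" for i
    using xY[OF that] small unfolding \<epsilon>_def by linarith
  have "(\<Prod>i\<in>{1..n}. 1 / sqrt (1 - excess n i)) \<le> (\<Prod>i\<in>{1..n}. exp (excess n i / 2 + (excess n i)\<^sup>2))"
  proof (intro prod_mono conjI)
    fix i assume i: "i \<in> {1..n}"
    show "0 \<le> 1 / sqrt (1 - excess n i)" using half[OF i] by simp
    show "1 / sqrt (1 - excess n i) \<le> exp (excess n i / 2 + (excess n i)\<^sup>2)"
      by (rule inverse_sqrt_le_exp[OF x(1)[OF i] half[OF i]])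
  qed
  also have "\<dots> = exp (\<Sum>i\<in>{1..n}. excess n i / 2 + (excess n i)\<^sup>2)"
    by (rule exp_sum[symmetric]) simp
  also have "(\<Sum>i\<in>{1..n}. excess n i / 2 + (excess n i)\<^sup>2) = (\<Sum>i\<in>{1..n}. excess n i) / 2 + (\<Sum>i\<in>{1..n}. (excess n i)\<^sup>2)"
    by (simp add: sum.distrib sum_divide_distrib)
  also have "exp \<dots> \<le> exp ((C\<^sup>2 * T * \<epsilon>\<^sup>2 + B * (integral {0..T} signal + \<eta> * T)) / 2 + T * \<epsilon>\<^sup>2 * Y\<^sup>2)"
  proof -
    have "(\<Sum>i\<in>{1..n}. excess n i) \<le> (\<Sum>i\<in>{1..n}. (C * \<epsilon>\<^sup>2)\<^sup>2 + B * (cell_integral T n signal i + \<eta> * \<epsilon>\<^sup>2))"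
      using x(2) by (intro sum_mono) (simp add: \<epsilon>_def)
    also have "\<dots> = real n * (C * \<epsilon>\<^sup>2)\<^sup>2 + B * (integral {0..T} signal + \<eta> * (real n * \<epsilon>\<^sup>2))"
      using sum_cell_integral[OF T n continuous_vols(6)]
      by (simp add: sum.distrib sum_distrib_left[symmetric] distrib_left)
    also have "real n * (C * \<epsilon>\<^sup>2)\<^sup>2 = C\<^sup>2 * (real n * \<epsilon>\<^sup>2) * \<epsilon>\<^sup>2" by (simp add: power2_eq_square)
    finally have 1: "(\<Sum>i\<in>{1..n}. excess n i) \<le> C\<^sup>2 * T * \<epsilon>\<^sup>2 + B * (integral {0..T} signal + \<eta> * T)"
      unfolding n\<epsilon> .
    have "(\<Sum>i\<in>{1..n}. (excess n i)\<^sup>2) \<le> (\<Sum>i\<in>{1..n}. (\<epsilon>\<^sup>2 * Y)\<^sup>2)"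
      using x(1) xY by (intro sum_mono power_mono) auto
    also have "\<dots> = (real n * \<epsilon>\<^sup>2) * \<epsilon>\<^sup>2 * Y\<^sup>2" by (simp add: power2_eq_square)
    finally have 2: "(\<Sum>i\<in>{1..n}. (excess n i)\<^sup>2) \<le> T * \<epsilon>\<^sup>2 * Y\<^sup>2"
      unfolding n\<epsilon> .
    have "(\<Sum>i\<in>{1..n}. excess n i) / 2 \<le> (C\<^sup>2 * T * \<epsilon>\<^sup>2 + B * (integral {0..T} signal + \<eta> * T)) / 2"
      by (rule divide_right_mono[OF 1]) simp
    from add_mono[OF this 2] show ?thesis by (simp only: exp_le_cancel_iff)
  qed
  finally show "(\<Prod>i\<in>{1..n}. 1 / sqrt (1 - excess n i))
    \<le> exp ((C\<^sup>2 * T * (step n)\<^sup>2 + B * (integral {0..T} signal + \<eta> * T)) / 2 + T * (step n)\<^sup>2 * Y\<^sup>2)"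
    by (simp add: \<epsilon>_def)
qed

lemma step_tendsto: "step \<longlonglongrightarrow> 0" "\<forall>\<^sub>F n in sequentially. 0 < step n"
proof -
  have "(\<lambda>n. T / real n) \<longlonglongrightarrow> 0" by (rule lim_const_over_n)
  from tendsto_real_sqrt[OF this] show "step \<longlonglongrightarrow> 0" by simp
  show "\<forall>\<^sub>F n in sequentially. 0 < step n"
    \<comment> \<open>At n = 0 the quotient T / real n is 0 by convention, so the step is positive
      only from n = 1 on.\<close>
    using eventually_gt_at_top[of 0] by eventually_elim (use T in simp)
qed

text \<open>\<open>B n\<close> tends to 2 (D h)^2, and the exponent x / 2 of each cell factor
  removes the 2. The oscillation \<kappa> of the signal is fixed before n grows and costs (D h)^2
  \<kappa> T in the limit.\<close>

lemma chi_square_limit: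
  assumes D: "(\<rho> has_real_derivative D) (at \<theta>)" and \<eta>: "0 < \<eta>"
  shows "\<forall>\<^sub>F n in sequentially. (\<forall>i\<in>{1..n}. 0 < base_cell n i \<and> 0 < alt_cell n i \<and> 0 < noise_cell n i \<and> excess n i < 1)
    \<and> (\<Prod>i\<in>{1..n}. 1 / sqrt (1 - excess n i)) \<le> exp ((D * h)\<^sup>2 * integral {0..T} signal + \<eta>)"
proof -
  define W where "W = integral {0..T} signal"
  \<comment> \<open>Chosen so that (D h)^2 T \<kappa> < \<eta>; the added 1 covers D = 0.\<close>
  define \<kappa> where "\<kappa> = \<eta> / (2 * ((D * h)\<^sup>2 * T + 1))"
  have \<kappa>: "0 < \<kappa>" using \<eta> T by (simp add: \<kappa>_def add_nonneg_pos)
  have \<kappa>\<eta>: "(D * h)\<^sup>2 * (W + \<kappa> * T) < (D * h)\<^sup>2 * W + \<eta>"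
  proof -
    have "(D * h)\<^sup>2 * T * \<eta> < \<eta> * (2 * ((D * h)\<^sup>2 * T + 1))"
    proof -
      have "0 \<le> (D * h)\<^sup>2 * T * \<eta>" using T \<eta> by simp
      then show ?thesis using \<eta> by (simp add: algebra_simps)
    qed
    then have "(D * h)\<^sup>2 * T * \<kappa> < \<eta>"
      using T by (simp add: \<kappa>_def pos_divide_less_eq add_nonneg_pos)
    then show ?thesis by (simp only: distrib_left) (simp add: mult_ac)
  qed
  obtain C e0 where C: "0 < e0" "e0 \<le> 1 / 2" "0 \<le> C"
    "\<And>e s. 0 < e \<Longrightarrow> e \<le> e0 \<Longrightarrow> s \<in> {0..T} \<Longrightarrow> \<bar>alt_var e s - base_var e s\<bar> \<le> C * e\<^sup>2 * base_var e s"
    by (rule var_ratio) blast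
  have unif: "uniformly_continuous_on {0..T} signal"
    by (rule compact_uniformly_continuous[OF continuous_vols(6)]) simp
  obtain d where d: "0 < d" "\<And>s t. s \<in> {0..T} \<Longrightarrow> t \<in> {0..T} \<Longrightarrow> dist t s < d \<Longrightarrow> dist (signal t) (signal s) < \<kappa>"
    using unif[unfolded uniformly_continuous_on_def] \<kappa> by blast
  obtain L where L: "0 \<le> L" "\<And>s. s \<in> {0..T} \<Longrightarrow> signal s \<le> L"
  proof -
    have "bounded (signal ` {0..T})"
      by (intro compact_imp_bounded compact_continuous_image continuous_vols) simp
    then obtain L where "\<forall>y\<in>signal ` {0..T}. norm y \<le> L" by (auto simp: bounded_iff)
    then show ?thesis using that[of "\<bar>L\<bar>"] by force
  qed
  define B where "B n = 2 * ((\<rho> (\<theta> + step n * h) - \<rho> \<theta>) / step n)\<^sup>2 * (1 + C * (step n)\<^sup>2)\<^sup>2 * (1 + 2 * hi / lo * step n)" for n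
  define Y where "Y n = C\<^sup>2 * (step n)\<^sup>2 + B n * (L + \<kappa>)" for n
  define U where "U n = (C\<^sup>2 * T * (step n)\<^sup>2 + B n * (W + \<kappa> * T)) / 2 + T * (step n)\<^sup>2 * (Y n)\<^sup>2" for n
  \<comment> \<open>The difference quotient of the slope along the nonzero increments step n * h,
    multiplied back by h.\<close>
  have quot: "(\<lambda>n. (\<rho> (\<theta> + step n * h) - \<rho> \<theta>) / step n) \<longlonglongrightarrow> D * h"
  proof -
    have "filterlim (\<lambda>n. step n * h) (at 0) sequentially"
      unfolding filterlim_at
    proof
      show "\<forall>\<^sub>F n in sequentially. step n * h \<in> UNIV \<and> step n * h \<noteq> 0"
        using step_tendsto(2)
        by eventually_elim (intro conjI UNIV_I less_imp_neq[symmetric] mult_pos_pos h)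
      show "(\<lambda>n. step n * h) \<longlonglongrightarrow> 0"
        by (rule tendsto_mult_left_zero[OF step_tendsto(1)])
    qed
    from filterlim_compose[OF D[unfolded DERIV_def] this]
    have "(\<lambda>n. (\<rho> (\<theta> + step n * h) - \<rho> \<theta>) / (step n * h) * h) \<longlonglongrightarrow> D * h"
      by (rule tendsto_mult_right)
    then show ?thesis using h by simp
  qed
  have Blim: "B \<longlonglongrightarrow> 2 * (D * h)\<^sup>2 * (1 + C * 0\<^sup>2)\<^sup>2 * (1 + 2 * hi / lo * 0)"
    unfolding B_def by (intro tendsto_intros quot step_tendsto(1))
  have Ylim: "Y \<longlonglongrightarrow> C\<^sup>2 * 0\<^sup>2 + (2 * (D * h)\<^sup>2 * (1 + C * 0\<^sup>2)\<^sup>2 * (1 + 2 * hi / lo * 0)) * (L + \<kappa>)"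
    unfolding Y_def by (intro tendsto_intros Blim step_tendsto(1))
  have "U \<longlonglongrightarrow> (C\<^sup>2 * T * 0\<^sup>2 + (2 * (D * h)\<^sup>2 * (1 + C * 0\<^sup>2)\<^sup>2 * (1 + 2 * hi / lo * 0)) * (W + \<kappa> * T)) / 2
      + T * 0\<^sup>2 * (C\<^sup>2 * 0\<^sup>2 + (2 * (D * h)\<^sup>2 * (1 + C * 0\<^sup>2)\<^sup>2 * (1 + 2 * hi / lo * 0)) * (L + \<kappa>))\<^sup>2"
    unfolding U_def by (intro tendsto_intros Blim Ylim step_tendsto(1)) simp_all
  then have "U \<longlonglongrightarrow> (D * h)\<^sup>2 * (W + \<kappa> * T)" by simp
  then have evU: "\<forall>\<^sub>F n in sequentially. U n < (D * h)\<^sup>2 * W + \<eta>"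
    using \<kappa>\<eta> by (rule order_tendstoD)
  have "(\<lambda>n. (step n)\<^sup>2 * Y n) \<longlonglongrightarrow> 0\<^sup>2 * (C\<^sup>2 * 0\<^sup>2 + (2 * (D * h)\<^sup>2 * (1 + C * 0\<^sup>2)\<^sup>2 * (1 + 2 * hi / lo * 0)) * (L + \<kappa>))"
    by (intro tendsto_intros Ylim step_tendsto(1))
  then have evY: "\<forall>\<^sub>F n in sequentially. (step n)\<^sup>2 * Y n < 1 / 2"
    by (rule order_tendstoD) simp
  have ev0: "\<forall>\<^sub>F n in sequentially. step n < e0"
    using step_tendsto(1) C(1) by (rule order_tendstoD)
  have sq: "(\<lambda>n. (step n)\<^sup>2) \<longlonglongrightarrow> 0\<^sup>2"
    by (intro tendsto_intros step_tendsto(1))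
  then have evd: "\<forall>\<^sub>F n in sequentially. (step n)\<^sup>2 < d"
    by (rule order_tendstoD) (use d(1) in simp)
  have "(\<lambda>n. C * (step n)\<^sup>2) \<longlonglongrightarrow> C * 0\<^sup>2"
    by (intro tendsto_intros sq)
  then have evC: "\<forall>\<^sub>F n in sequentially. C * (step n)\<^sup>2 < 1"
    by (rule order_tendstoD) simp
  show ?thesis
    using evU evY ev0 evd evC eventually_ge_at_top[of 1]
  proof eventually_elim
    case (elim n)
    have e: "0 < step n" using T elim(6) by simp
    have osc: "signal s \<le> signal t + \<kappa>" if "s \<in> {0..T}" "t \<in> {0..T}" "\<bar>s - t\<bar> \<le> (step n)\<^sup>2" for s t
      using d(2)[of t s] that elim(4) by (simp add: dist_real_def)
    have Bnn: "0 \<le> B n"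
      unfolding B_def using e lo hi_pos by (intro mult_nonneg_nonneg) auto
    have e12: "step n \<le> 1 / 2" using elim(3) C(2) by linarith
    have CC: "\<bar>alt_var (step n) s - base_var (step n) s\<bar> \<le> C * (step n)\<^sup>2 * base_var (step n) s" if "s \<in> {0..T}" for s
      by (rule C(4)[OF e less_imp_le[OF elim(3)] that])
    have b: "0 < base_cell n i" "0 < alt_cell n i" "0 < noise_cell n i" "0 \<le> excess n i"
      "excess n i \<le> (C * (step n)\<^sup>2)\<^sup>2 + B n * (cell_integral T n signal i + \<kappa> * (step n)\<^sup>2)" if "i \<in> {1..n}" for i
      unfolding B_def by (rule excess_bound[OF that e12 C(3) elim(5) CC osc]; assumption)+
    have cell: "cell_integral T n signal i \<le> (step n)\<^sup>2 * L" if i: "i \<in> {1..n}" for i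
    proof -
      have "cell_integral T n signal i \<le> cell_integral T n (\<lambda>_. L) i"
        using cell_subset(1)[OF T i] L(2) by (intro cell_integral_mono[OF i continuous_vols(6)]) auto
      then show ?thesis using T by (simp add: cell_integral_const[OF i])
    qed
    have small: "(step n)\<^sup>2 * (C\<^sup>2 * (step n)\<^sup>2 + B n * (L + \<kappa>)) \<le> 1 / 2"
      using elim(2) by (simp add: Y_def)
    have "excess n i \<le> 1 / 2" if "i \<in> {1..n}" for i
      by (rule prod_excess_le_exp(2)[OF elim(6) L(1) cell b(4,5) Bnn small that])
    then have "excess n i < 1" if "i \<in> {1..n}" for i
      using that by force
    moreover have "(\<Prod>i\<in>{1..n}. 1 / sqrt (1 - excess n i)) \<le> exp ((D * h)\<^sup>2 * integral {0..T} signal + \<eta>)"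
    proof -
      have "(\<Prod>i\<in>{1..n}. 1 / sqrt (1 - excess n i)) \<le> exp (U n)"
        unfolding U_def Y_def W_def by (rule prod_excess_le_exp(1)[OF elim(6) L(1) cell b(4,5) Bnn small])
      also have "\<dots> \<le> exp ((D * h)\<^sup>2 * integral {0..T} signal + \<eta>)"
        using elim(1) by (simp add: W_def)
      finally show ?thesis .
    qed
    ultimately show ?case using b(1-3) by blast
  qed
qed

end

section \<open>From limit laws to a variance bound\<close>

lemma regression_chi_square_bound:
  fixes n :: nat and a1 a2 b :: "nat \<Rightarrow> real" and r1 r2 :: real and g :: "(nat \<Rightarrow> real \<times> real) \<Rightarrow> real"
  defines "x \<equiv> \<lambda>i. (1 - a2 i / a1 i)\<^sup>2 + 2 * (r2 - r1)\<^sup>2 * (a2 i)\<^sup>2 / (a1 i * b i)"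
    and "law \<equiv> \<lambda>a r. distr (\<Pi>\<^sub>M i\<in>{1..n}. pair_law (a i) (b i) r) (data_space n) (observe n)"
  assumes pos: "\<And>i. i \<in> {1..n} \<Longrightarrow> 0 < a1 i" "\<And>i. i \<in> {1..n} \<Longrightarrow> 0 < a2 i" "\<And>i. i \<in> {1..n} \<Longrightarrow> 0 < b i"
    and x: "\<And>i. i \<in> {1..n} \<Longrightarrow> x i < 1"
    and g [measurable]: "g \<in> borel_measurable (data_space n)" and g1: "\<And>y. \<bar>g y\<bar> \<le> 1"
  shows "((\<integral>y. g y \<partial>law a2 r2) - (\<integral>y. g y \<partial>law a1 r1))\<^sup>2 \<le> (\<integral>y. (g y)\<^sup>2 \<partial>law a1 r1) * ((\<Prod>i\<in>{1..n}. 1 / sqrt (1 - x i)) - 1)"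
proof -
  \<comment> \<open>Outside {1..n} the parameters are padded so that the two laws coincide and x is
    0, because the product bound has hypotheses at every index.\<close>
  define A1 where "A1 i = (if i \<in> {1..n} then a1 i else 1)" for i
  define A2 where "A2 i = (if i \<in> {1..n} then a2 i else 1)" for i
  define B where "B i = (if i \<in> {1..n} then b i else 1)" for i
  define R where "R i = (if i \<in> {1..n} then r2 else r1)" for i
  define P where "P i = pair_law (A1 i) (B i) r1" for i
  define Q where "Q i = pair_law (A2 i) (B i) (R i)" for i
  define L where "L i z = pair_density (A2 i) (B i) (R i) z / pair_density (A1 i) (B i) r1 z" for i z
  define C where "C i = 1 / sqrt (1 - ((1 - A2 i / A1 i)\<^sup>2 + 2 * (R i - r1)\<^sup>2 * (A2 i)\<^sup>2 / (A1 i * B i)))" for i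
  let ?m = "observe n"
  have P': "0 < A1 i" "0 < A2 i" "0 < B i" for i
    using pos by (auto simp: A1_def A2_def B_def)
  have x': "(1 - A2 i / A1 i)\<^sup>2 + 2 * (R i - r1)\<^sup>2 * (A2 i)\<^sup>2 / (A1 i * B i) < 1" for i
    using x[of i] by (auto simp: A1_def A2_def B_def R_def x_def)
  have law1: "law a1 r1 = distr (Pi\<^sub>M {1..n} P) (data_space n) ?m" and law2: "law a2 r2 = distr (Pi\<^sub>M {1..n} Q) (data_space n) ?m"
    unfolding law_def P_def Q_def
    by (intro arg_cong[where f="\<lambda>N. distr N (data_space n) ?m"] PiM_cong; simp add: A1_def A2_def B_def R_def)+
  have sets_PQ: "sets (Pi\<^sub>M {1..n} P) = sets (data_space n)" "sets (Pi\<^sub>M {1..n} Q) = sets (data_space n)"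
    by (auto intro!: sets_PiM_cong simp: P_def Q_def)
  have mP: "?m \<in> measurable (Pi\<^sub>M {1..n} P) (data_space n)" and mQ: "?m \<in> measurable (Pi\<^sub>M {1..n} Q) (data_space n)"
    using measurable_observe[of n] by (simp_all only: measurable_cong_sets[OF sets_PQ(1) refl] measurable_cong_sets[OF sets_PQ(2) refl])
  have "((\<integral>y. g (?m y) \<partial>Pi\<^sub>M {1..n} Q) - (\<integral>y. g (?m y) \<partial>Pi\<^sub>M {1..n} P))\<^sup>2
      \<le> (\<integral>y. (g (?m y))\<^sup>2 \<partial>Pi\<^sub>M {1..n} P) * ((\<Prod>i\<in>{1..n}. C i) - 1)"
  proof (rule product_chi_square_bound[where L=L])
    show "prob_space (P i)" "prob_space (Q i)" for i
      unfolding P_def Q_def by (intro prob_space_pair_law P')+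
    show "L i \<in> borel_measurable (P i)" for i
      unfolding L_def[abs_def] P_def by (simp cong: measurable_cong_sets)
    show "0 \<le> L i z" for i z
      unfolding L_def using pair_density_pos P' by (intro divide_nonneg_nonneg less_imp_le) auto
    show "Q i = density (P i) (L i)" for i
      unfolding P_def Q_def L_def by (rule pair_law_chi_square(1)[OF P' x'])
    show "(\<integral>\<^sup>+z. ennreal ((L i z)\<^sup>2) \<partial>P i) = ennreal (C i)" for i
      unfolding P_def L_def C_def by (rule pair_law_chi_square(2)[OF P' x'])
    show "0 \<le> C i" for i using x'[of i] by (simp add: C_def)
    show "(\<lambda>y. g (?m y)) \<in> borel_measurable (Pi\<^sub>M {1..n} P)"
      by (rule measurable_compose[OF mP g])
  qed (use g1 in auto)
  moreover have "(\<Prod>i\<in>{1..n}. C i) = (\<Prod>i\<in>{1..n}. 1 / sqrt (1 - x i))"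
    by (intro prod.cong refl) (simp add: C_def x_def A1_def A2_def B_def R_def)
  moreover have g2: "(\<lambda>y. (g y)\<^sup>2) \<in> borel_measurable (data_space n)" by measurable
  ultimately show ?thesis
    unfolding law1 law2 integral_distr[OF mQ g] integral_distr[OF mP g] integral_distr[OF mP g2] by simp
qed

lemma cell_integral_cong:
  assumes "0 < T" "i \<in> {1..n}" "\<And>s. s \<in> {0..T} \<Longrightarrow> f s = g s"
  shows "cell_integral T n f i = cell_integral T n g i"
  unfolding cell_integral_def
proof (rule Henstock_Kurzweil_Integration.integral_cong)
  fix s assume s: "s \<in> {(real i - 1) * (T / real n)..real i * (T / real n)}"
  with cell_subset(1)[OF assms(1,2)] show "f s = g s" by (intro assms(3)) blast
qed

lemma real_distribution_centered_normal:
  assumes "0 \<le> v"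
  shows "real_distribution (centered_normal v)"
proof -
  have "prob_space (centered_normal v)"
    unfolding centered_normal_def using assms
    by (auto intro!: prob_space_return prob_space_normal_density)
  then show ?thesis
    by (auto intro!: real_distribution.intro simp: real_distribution_axioms_def centered_normal_def)
qed

lemma char_centered_normal:
  assumes "0 \<le> v"
  shows "char (centered_normal v) u = of_real (exp (- (v * u\<^sup>2) / 2))"
proof (cases "v = 0")
  case True
  then show ?thesis by (simp add: centered_normal_def char_def integral_return)
next
  case False
  with assms show ?thesis by (simp add: centered_normal_def char_normal power_mult_distrib mult.commute)
qed

text \<open>The index is shifted because the laws are controlled from n = 1 on, whereas Levy's
  continuity theorem asks for a distribution at every index.\<close>

lemma weak_conv_char:
  fixes law :: "nat \<Rightarrow> 'a measure" and Z :: "nat \<Rightarrow> 'a \<Rightarrow> real"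
  assumes prob: "\<And>n. 1 \<le> n \<Longrightarrow> prob_space (law n)" and meas: "\<And>n. 1 \<le> n \<Longrightarrow> Z n \<in> borel_measurable (law n)"
    and conv: "weak_conv_m (\<lambda>n. distr (law n) borel (Z n)) (centered_normal v)" and v: "0 \<le> v"
  shows "(\<lambda>n. \<integral>y. iexp (u * Z (Suc n) y) \<partial>law (Suc n)) \<longlonglongrightarrow> of_real (exp (- (v * u\<^sup>2) / 2))"
proof -
  have "weak_conv_m (\<lambda>n. distr (law (Suc n)) borel (Z (Suc n))) (centered_normal v)"
    using conv unfolding weak_conv_m_def weak_conv_def by (auto intro: LIMSEQ_Suc)
  moreover have "real_distribution (distr (law (Suc n)) borel (Z (Suc n)))" for n
  proof -
    have "prob_space (distr (law (Suc n)) borel (Z (Suc n)))"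
      by (intro prob_space.prob_space_distr prob meas) auto
    then show ?thesis
      by (auto intro!: real_distribution.intro simp: real_distribution_axioms_def)
  qed
  ultimately have "(\<lambda>n. char (distr (law (Suc n)) borel (Z (Suc n))) u) \<longlonglongrightarrow> char (centered_normal v) u"
    using v by (intro levy_continuity1 real_distribution_centered_normal)
  moreover have "char (distr (law (Suc n)) borel (Z (Suc n))) u = (\<integral>y. iexp (u * Z (Suc n) y) \<partial>law (Suc n))" for n
    unfolding char_def using meas[of "Suc n"] by (subst integral_distr) auto
  ultimately show ?thesis using v by (simp add: char_centered_normal)
qed

section \<open>Limits in the sample size, the frequency and the shift\<close>

text \<open>Under \<open>law2\<close> the variable Z is Z' + h with Z' asymptotically N(0, v), so
  the mean of sin (u Z) tends to the imaginary part of exp (i u h - v u^2 / 2); under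
  \<open>law1\<close> it tends to 0 by symmetry. The second moment comes from sin^2 x = (1 - cos (2
  x)) / 2.\<close>

lemma shifted_normal_limit_bound:
  fixes law1 law2 :: "nat \<Rightarrow> 'a measure" and Z Z' :: "nat \<Rightarrow> 'a \<Rightarrow> real"
  assumes prob: "\<And>n. 1 \<le> n \<Longrightarrow> prob_space (law1 n)" "\<And>n. 1 \<le> n \<Longrightarrow> prob_space (law2 n)"
    and meas: "\<And>n. 1 \<le> n \<Longrightarrow> Z n \<in> borel_measurable (law1 n)" "\<And>n. 1 \<le> n \<Longrightarrow> Z n \<in> borel_measurable (law2 n)"
    and conv1: "weak_conv_m (\<lambda>n. distr (law1 n) borel (Z n)) (centered_normal v)"
    and conv2: "weak_conv_m (\<lambda>n. distr (law2 n) borel (Z' n)) (centered_normal v)" and v: "0 \<le> v"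
    and shift: "\<And>n y. 1 \<le> n \<Longrightarrow> Z' n y = Z n y - h"
    and bound: "\<forall>\<^sub>F n in sequentially. ((\<integral>y. sin (u * Z n y) \<partial>law2 n) - (\<integral>y. sin (u * Z n y) \<partial>law1 n))\<^sup>2
      \<le> (\<integral>y. (sin (u * Z n y))\<^sup>2 \<partial>law1 n) * K"
  shows "(sin (u * h) * exp (- (v * u\<^sup>2) / 2))\<^sup>2 \<le> (1 - exp (- (2 * v * u\<^sup>2))) / 2 * K"
proof -
  have int: "integrable (law1 n) (\<lambda>y. iexp (r * Z n y))" "integrable (law2 n) (\<lambda>y. iexp (r * Z n y))" if "1 \<le> n" for n r
    using prob_space.integrable_iexp[OF prob(1)[OF that], of "\<lambda>y. of_real (r * Z n y)"]
      prob_space.integrable_iexp[OF prob(2)[OF that], of "\<lambda>y. of_real (r * Z n y)"] meas[OF that] by auto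
  have Im_sin: "Im (iexp x) = sin x" and Re_cos: "Re (iexp x) = cos x" for x
    by (simp_all add: exp_Euler cos_of_real sin_of_real)
  have "(\<lambda>n. Im (\<integral>y. iexp (u * Z (Suc n) y) \<partial>law1 (Suc n))) \<longlonglongrightarrow> Im (of_real (exp (- (v * u\<^sup>2) / 2)))"
    by (intro tendsto_Im weak_conv_char prob meas conv1 v)
  moreover have "Im (\<integral>y. iexp (u * Z (Suc n) y) \<partial>law1 (Suc n)) = (\<integral>y. sin (u * Z (Suc n) y) \<partial>law1 (Suc n))" for n
    using integral_Im[OF int(1)[of "Suc n" u]] by (simp only: Im_sin)
  ultimately have s1: "(\<lambda>n. \<integral>y. sin (u * Z (Suc n) y) \<partial>law1 (Suc n)) \<longlonglongrightarrow> 0" by simp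
  have "Z' n \<in> borel_measurable (law2 n)" if "1 \<le> n" for n
  proof -
    have "Z' n = (\<lambda>y. Z n y - h)" using shift[OF that] by auto
    then show ?thesis using meas(2)[OF that] by simp
  qed
  then have "(\<lambda>n. Im (iexp (u * h) * (\<integral>y. iexp (u * Z' (Suc n) y) \<partial>law2 (Suc n)))) \<longlonglongrightarrow> Im (iexp (u * h) * of_real (exp (- (v * u\<^sup>2) / 2)))"
    by (intro tendsto_Im tendsto_mult tendsto_const weak_conv_char prob conv2 v)
  then have "(\<lambda>n. Im (iexp (u * h) * (\<integral>y. iexp (u * (Z (Suc n) y - h)) \<partial>law2 (Suc n)))) \<longlonglongrightarrow> Im (iexp (u * h) * of_real (exp (- (v * u\<^sup>2) / 2)))"
    by (simp only: shift One_nat_def Suc_le_mono le0)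
  moreover have "Im (iexp (u * h) * (\<integral>y. iexp (u * (Z (Suc n) y - h)) \<partial>law2 (Suc n))) = (\<integral>y. sin (u * Z (Suc n) y) \<partial>law2 (Suc n))" for n
  proof -
    have "iexp (u * h) * (\<integral>y. iexp (u * (Z (Suc n) y - h)) \<partial>law2 (Suc n)) = (\<integral>y. iexp (u * h) * iexp (u * (Z (Suc n) y - h)) \<partial>law2 (Suc n))"
      by (rule integral_mult_right_zero[symmetric])
    also have "\<dots> = (\<integral>y. iexp (u * Z (Suc n) y) \<partial>law2 (Suc n))"
      by (simp add: exp_add[symmetric] algebra_simps)
    finally show ?thesis
      using integral_Im[OF int(2)[of "Suc n" u]] by (simp only: Im_sin)
  qed
  moreover have "Im (iexp (u * h) * of_real (exp (- (v * u\<^sup>2) / 2))) = sin (u * h) * exp (- (v * u\<^sup>2) / 2)"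
    using Im_sin[of "u * h"] by simp
  ultimately have s2: "(\<lambda>n. \<integral>y. sin (u * Z (Suc n) y) \<partial>law2 (Suc n)) \<longlonglongrightarrow> sin (u * h) * exp (- (v * u\<^sup>2) / 2)" by simp
  have "(\<lambda>n. (1 - Re (\<integral>y. iexp ((2 * u) * Z (Suc n) y) \<partial>law1 (Suc n))) / 2) \<longlonglongrightarrow> (1 - Re (of_real (exp (- (v * (2 * u)\<^sup>2) / 2)))) / 2"
    by (intro tendsto_divide tendsto_diff tendsto_const tendsto_Re weak_conv_char prob meas conv1 v) simp_all
  moreover have "(1 - Re (\<integral>y. iexp ((2 * u) * Z (Suc n) y) \<partial>law1 (Suc n))) / 2 = (\<integral>y. (sin (u * Z (Suc n) y))\<^sup>2 \<partial>law1 (Suc n))" for n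
  proof -
    interpret prob_space "law1 (Suc n)" by (rule prob) simp
    have [measurable]: "Z (Suc n) \<in> borel_measurable (law1 (Suc n))" by (rule meas) simp
    have ic: "integrable (law1 (Suc n)) (\<lambda>y. cos (2 * u * Z (Suc n) y))"
      by (rule integrable_const_bound[where B=1]) auto
    have "(\<integral>y. (sin (u * Z (Suc n) y))\<^sup>2 \<partial>law1 (Suc n)) = (\<integral>y. (1 - cos (2 * u * Z (Suc n) y)) / 2 \<partial>law1 (Suc n))"
      by (simp add: cos_double_sin mult.assoc)
    also have "\<dots> = (1 - (\<integral>y. cos (2 * u * Z (Suc n) y) \<partial>law1 (Suc n))) / 2"
      using ic by (simp add: prob_space)
    also have "(\<integral>y. cos (2 * u * Z (Suc n) y) \<partial>law1 (Suc n)) = Re (\<integral>y. iexp ((2 * u) * Z (Suc n) y) \<partial>law1 (Suc n))"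
      using integral_Re[OF int(1)[of "Suc n" "2 * u"]] by (simp only: Re_cos)
    finally show ?thesis by simp
  qed
  ultimately have s3: "(\<lambda>n. \<integral>y. (sin (u * Z (Suc n) y))\<^sup>2 \<partial>law1 (Suc n)) \<longlonglongrightarrow> (1 - exp (- (2 * v * u\<^sup>2))) / 2"
    by (simp add: power_mult_distrib mult_ac)
  have "(sin (u * h) * exp (- (v * u\<^sup>2) / 2) - 0)\<^sup>2 \<le> (1 - exp (- (2 * v * u\<^sup>2))) / 2 * K"
  proof (rule tendsto_le[OF sequentially_bot])
    show "(\<lambda>n. (\<integral>y. (sin (u * Z (Suc n) y))\<^sup>2 \<partial>law1 (Suc n)) * K) \<longlonglongrightarrow> (1 - exp (- (2 * v * u\<^sup>2))) / 2 * K"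
      by (intro tendsto_mult_right s3)
    show "(\<lambda>n. ((\<integral>y. sin (u * Z (Suc n) y) \<partial>law2 (Suc n)) - (\<integral>y. sin (u * Z (Suc n) y) \<partial>law1 (Suc n)))\<^sup>2)
        \<longlonglongrightarrow> (sin (u * h) * exp (- (v * u\<^sup>2) / 2) - 0)\<^sup>2"
      by (intro tendsto_power tendsto_diff s1 s2)
    show "\<forall>\<^sub>F n in sequentially. ((\<integral>y. sin (u * Z (Suc n) y) \<partial>law2 (Suc n)) - (\<integral>y. sin (u * Z (Suc n) y) \<partial>law1 (Suc n)))\<^sup>2
        \<le> (\<integral>y. (sin (u * Z (Suc n) y))\<^sup>2 \<partial>law1 (Suc n)) * K"
      using bound by (rule eventually_sequentially_Suc[THEN iffD2])
  qed
  then show ?thesis by simp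
qed

text \<open>After division by u^2, the inequality 1 - exp (- t) \<le> t bounds the right side by v
  K, and sin (u h) / u tends to h as u tends to 0.\<close>

lemma small_frequency_bound:
  fixes v K h :: real
  assumes v: "0 \<le> v" and K: "0 \<le> K"
    and bound: "\<And>u. (sin (u * h) * exp (- (v * u\<^sup>2) / 2))\<^sup>2 \<le> (1 - exp (- (2 * v * u\<^sup>2))) / 2 * K"
  shows "h\<^sup>2 \<le> v * K"
proof -
  have le: "(sin (u * h) / u * exp (- (v * u\<^sup>2) / 2))\<^sup>2 \<le> v * K" if "u \<noteq> 0" for u
  proof -
    have "1 - exp (- (2 * v * u\<^sup>2)) \<le> 2 * v * u\<^sup>2"
      using exp_ge_add_one_self[of "- (2 * v * u\<^sup>2)"] by linarith
    then have "(1 - exp (- (2 * v * u\<^sup>2))) / 2 * K \<le> (v * u\<^sup>2) * K"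
      using K by (intro mult_right_mono) auto
    with bound[of u] have "(sin (u * h) * exp (- (v * u\<^sup>2) / 2))\<^sup>2 \<le> v * K * u\<^sup>2" by (simp add: mult_ac)
    then have "(sin (u * h) * exp (- (v * u\<^sup>2) / 2))\<^sup>2 / u\<^sup>2 \<le> v * K"
      using that by (simp add: pos_divide_le_eq)
    then show ?thesis by (simp add: power_divide power_mult_distrib)
  qed
  have "((\<lambda>u. sin (u * h) / u) \<longlongrightarrow> h) (at 0)"
  proof -
    have "((\<lambda>u. sin (u * h)) has_real_derivative h) (at 0)"
      by (auto intro!: derivative_eq_intros)
    then show ?thesis by (simp add: DERIV_def)
  qed
  then have "((\<lambda>u. (sin (u * h) / u * exp (- (v * u\<^sup>2) / 2))\<^sup>2) \<longlongrightarrow> (h * exp (- (v * 0\<^sup>2) / 2))\<^sup>2) (at 0)"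
    by (intro tendsto_intros) simp_all
  moreover have "\<forall>\<^sub>F u in at 0. (sin (u * h) / u * exp (- (v * u\<^sup>2) / 2))\<^sup>2 \<le> v * K"
    using le by (auto simp: eventually_at_filter)
  ultimately have "(h * exp (- (v * 0\<^sup>2) / 2))\<^sup>2 \<le> v * K"
    by (rule tendsto_upperbound) simp
  then show ?thesis by simp
qed

text \<open>The bound is divided by h^2 and h tends to 0, where exp t - 1 is linear. The tolerance
  \<eta> is taken as h^3, so that it disappears relative to h^2.\<close>

lemma small_shift_bound:
  fixes v K h0 :: real
  assumes v: "0 \<le> v" and K: "0 \<le> K" and h0: "0 < h0"
    and bound: "\<And>h \<eta>. 0 < h \<Longrightarrow> h \<le> h0 \<Longrightarrow> 0 < \<eta> \<Longrightarrow> h\<^sup>2 \<le> v * (exp (K * h\<^sup>2 + \<eta>) - 1)"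
  shows "1 \<le> v * K"
proof -
  have le: "1 \<le> v * (K + h + (K + h)\<^sup>2 * h\<^sup>2)" if h: "0 < h" "h \<le> h0" "(K + h) * h\<^sup>2 \<le> 1" for h
  proof -
    let ?x = "(K + h) * h\<^sup>2"
    have "h\<^sup>2 \<le> v * (exp (K * h\<^sup>2 + h * h\<^sup>2) - 1)"
      using h by (intro bound) auto
    also have "K * h\<^sup>2 + h * h\<^sup>2 = ?x" by (simp add: distrib_right)
    also have "v * (exp ?x - 1) \<le> v * (?x + ?x\<^sup>2)"
      using exp_bound[of ?x] h K v by (intro mult_left_mono) auto
    also have "\<dots> = v * (K + h + (K + h)\<^sup>2 * h\<^sup>2) * h\<^sup>2"
      by (simp add: power2_eq_square algebra_simps)
    finally have "1 * h\<^sup>2 \<le> v * (K + h + (K + h)\<^sup>2 * h\<^sup>2) * h\<^sup>2" by simp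
    then show ?thesis using h(1) by (simp only: mult_le_cancel_right) simp
  qed
  have lim: "((\<lambda>h. (K + h) * h\<^sup>2) \<longlongrightarrow> (K + 0) * 0\<^sup>2) (at_right 0)"
    by (intro tendsto_intros)
  have "\<forall>\<^sub>F h in at_right 0. (K + h) * h\<^sup>2 < 1"
    using lim by (rule order_tendstoD) simp
  moreover have "\<forall>\<^sub>F h in at_right 0. 0 < h \<and> h < h0"
    using h0 by (simp add: eventually_at_right_field) blast
  ultimately have "\<forall>\<^sub>F h in at_right 0. 1 \<le> v * (K + h + (K + h)\<^sup>2 * h\<^sup>2)"
    by eventually_elim (use le in auto)
  moreover have "((\<lambda>h. v * (K + h + (K + h)\<^sup>2 * h\<^sup>2)) \<longlongrightarrow> v * (K + 0 + (K + 0)\<^sup>2 * 0\<^sup>2)) (at_right 0)"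
    by (intro tendsto_intros)
  ultimately have "1 \<le> v * (K + 0 + (K + 0)\<^sup>2 * 0\<^sup>2)"
    by (intro tendsto_lowerbound[OF _ _ trivial_limit_at_right_real])
  then show ?thesis by simp
qed

section \<open>Local perturbations in the volatility class\<close>

text \<open>The volatility class in the coordinates \<open>(\<sigma>\<^sup>2, \<sigma>'\<^sup>2)\<close>, where it is convex: this keeps
  the local perturbations inside the class even when the parameter is on its boundary.\<close>

definition square_class :: "real \<Rightarrow> real \<Rightarrow> real \<Rightarrow> real \<Rightarrow> ((real \<Rightarrow> real) \<times> (real \<Rightarrow> real)) set" where
  "square_class T \<alpha> c c' = {(S, S').
     (\<forall>t\<in>{0..T}. c'\<^sup>2 \<le> S t \<and> S t \<le> c\<^sup>2 \<and> c'\<^sup>2 \<le> S' t \<and> S' t \<le> c\<^sup>2)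
   \<and> (\<forall>s\<in>{0..T}. \<forall>t\<in>{0..T}. (S t - S s)\<^sup>2 + (S' t - S' s)\<^sup>2 \<le> c * \<bar>t - s\<bar> powr (2 * \<alpha>))}"

lemma square_class_of_volatility_class:
  assumes "0 < c'" "(\<sigma>, \<sigma>') \<in> volatility_class T \<alpha> c c'"
  shows "(\<lambda>t. (\<sigma> t)\<^sup>2, \<lambda>t. (\<sigma>' t)\<^sup>2) \<in> square_class T \<alpha> c c'"
proof -
  have "c' \<le> \<sigma> t" "\<sigma> t \<le> c" "c' \<le> \<sigma>' t" "\<sigma>' t \<le> c" "0 \<le> \<sigma> t" "0 \<le> \<sigma>' t" if "t \<in> {0..T}" for t
    using assms(2) that by (auto simp: volatility_class_def less_imp_le)
  then have "c'\<^sup>2 \<le> (\<sigma> t)\<^sup>2 \<and> (\<sigma> t)\<^sup>2 \<le> c\<^sup>2 \<and> c'\<^sup>2 \<le> (\<sigma>' t)\<^sup>2 \<and> (\<sigma>' t)\<^sup>2 \<le> c\<^sup>2" if "t \<in> {0..T}" for t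
    using that assms(1) by (simp add: power_mono)
  then show ?thesis
    using assms(2) unfolding square_class_def volatility_class_def by simp
qed

lemma volatility_class_of_square_class:
  assumes "0 < c'" "0 < c" "(S, S') \<in> square_class T \<alpha> c c'"
  shows "(\<lambda>t. sqrt (S t), \<lambda>t. sqrt (S' t)) \<in> volatility_class T \<alpha> c c'"
proof -
  have b: "c'\<^sup>2 \<le> S t" "S t \<le> c\<^sup>2" "c'\<^sup>2 \<le> S' t" "S' t \<le> c\<^sup>2" if "t \<in> {0..T}" for t
    using assms(3) that by (auto simp: square_class_def)
  have pos: "0 < S t" "0 < S' t" if "t \<in> {0..T}" for t
    using b[OF that] zero_less_power[OF assms(1), of 2] by linarith+
  have "c' \<le> sqrt (S t)" "sqrt (S t) \<le> c" "c' \<le> sqrt (S' t)" "sqrt (S' t) \<le> c" if "t \<in> {0..T}" for t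
    using b[OF that] assms(1,2) by (auto intro: real_le_rsqrt real_le_lsqrt)
  then show ?thesis
    using assms(3) pos unfolding volatility_class_def square_class_def by (auto simp: less_imp_le)
qed

lemma square_convex:
  fixes x y e :: real
  assumes "0 \<le> e" "e \<le> 1"
  shows "((1 - e) * x + e * y)\<^sup>2 \<le> (1 - e) * x\<^sup>2 + e * y\<^sup>2"
proof -
  have "(1 - e) * x\<^sup>2 + e * y\<^sup>2 - ((1 - e) * x + e * y)\<^sup>2 = e * (1 - e) * (x - y)\<^sup>2"
    by (simp add: power2_eq_square algebra_simps)
  moreover have "0 \<le> e * (1 - e) * (x - y)\<^sup>2" using assms by simp
  ultimately show ?thesis by linarith
qed

text \<open>The bounds are interval constraints, and the Hoelder condition bounds a convex quadratic
  function of the increments.\<close>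

lemma square_class_convex:
  assumes S: "(S, S') \<in> square_class T \<alpha> c c'" and R: "(R, R') \<in> square_class T \<alpha> c c'" and e: "0 \<le> e" "e \<le> 1"
  shows "(\<lambda>t. S t + e * (R t - S t), \<lambda>t. S' t + e * (R' t - S' t)) \<in> square_class T \<alpha> c c'"
proof -
  have eq: "x + e * (y - x) = (1 - e) * x + e * y" for x y :: real by (simp add: algebra_simps)
  have conv: "l \<le> (1 - e) * x + e * y \<and> (1 - e) * x + e * y \<le> u" if "l \<le> x" "x \<le> u" "l \<le> y" "y \<le> u" for x y l u :: real
  proof -
    have "(1 - e) * l + e * l \<le> (1 - e) * x + e * y" "(1 - e) * x + e * y \<le> (1 - e) * u + e * u"
      using e that by (auto intro!: add_mono mult_left_mono)
    then show ?thesis by (simp add: algebra_simps)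
  qed
  have hoelder: "((1 - e) * S t + e * R t - ((1 - e) * S s + e * R s))\<^sup>2 + ((1 - e) * S' t + e * R' t - ((1 - e) * S' s + e * R' s))\<^sup>2
      \<le> c * \<bar>t - s\<bar> powr (2 * \<alpha>)" if st: "s \<in> {0..T}" "t \<in> {0..T}" for s t
  proof -
    let ?H = "c * \<bar>t - s\<bar> powr (2 * \<alpha>)"
    have "((1 - e) * S t + e * R t - ((1 - e) * S s + e * R s))\<^sup>2 \<le> (1 - e) * (S t - S s)\<^sup>2 + e * (R t - R s)\<^sup>2"
      using square_convex[OF e, of "S t - S s" "R t - R s"] by (simp add: algebra_simps)
    moreover have "((1 - e) * S' t + e * R' t - ((1 - e) * S' s + e * R' s))\<^sup>2 \<le> (1 - e) * (S' t - S' s)\<^sup>2 + e * (R' t - R' s)\<^sup>2"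
      using square_convex[OF e, of "S' t - S' s" "R' t - R' s"] by (simp add: algebra_simps)
    moreover have "(1 - e) * ((S t - S s)\<^sup>2 + (S' t - S' s)\<^sup>2) \<le> (1 - e) * ?H"
      using S st e by (intro mult_left_mono) (auto simp: square_class_def)
    moreover have "e * ((R t - R s)\<^sup>2 + (R' t - R' s)\<^sup>2) \<le> e * ?H"
      using R st e by (intro mult_left_mono) (auto simp: square_class_def)
    moreover have "(1 - e) * ?H + e * ?H = ?H" by (simp add: left_diff_distrib)
    ultimately show ?thesis unfolding distrib_left by linarith
  qed
  show ?thesis
    unfolding square_class_def eq using conv S R hoelder by (auto simp: square_class_def)
qed

lemma square_class_continuous:
  assumes "(S, S') \<in> square_class T \<alpha> c c'" "0 < \<alpha>"
  shows "continuous_on {0..T} S" "continuous_on {0..T} S'"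
proof -
  have cont: "continuous_on {0..T} f" if f: "\<And>s t. s \<in> {0..T} \<Longrightarrow> t \<in> {0..T} \<Longrightarrow> (f t - f s)\<^sup>2 \<le> c * \<bar>t - s\<bar> powr (2 * \<alpha>)" for f :: "real \<Rightarrow> real"
    unfolding continuous_on_def
  proof
    fix s assume s: "s \<in> {0..T}"
    have "((\<lambda>t. \<bar>t - s\<bar> powr (2 * \<alpha>)) \<longlongrightarrow> 0 powr (2 * \<alpha>)) (at s within {0..T})"
      using assms(2) by (intro tendsto_powr') (auto intro!: tendsto_eq_intros)
    then have lim: "((\<lambda>t. c * \<bar>t - s\<bar> powr (2 * \<alpha>)) \<longlongrightarrow> 0) (at s within {0..T})"
      by (auto intro: tendsto_mult_right_zero)
    have "((\<lambda>t. (f t - f s)\<^sup>2) \<longlongrightarrow> 0) (at s within {0..T})"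
      by (rule tendsto_sandwich[OF _ _ tendsto_const lim]) (use f s in \<open>auto simp: eventually_at_filter\<close>)
    from tendsto_real_sqrt[OF this] have "((\<lambda>t. \<bar>f t - f s\<bar>) \<longlongrightarrow> 0) (at s within {0..T})"
      by simp
    then show "(f \<longlongrightarrow> f s) (at s within {0..T})"
      using LIM_zero_iff tendsto_rabs_zero_iff by blast
  qed
  have "(S t - S s)\<^sup>2 \<le> c * \<bar>t - s\<bar> powr (2 * \<alpha>)" "(S' t - S' s)\<^sup>2 \<le> c * \<bar>t - s\<bar> powr (2 * \<alpha>)"
    if "s \<in> {0..T}" "t \<in> {0..T}" for s t
  proof -
    have "(S t - S s)\<^sup>2 + (S' t - S' s)\<^sup>2 \<le> c * \<bar>t - s\<bar> powr (2 * \<alpha>)"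
      using assms(1) that by (auto simp: square_class_def)
    then show "(S t - S s)\<^sup>2 \<le> c * \<bar>t - s\<bar> powr (2 * \<alpha>)" "(S' t - S' s)\<^sup>2 \<le> c * \<bar>t - s\<bar> powr (2 * \<alpha>)"
      using zero_le_power2[of "S t - S s"] zero_le_power2[of "S' t - S' s"] by linarith+
  qed
  then show "continuous_on {0..T} S" "continuous_on {0..T} S'"
    by (auto intro!: cont)
qed

text \<open>A constant pair has zero increments, so the whole Hoelder budget is left for the tilt,
  and the midpoint m leaves the positive room (c^2 - c'^2) / 2 on either side. By \<alpha> \<le> 1
  the affine factor, being Lipschitz on [0, T], is Hoelder of order \<alpha>.\<close>

lemma square_class_tilt:
  assumes c: "0 < c'" "c' < c" and T: "0 < T" and \<alpha>: "0 < \<alpha>" "\<alpha> \<le> 1" and S: "(S, S') \<in> square_class T \<alpha> c c'"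
  defines "m \<equiv> (c'\<^sup>2 + c\<^sup>2) / 2"
  obtains h0 where "0 < h0"
    "\<And>h. 0 < h \<Longrightarrow> h \<le> h0 \<Longrightarrow> (\<lambda>s. m + - h * (2 * l + 2 * s) * S s, \<lambda>_. m) \<in> square_class T \<alpha> c c'"
proof -
  define \<Lambda> where "\<Lambda> = 2 * \<bar>l\<bar> + 2 * T"
  \<comment> \<open>Bounds the squared increments of (2 l + 2 s) S s through 2 x^2 + 2 y^2, with x
    from the increment of S and y from that of the affine factor.\<close>
  define K where "K = 2 * \<Lambda>\<^sup>2 * c + 8 * (c\<^sup>2)\<^sup>2 * T powr (2 - 2 * \<alpha>)"
  \<comment> \<open>The first entry keeps the tilt within the distance of m to the bounds, the
    second makes h^2 K \<le> c.\<close>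
  define h0 where "h0 = min ((c\<^sup>2 - c'\<^sup>2) / (2 * (\<Lambda> * c\<^sup>2 + 1))) (sqrt (c / (K + 1)))"
  have c0: "0 < c" using c by simp
  have \<Lambda>: "0 < \<Lambda>" using T by (simp add: \<Lambda>_def add_nonneg_pos)
  have K: "0 \<le> K" using c0 by (simp add: K_def)
  have gap: "0 < c\<^sup>2 - c'\<^sup>2" using c power_strict_mono[of c' c 2] by simp
  have den: "0 < \<Lambda> * c\<^sup>2 + 1" using \<Lambda> by (intro add_nonneg_pos mult_nonneg_nonneg) auto
  have m: "c'\<^sup>2 \<le> m" "m \<le> c\<^sup>2" "c\<^sup>2 - m = (c\<^sup>2 - c'\<^sup>2) / 2" "m - c'\<^sup>2 = (c\<^sup>2 - c'\<^sup>2) / 2"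
    using gap by (auto simp: m_def field_simps)
  have S': "c'\<^sup>2 \<le> S t" "S t \<le> c\<^sup>2" "0 \<le> S t" if "t \<in> {0..T}" for t
    using S that order_trans[OF zero_le_power2, of c' "S t"] by (auto simp: square_class_def)
  have hoelder: "(S t - S s)\<^sup>2 \<le> c * \<bar>t - s\<bar> powr (2 * \<alpha>)" if "s \<in> {0..T}" "t \<in> {0..T}" for s t
  proof -
    have "(S t - S s)\<^sup>2 + (S' t - S' s)\<^sup>2 \<le> c * \<bar>t - s\<bar> powr (2 * \<alpha>)"
      using S that by (auto simp: square_class_def)
    then show ?thesis using zero_le_power2[of "S' t - S' s"] by linarith
  qed
  have slope: "\<bar>2 * l + 2 * s\<bar> \<le> \<Lambda>" if "s \<in> {0..T}" for s
    using that by (auto simp: \<Lambda>_def)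
  show ?thesis
  proof (rule that[of h0])
    show "0 < h0" using gap den c0 K by (auto simp: h0_def intro!: divide_pos_pos mult_pos_pos add_nonneg_pos)
    fix h assume h: "0 < h" "h \<le> h0"
    define f where "f s = - h * (2 * l + 2 * s) * S s" for s
    have small: "\<bar>f s\<bar> \<le> (c\<^sup>2 - c'\<^sup>2) / 2" if s: "s \<in> {0..T}" for s
    proof -
      have "\<bar>f s\<bar> = h * (\<bar>2 * l + 2 * s\<bar> * S s)" using h S'[OF s] by (simp add: f_def abs_mult)
      also have "\<dots> \<le> h * (\<Lambda> * c\<^sup>2)"
        using slope[OF s] S'[OF s] h \<Lambda> by (intro mult_left_mono mult_mono) auto
      also have "\<dots> \<le> h * (\<Lambda> * c\<^sup>2 + 1)" using h by (intro mult_left_mono) auto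
      also have "\<dots> \<le> (c\<^sup>2 - c'\<^sup>2) / (2 * (\<Lambda> * c\<^sup>2 + 1)) * (\<Lambda> * c\<^sup>2 + 1)"
        using h den by (intro mult_right_mono) (auto simp: h0_def)
      also have "\<dots> = (c\<^sup>2 - c'\<^sup>2) / 2"
      proof -
        have "x / (2 * d) * d = x / 2" if "0 < d" for x d :: real using that by simp
        from this[OF den] show ?thesis .
      qed
      finally show ?thesis .
    qed
    have h2: "h\<^sup>2 * K \<le> c"
    proof -
      have "h\<^sup>2 \<le> (sqrt (c / (K + 1)))\<^sup>2" using h by (intro power_mono) (auto simp: h0_def)
      also have "\<dots> = c / (K + 1)" using c0 K by simp
      finally have "h\<^sup>2 * (K + 1) \<le> c" using K by (simp add: pos_le_divide_eq)
      moreover have "h\<^sup>2 * K \<le> h\<^sup>2 * (K + 1)" by (intro mult_left_mono) auto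
      ultimately show ?thesis by linarith
    qed
    have "(f t - f s)\<^sup>2 \<le> c * \<bar>t - s\<bar> powr (2 * \<alpha>)" if st: "s \<in> {0..T}" "t \<in> {0..T}" for s t
    proof -
      define D where "D = \<bar>t - s\<bar> powr (2 * \<alpha>)"
      have D0: "0 \<le> D" by (simp add: D_def)
      have lip: "(t - s)\<^sup>2 \<le> T powr (2 - 2 * \<alpha>) * D"
      proof (cases "t = s")
        case False
        then have "(t - s)\<^sup>2 = \<bar>t - s\<bar> powr 2" by simp
        also have "\<dots> = \<bar>t - s\<bar> powr (2 - 2 * \<alpha>) * D"
          by (simp add: D_def powr_add[symmetric])
        also have "\<dots> \<le> T powr (2 - 2 * \<alpha>) * D"
          using st \<alpha> D0 by (intro mult_right_mono powr_mono2) auto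
        finally show ?thesis .
      qed (simp add: D_def)
      define x where "x = (2 * l + 2 * t) * (S t - S s)"
      define y where "y = 2 * (t - s) * S s"
      have fx: "f t - f s = - h * (x + y)" by (simp add: f_def x_def y_def algebra_simps)
      have x2: "x\<^sup>2 \<le> \<Lambda>\<^sup>2 * (c * D)"
        unfolding x_def power_mult_distrib using slope[OF st(2)] hoelder[OF st] \<Lambda>
        by (intro mult_mono) (auto simp: D_def abs_le_square_iff[symmetric])
      have y2: "y\<^sup>2 \<le> 4 * (T powr (2 - 2 * \<alpha>) * D) * (c\<^sup>2)\<^sup>2"
        unfolding y_def power_mult_distrib using lip S'[OF st(1)] D0
        by (intro mult_mono power_mono) auto
      have "(x + y)\<^sup>2 \<le> 2 * x\<^sup>2 + 2 * y\<^sup>2"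
        using sum_squares_bound[of x y] by (simp add: power2_eq_square algebra_simps)
      also have "\<dots> \<le> K * D"
        using x2 y2 by (simp add: K_def algebra_simps)
      finally have "h\<^sup>2 * (x + y)\<^sup>2 \<le> h\<^sup>2 * (K * D)" by (intro mult_left_mono) auto
      also have "\<dots> = (h\<^sup>2 * K) * D" by simp
      also have "\<dots> \<le> c * D" using h2 D0 by (intro mult_right_mono)
      finally show ?thesis by (simp add: fx power_mult_distrib D_def)
    qed
    then show "(\<lambda>s. m + - h * (2 * l + 2 * s) * S s, \<lambda>_. m) \<in> square_class T \<alpha> c c'"
      unfolding f_def[symmetric] square_class_def using small m by (fastforce simp: abs_le_iff)
  qed
qed

lemma increment_measurable:
  assumes X: "\<And>t. t \<in> {0..T} \<Longrightarrow> X t \<in> borel_measurable M" and T: "0 < T" and i: "i \<in> {1..n}"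
  shows "increment T n X i \<in> borel_measurable M"
proof -
  show ?thesis
    unfolding increment_def[abs_def] using cell_subset(1,3)[OF T i] by (intro borel_measurable_diff X) auto
qed

lemma prob_space_data_law:
  assumes model: "two_factor_model M T T1 T2 x1 x2 p B B' X1 X2" and T: "0 < T"
  shows "prob_space (data_law M T n X1 X2)"
proof -
  interpret prob_space M using model by (simp add: two_factor_model_def brownian_motion_def)
  have X: "X1 t \<in> borel_measurable M" "X2 t \<in> borel_measurable M" if "t \<in> {0..T}" for t
    using model that by (cases p; auto simp: two_factor_model_def forward_price_def)+
  have "(\<lambda>\<omega>. \<lambda>i\<in>{1..n}. (increment T n X1 i \<omega>, increment T n X2 i \<omega>)) \<in> measurable M (data_space n)"
    unfolding borel_prod[symmetric]
    by (intro measurable_restrict measurable_Pair increment_measurable[OF X(1) T] increment_measurable[OF X(2) T])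
  then show ?thesis unfolding data_law_def by (rule prob_space_distr)
qed

section \<open>The efficiency bound\<close>

text \<open>Rests on exp (\<theta> T2) - exp (\<theta> T1) = k exp (\<theta> (T1 + T2)) with k the
  price scale, by which D^2 k^2 is the inverse of the prefactor of \<open>V_opt\<close>; the factor
  k^2 is the one that W carries in front of the integral.\<close>

lemma inverse_V_opt:
  assumes "0 < T" "0 < \<theta>" "T1 < T2" and cont: "continuous_on {0..T} \<sigma>" "continuous_on {0..T} \<sigma>'"
    and pos: "\<And>t. t \<in> {0..T} \<Longrightarrow> 0 < \<sigma> t" "\<And>t. t \<in> {0..T} \<Longrightarrow> 0 < \<sigma>' t"
  defines "D \<equiv> - (T2 - T1) * exp (- \<theta> * (T1 + T2)) / (price_scale T1 T2 \<theta>)\<^sup>2"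
    and "W \<equiv> integral {0..T} (\<lambda>s. (price_scale T1 T2 \<theta>)\<^sup>2 * exp (2 * \<theta> * s) * (\<sigma> s)\<^sup>2 / (\<sigma>' s)\<^sup>2)"
  shows "0 < W" "V_opt T T1 T2 (\<theta>, \<sigma>, \<sigma>') = 1 / (D\<^sup>2 * W)"
proof -
  define k where "k = price_scale T1 T2 \<theta>"
  define J where "J = integral {0..T} (\<lambda>s. exp (2 * \<theta> * s) * (\<sigma> s)\<^sup>2 / (\<sigma>' s)\<^sup>2)"
  have k: "0 < k" using assms by (simp add: k_def price_scale_def)
  have nz: "\<sigma>' s \<noteq> 0" if "s \<in> {0..T}" for s using pos(2)[OF that] by simp
  have J: "0 < J"
    unfolding J_def
  proof (rule integral_pos_of_pos)
    show "continuous_on {0..T} (\<lambda>s. exp (2 * \<theta> * s) * (\<sigma> s)\<^sup>2 / (\<sigma>' s)\<^sup>2)"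
      using cont nz by (auto intro!: continuous_intros)
    show "0 < exp (2 * \<theta> * s) * (\<sigma> s)\<^sup>2 / (\<sigma>' s)\<^sup>2" if "s \<in> {0..T}" for s
      using pos[OF that] by simp
  qed (use assms in simp)
  have W: "W = k\<^sup>2 * J"
    unfolding W_def J_def k_def[symmetric] by (simp add: mult.assoc flip: times_divide_eq_right)
  then show "0 < W" using k J by simp
  have e: "exp (\<theta> * T2) - exp (\<theta> * T1) = k * exp (\<theta> * (T1 + T2))"
  proof -
    have "exp (- \<theta> * T1) * exp (\<theta> * (T1 + T2)) = exp (\<theta> * T2)" "exp (- \<theta> * T2) * exp (\<theta> * (T1 + T2)) = exp (\<theta> * T1)"
      by (simp_all add: exp_add[symmetric] algebra_simps)
    then show ?thesis by (simp add: k_def price_scale_def left_diff_distrib)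
  qed
  have "D = - ((T2 - T1) / (k\<^sup>2 * exp (\<theta> * (T1 + T2))))"
    by (simp add: D_def k_def exp_minus divide_inverse mult_ac del: minus_diff_eq)
  then have "D\<^sup>2 = (T2 - T1)\<^sup>2 / (k\<^sup>2 * exp (\<theta> * (T1 + T2)))\<^sup>2"
    by (simp only: power2_minus power_divide)
  also have "(k\<^sup>2 * exp (\<theta> * (T1 + T2)))\<^sup>2 = k\<^sup>2 * (k * exp (\<theta> * (T1 + T2)))\<^sup>2"
    by (simp add: power2_eq_square)
  finally have "D\<^sup>2 = (T2 - T1)\<^sup>2 / (k * exp (\<theta> * (T1 + T2)))\<^sup>2 / k\<^sup>2"
    by simp
  then have DW: "D\<^sup>2 * W = (T2 - T1)\<^sup>2 * J / (k * exp (\<theta> * (T1 + T2)))\<^sup>2"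
    unfolding W using k by simp
  show "V_opt T T1 T2 (\<theta>, \<sigma>, \<sigma>') = 1 / (D\<^sup>2 * W)"
    unfolding DW V_opt_def prod.case J_def[symmetric] e using assms(3) J k by (simp add: field_simps)
qed

theorem theorem2:
  fixes T T1 T2 \<alpha> c c' x1 x2 :: real
    and M :: "param \<Rightarrow> 'w measure"
    and B B' X1 X2 :: "param \<Rightarrow> real \<Rightarrow> 'w \<Rightarrow> real"
    and est :: "nat \<Rightarrow> (nat \<Rightarrow> real \<times> real) \<Rightarrow> real"
    and V :: "param \<Rightarrow> real"
  assumes times: "0 < T" "T \<le> T1" "T1 < T2"
    and constants: "1/2 \<le> \<alpha>" "\<alpha> \<le> 1" "0 < c'" "c' < c"
    and model: "\<And>p. p \<in> param_space T \<alpha> c c' \<Longrightarrow>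
        two_factor_model (M p) T T1 T2 x1 x2 p (B p) (B' p) (X1 p) (X2 p)"
    and estimator: "\<And>n. n \<ge> 1 \<Longrightarrow> est n \<in> borel_measurable (data_space n)"
    and variance: "\<And>p. p \<in> param_space T \<alpha> c c' \<Longrightarrow> 0 \<le> V p"
    and normality: "\<And>p q. p \<in> param_space T \<alpha> c c' \<Longrightarrow> local_sequence T \<alpha> c c' p q \<Longrightarrow>
        weak_conv_m
          (\<lambda>n. distr (data_law (M (q n)) T n (X1 (q n)) (X2 (q n))) borel
                 (\<lambda>y. (est n y - fst (q n)) / sqrt (T / real n)))
          (centered_normal (V p))"
  shows "\<forall>p \<in> param_space T \<alpha> c c'. V p \<ge> V_opt T T1 T2 p"
proof
  fix p :: param assume p: "p \<in> param_space T \<alpha> c c'"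
  obtain \<theta> \<sigma> \<sigma>' where p_eq: "p = (\<theta>, \<sigma>, \<sigma>')" by (cases p) auto
  have \<theta>: "0 < \<theta>" and vol: "(\<sigma>, \<sigma>') \<in> volatility_class T \<alpha> c c'"
    using p by (auto simp: p_eq param_space_def)
  have c0: "0 < c" and \<alpha>: "0 < \<alpha>" using constants by auto
  define S where "S t = (\<sigma> t)\<^sup>2" for t
  define S' where "S' t = (\<sigma>' t)\<^sup>2" for t
  have S: "(S, S') \<in> square_class T \<alpha> c c'"
    unfolding S_def S'_def by (rule square_class_of_volatility_class[OF constants(3) vol])
  define m where "m = (c'\<^sup>2 + c\<^sup>2) / 2"
  have sq: "c'\<^sup>2 < c\<^sup>2" using constants power_strict_mono[of c' c 2] by simp
  have m: "c'\<^sup>2 \<le> m" "m \<le> c\<^sup>2" using sq by (auto simp: m_def)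
  have mm: "(\<lambda>_. m, \<lambda>_. m) \<in> square_class T \<alpha> c c'"
    using m c0 by (auto simp: square_class_def)
  have pos: "0 < \<sigma> t" "0 < \<sigma>' t" if "t \<in> {0..T}" for t
    using vol that by (auto simp: volatility_class_def)
  have contS: "continuous_on {0..T} S" "continuous_on {0..T} S'"
    by (rule square_class_continuous[OF S \<alpha>])+
  have cont: "continuous_on {0..T} \<sigma>" "continuous_on {0..T} \<sigma>'"
  proof -
    have "continuous_on {0..T} (\<lambda>t. sqrt (S t))" "continuous_on {0..T} (\<lambda>t. sqrt (S' t))"
      by (intro continuous_intros contS)+
    moreover have "sqrt (S t) = \<sigma> t" "sqrt (S' t) = \<sigma>' t" if "t \<in> {0..T}" for t
      using pos[OF that] by (simp_all add: S_def S'_def)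
    ultimately show "continuous_on {0..T} \<sigma>" "continuous_on {0..T} \<sigma>'"
      by (auto cong: continuous_on_cong_simp)
  qed
  define l where "l = (T2 * exp (- \<theta> * T2) - T1 * exp (- \<theta> * T1)) / price_scale T1 T2 \<theta>"
  obtain h0 where h0: "0 < h0" and tilt_class: "\<And>h. 0 < h \<Longrightarrow> h \<le> h0 \<Longrightarrow>
      (\<lambda>s. m + - h * (2 * l + 2 * s) * S s, \<lambda>_. m) \<in> square_class T \<alpha> c c'"
    unfolding m_def by (rule square_class_tilt[OF constants(3,4) times(1) \<alpha> constants(2) S]) blast
  define D where "D = - (T2 - T1) * exp (- \<theta> * (T1 + T2)) / (price_scale T1 T2 \<theta>)\<^sup>2"
  define W where "W = integral {0..T} (\<lambda>s. (price_scale T1 T2 \<theta>)\<^sup>2 * exp (2 * \<theta> * s) * S s / S' s)"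
  have D: "(regression_slope T1 T2 has_real_derivative D) (at \<theta>)"
    unfolding D_def by (rule has_derivative_regression_slope[OF \<theta> times(3)])
  have W: "0 < W" and Vopt: "V_opt T T1 T2 p = 1 / (D\<^sup>2 * W)"
    using inverse_V_opt[OF times(1) \<theta> times(3) cont pos] unfolding W_def D_def S_def S'_def p_eq by auto
  have key: "h\<^sup>2 \<le> V p * (exp (D\<^sup>2 * W * h\<^sup>2 + \<eta>) - 1)" if h_range: "0 < h" "h \<le> h0" and \<eta>: "0 < \<eta>" for h \<eta>
  proof -
    interpret local_alternative T T1 T2 \<theta> h m "c'\<^sup>2" "c\<^sup>2" S S'
    proof
      fix s assume "s \<in> {0..T}"
      then show "c'\<^sup>2 \<le> S s" "S s \<le> c\<^sup>2" "c'\<^sup>2 \<le> S' s" "S' s \<le> c\<^sup>2"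
        using S by (auto simp: square_class_def)
    qed (use times \<theta> h_range constants m contS in auto)
    have tilt_eq: "(\<lambda>s. m + tilt s) = (\<lambda>s. m + - h * (2 * l + 2 * s) * S s)"
      by (simp add: tilt_def log_slope_def l_def)
    have W_eq: "W = integral {0..T} signal"
      by (simp add: W_def signal_def[abs_def])
    have base_class: "(base_vol e, noise_vol e) \<in> square_class T \<alpha> c c'" and alt_class: "(alt_vol e, noise_vol e) \<in> square_class T \<alpha> c c'"
      if "0 \<le> e" "e \<le> 1" for e
      using square_class_convex[OF S mm that] square_class_convex[OF S tilt_class[OF h_range, folded tilt_eq] that]
      by (simp_all add: base_vol_def[abs_def] noise_vol_def[abs_def] alt_vol_def[abs_def])
    \<comment> \<open>When the step is at most 1 the perturbed volatilities are convex combinations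
      in the class. For all other n the sequences fall back on \<sigma> and \<sigma>', because a
      local sequence must lie in the parameter space for every n.\<close>
    define inside where "inside n \<longleftrightarrow> 1 \<le> n \<and> step n \<le> 1" for n
    define q1 where "q1 n = (if inside n then (\<theta>, \<lambda>t. sqrt (base_vol (step n) t), \<lambda>t. sqrt (noise_vol (step n) t)) else p)" for n
    \<comment> \<open>The first component is \<theta> + step n * h even where \<open>inside\<close>
      fails, since the shift of the rescaled error by h must be exact for all n \<ge> 1.\<close>
    define q2 where "q2 n = (\<theta> + step n * h,
      if inside n then (\<lambda>t. sqrt (alt_vol (step n) t), \<lambda>t. sqrt (noise_vol (step n) t)) else (\<sigma>, \<sigma>'))" for n
    have step0: "0 \<le> step n" for n using T by simp
    have ev_inside: "\<forall>\<^sub>F n in sequentially. inside n"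
      using order_tendstoD(2)[OF step_tendsto(1) zero_less_one] eventually_ge_at_top[of 1]
      by eventually_elim (simp add: inside_def)
    have q1_mem: "q1 n \<in> param_space T \<alpha> c c'" for n
      using p \<theta> volatility_class_of_square_class[OF constants(3) c0 base_class[OF step0, of n]]
      by (simp add: q1_def param_space_def inside_def)
    have q2_mem: "q2 n \<in> param_space T \<alpha> c c'" for n
      using vol \<theta> h step0[of n] volatility_class_of_square_class[OF constants(3) c0 alt_class[OF step0, of n]]
      by (simp add: q2_def param_space_def inside_def add_pos_nonneg)
    have nonneg: "0 \<le> base_vol (step n) t" "0 \<le> alt_vol (step n) t" "0 \<le> noise_vol (step n) t" if "inside n" "t \<in> {0..T}" for n t
      using base_class[OF step0, of n] alt_class[OF step0, of n] that order_trans[OF zero_le_power2[of c']]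
      by (auto simp: square_class_def inside_def)
    have loc1: "local_sequence T \<alpha> c c' p q1"
      unfolding local_sequence_def
    proof (intro conjI allI q1_mem exI)
      show "\<forall>\<^sub>F n in sequentially. fst (q1 n) = fst p + step n * 0
        \<and> (\<forall>t\<in>{0..T}. (fst (snd (q1 n)) t)\<^sup>2 = (fst (snd p) t)\<^sup>2 + step n * (m - S t))
        \<and> (\<forall>t\<in>{0..T}. (snd (snd (q1 n)) t)\<^sup>2 = (snd (snd p) t)\<^sup>2 + step n * (m - S' t))"
        using ev_inside
      proof eventually_elim
        case (elim n)
        then show ?case
          using nonneg(1,3)[OF elim] by (simp add: q1_def p_eq) (simp add: base_vol_def noise_vol_def S_def S'_def)
      qed
    qed
    have loc2: "local_sequence T \<alpha> c c' p q2"
      unfolding local_sequence_def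
    proof (intro conjI allI q2_mem exI)
      show "\<forall>\<^sub>F n in sequentially. fst (q2 n) = fst p + step n * h
        \<and> (\<forall>t\<in>{0..T}. (fst (snd (q2 n)) t)\<^sup>2 = (fst (snd p) t)\<^sup>2 + step n * (m + tilt t - S t))
        \<and> (\<forall>t\<in>{0..T}. (snd (snd (q2 n)) t)\<^sup>2 = (snd (snd p) t)\<^sup>2 + step n * (m - S' t))"
        using ev_inside
      proof eventually_elim
        case (elim n)
        then show ?case
          using nonneg(2,3)[OF elim] by (simp add: q2_def p_eq) (simp add: alt_vol_def noise_vol_def S_def S'_def)
      qed
    qed
    define law1 where "law1 n = data_law (M (q1 n)) T n (X1 (q1 n)) (X2 (q1 n))" for n
    define law2 where "law2 n = data_law (M (q2 n)) T n (X1 (q2 n)) (X2 (q2 n))" for n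
    have sets_law [measurable_cong]: "sets (law1 n) = sets (data_space n)" "sets (law2 n) = sets (data_space n)" for n
      by (simp_all add: law1_def law2_def data_law_def)
    have prob: "prob_space (law1 n)" "prob_space (law2 n)" for n
      unfolding law1_def law2_def by (rule prob_space_data_law[OF model[OF q1_mem] T] prob_space_data_law[OF model[OF q2_mem] T])+
    define Z where "Z n y = (est n y - \<theta>) / step n" for n y
    have Z: "Z n \<in> borel_measurable (data_space n)" if "1 \<le> n" for n
      using estimator[OF that] unfolding Z_def[abs_def] by simp
    \<comment> \<open>One statement for both sequences: the square roots in the parameters cancel
      against the squares in the variances.\<close>
    have law_eq: "data_law (M q) T n (X1 q) (X2 q) = distr (\<Pi>\<^sub>M i\<in>{1..n}. pair_law (a i) (noise_cell n i) (\<rho> \<theta>')) (data_space n) (observe n)"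
      if n: "inside n" and q: "q = (\<theta>', \<lambda>t. sqrt (v t), \<lambda>t. sqrt (noise_vol (step n) t))" "q \<in> param_space T \<alpha> c c'"
        and v: "(v, noise_vol (step n)) \<in> square_class T \<alpha> c c'"
        and a: "a = cell_integral T n (\<lambda>s. (k \<theta>')\<^sup>2 * exp (2 * \<theta>' * s) * v s)" for n q \<theta>' v a
    proof -
      have vpos: "0 < v t" "0 < noise_vol (step n) t" if "t \<in> {0..T}" for t
      proof -
        have "c'\<^sup>2 \<le> v t" "c'\<^sup>2 \<le> noise_vol (step n) t"
          using v that by (simp_all add: square_class_def)
        then show "0 < v t" "0 < noise_vol (step n) t"
          using zero_less_power[OF constants(3), of 2] by linarith+
      qed
      have law: "data_law (M q) T n (X1 q) (X2 q) = distr (\<Pi>\<^sub>M i\<in>{1..n}.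
          pair_law (cell_integral T n (\<lambda>s. (k \<theta>')\<^sup>2 * exp (2 * \<theta>' * s) * (sqrt (v s))\<^sup>2) i)
            (cell_integral T n (\<lambda>s. (sqrt (noise_vol (step n) s))\<^sup>2) i) (\<rho> \<theta>')) (data_space n) (observe n)"
      proof (rule data_law_eq)
        show "two_factor_model (M q) T T1 T2 x1 x2 (\<theta>', \<lambda>t. sqrt (v t), \<lambda>t. sqrt (noise_vol (step n) t)) (B q) (B' q) (X1 q) (X2 q)"
          unfolding q(1)[symmetric] by (rule model[OF q(2)])
        show "continuous_on {0..T} (\<lambda>t. sqrt (v t))" "continuous_on {0..T} (\<lambda>t. sqrt (noise_vol (step n) t))"
          using square_class_continuous[OF v \<alpha>] by (auto intro!: continuous_intros)
        show "0 < \<theta>'" using q by (simp add: param_space_def)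
        show "1 \<le> n" using n by (simp add: inside_def)
        show "0 < sqrt (v t)" "0 < sqrt (noise_vol (step n) t)" if "t \<in> {0..T}" for t
          using vpos[OF that] by (simp_all only: real_sqrt_gt_0_iff)
      qed (rule T T12)+
      have cells: "cell_integral T n (\<lambda>s. (k \<theta>')\<^sup>2 * exp (2 * \<theta>' * s) * (sqrt (v s))\<^sup>2) i = a i"
        "cell_integral T n (\<lambda>s. (sqrt (noise_vol (step n) s))\<^sup>2) i = noise_cell n i" if "i \<in> {1..n}" for i
        unfolding a by (rule cell_integral_cong[OF T that]; use vpos in \<open>simp add: less_imp_le\<close>)+
      have "(\<Pi>\<^sub>M i\<in>{1..n}. pair_law (cell_integral T n (\<lambda>s. (k \<theta>')\<^sup>2 * exp (2 * \<theta>' * s) * (sqrt (v s))\<^sup>2) i)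
            (cell_integral T n (\<lambda>s. (sqrt (noise_vol (step n) s))\<^sup>2) i) (\<rho> \<theta>')) = (\<Pi>\<^sub>M i\<in>{1..n}. pair_law (a i) (noise_cell n i) (\<rho> \<theta>'))"
        by (intro PiM_cong refl) (simp only: cells)
      then show ?thesis unfolding law by (simp only:)
    qed
    have law1_eq: "law1 n = distr (\<Pi>\<^sub>M i\<in>{1..n}. pair_law (base_cell n i) (noise_cell n i) (\<rho> \<theta>)) (data_space n) (observe n)"
      if n: "inside n" for n
      unfolding law1_def
      by (rule law_eq[OF n _ q1_mem base_class[OF step0]]) (use n in \<open>auto simp: q1_def inside_def base_var_def[abs_def]\<close>)
    have law2_eq: "law2 n = distr (\<Pi>\<^sub>M i\<in>{1..n}. pair_law (alt_cell n i) (noise_cell n i) (\<rho> (\<theta> + step n * h))) (data_space n) (observe n)"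
      if n: "inside n" for n
      unfolding law2_def
      by (rule law_eq[OF n _ q2_mem alt_class[OF step0]]) (use n in \<open>auto simp: q2_def inside_def alt_var_def[abs_def]\<close>)
    define K where "K = exp ((D * h)\<^sup>2 * W + \<eta>) - 1"
    have "(sin (u * h) * exp (- (V p * u\<^sup>2) / 2))\<^sup>2 \<le> (1 - exp (- (2 * V p * u\<^sup>2))) / 2 * K" for u
    proof (rule shifted_normal_limit_bound[OF prob])
      show "Z n \<in> borel_measurable (law1 n)" "Z n \<in> borel_measurable (law2 n)" if "1 \<le> n" for n
        using Z[OF that] by (simp_all only: measurable_cong_sets[OF sets_law(1) refl] measurable_cong_sets[OF sets_law(2) refl])
      have "fst (q1 n) = \<theta>" for n by (simp add: q1_def p_eq)
      then show "weak_conv_m (\<lambda>n. distr (law1 n) borel (Z n)) (centered_normal (V p))"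
        using normality[OF p loc1] by (simp add: law1_def[abs_def] Z_def[abs_def])
      show "weak_conv_m (\<lambda>n. distr (law2 n) borel (\<lambda>y. (est n y - fst (q2 n)) / step n)) (centered_normal (V p))"
        using normality[OF p loc2] by (simp add: law2_def[abs_def])
      show "(est n y - fst (q2 n)) / step n = Z n y - h" if "1 \<le> n" for n y
      proof -
        have "step n \<noteq> 0" using that T by simp
        moreover have "(x - (\<theta> + e * h)) / e = (x - \<theta>) / e - h" if "e \<noteq> 0" for x e :: real
          using that by (simp add: diff_divide_distrib add_divide_distrib)
        ultimately show ?thesis by (simp only: q2_def fst_conv Z_def)
      qed
      show "0 \<le> V p" by (rule variance[OF p])
      show "\<forall>\<^sub>F n in sequentially. ((\<integral>y. sin (u * Z n y) \<partial>law2 n) - (\<integral>y. sin (u * Z n y) \<partial>law1 n))\<^sup>2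
          \<le> (\<integral>y. (sin (u * Z n y))\<^sup>2 \<partial>law1 n) * K"
        using chi_square_limit[OF D \<eta>] ev_inside
      proof eventually_elim
        case (elim n)
        then have "1 \<le> n" by (simp add: inside_def)
        have "((\<integral>y. sin (u * Z n y) \<partial>law2 n) - (\<integral>y. sin (u * Z n y) \<partial>law1 n))\<^sup>2
            \<le> (\<integral>y. (sin (u * Z n y))\<^sup>2 \<partial>law1 n) * ((\<Prod>i\<in>{1..n}. 1 / sqrt (1 - excess n i)) - 1)"
          unfolding law1_eq[OF elim(2)] law2_eq[OF elim(2)] excess_def
        proof (rule regression_chi_square_bound)
          show "(\<lambda>y. sin (u * Z n y)) \<in> borel_measurable (data_space n)"
            using Z[OF \<open>1 \<le> n\<close>] by simp
        qed (use elim(1) in \<open>auto simp: excess_def\<close>)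
        also have "\<dots> \<le> (\<integral>y. (sin (u * Z n y))\<^sup>2 \<partial>law1 n) * K"
          using elim(1) by (intro mult_left_mono) (auto simp: K_def W_eq)
        finally show ?case .
      qed
    qed
    then have "h\<^sup>2 \<le> V p * K"
    proof (rule small_frequency_bound[OF variance[OF p], rotated])
      have "0 \<le> (D * h)\<^sup>2 * W + \<eta>" using W \<eta> by simp
      then show "0 \<le> K" by (simp add: K_def)
    qed
    then show ?thesis by (simp add: K_def power_mult_distrib mult_ac)
  qed
  have D0: "D \<noteq> 0" using times(3) \<theta> by (simp add: D_def price_scale_def)
  have "1 \<le> V p * (D\<^sup>2 * W)"
    by (rule small_shift_bound[OF variance[OF p] _ h0 key]) (use W in auto)
  then show "V_opt T T1 T2 p \<le> V p"
    unfolding Vopt using W D0 by (simp add: pos_divide_le_eq)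
qed

end
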